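(* Let $\eta$ be a (sample continuous) simple max-stable random field on a locally compact metric space $T$. For all compact $S\subset T$, $$C(S):=\mathbb{E}\big[\sup\{\eta(s)^{-1}:\ s\in S\}\big]<\infty,$$ and furthermore: (1) For all disjoint compact subsets $S_1,S_2\subset T$, $$\beta(S_1,S_2)\leq 2\,[C(S_1)+C(S_2)]\,[\theta(S_1)+\theta(S_2)-\theta(S_1\cup S_2)].$$ (2) For $(S_{1,i})_{i\in I}$ and $(S_{2,j})_{j\in J}$ countable families of compact subsets of $T$ such that $S_1=\bigcup_{i\in I}S_{1,i}$ and $S_2=\bigcup_{j\in J}S_{2,j}$ are disjoint and closed, $$\beta(S_1,S_2)\leq 2\sum_{i\in I}\sum_{j\in J}[C(S_{1,i})+C(S_{2,j})]\,[\theta(S_{1,i})+\theta(S_{2,j})-\theta(S_{1,i}\cup S_{2,j})].$$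
   Context: A random field $\eta=(\eta(t))_{t\in T}$ with continuous sample paths is simple max-stable if it is max-stable with standard unit Fréchet marginals: $\mathbb P[\eta(t)\le y]=\exp[-y^{-1}]1_{\{y>0\}}$ for $y\in\mathbb R$, $t\in T$, and for every $n\ge1$ the pointwise maximum of $n$ i.i.d. copies of $\eta$ has the same law as $n\eta$. For compact $S\subset T$, the extremal coefficient $\theta(S)$ is defined by $\mathbb P[\sup_{s\in S}\eta(s)\le y]=\exp[-\theta(S)y^{-1}]$, $y>0$. Mixing coefficient. For closed $S\subset T$, $\mathcal P_S$ is the distribution of the restriction $\eta_S$ of $\eta$ to $S$, on the space $\mathbb C(S)$ of continuous functions on $S$ (topology of uniform convergence on compact sets) with its Borel $\sigma$-field $\mathcal C_S$. For disjoint closed $S_1,S_2$, $\mathbb C(S_1\cup S_2)$ is identified with $\mathbb C(S_1)\times\mathbb C(S_2)$, and $$\beta(S_1,S_2)=\sup\{|\mathcal P_{S_1\cup S_2}(C)-(\mathcal P_{S_1}\otimes\mathcal P_{S_2})(C)|:\ C\in\mathcal C_{S_1\cup S_2}\}.$$ *)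

theory Defs
  imports "HOL-Probability.Probability"
begin

(* Functions on S are represented as functions on the whole type that are undefined outside S. *)
definition cts_on :: "'t::metric_space set \<Rightarrow> ('t \<Rightarrow> real) set" where
  "cts_on S = {f \<in> extensional S. continuous_on S f}"

definition ucc_ball :: "'t::metric_space set \<Rightarrow> ('t \<Rightarrow> real) \<Rightarrow> 't set \<Rightarrow> real \<Rightarrow> ('t \<Rightarrow> real) set" where
  "ucc_ball S f K e = {g \<in> cts_on S. \<forall>x\<in>K. \<bar>g x - f x\<bar> < e}"

definition ucc_open :: "'t::metric_space set \<Rightarrow> ('t \<Rightarrow> real) set \<Rightarrow> bool" where
  "ucc_open S U \<longleftrightarrow> U \<subseteq> cts_on S \<and>
     (\<forall>f\<in>U. \<exists>K e. compact K \<and> K \<subseteq> S \<and> e > 0 \<and> ucc_ball S f K e \<subseteq> U)"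

(* Topology of uniform convergence on compact subsets of S. *)
definition ucc_topology :: "'t::metric_space set \<Rightarrow> ('t \<Rightarrow> real) topology" where
  "ucc_topology S = topology (ucc_open S)"

lemma ucc_openD:
  assumes "ucc_open S U" "f \<in> U"
  obtains K e where "compact K" "K \<subseteq> S" "e > 0" "ucc_ball S f K e \<subseteq> U"
  using assms unfolding ucc_open_def by meson

lemma ucc_open_Int:
  assumes U: "ucc_open S U" and V: "ucc_open S V"
  shows "ucc_open S (U \<inter> V)"
  unfolding ucc_open_def
proof (intro conjI ballI)
  show "U \<inter> V \<subseteq> cts_on S" using U by (auto simp: ucc_open_def)
  fix f assume f: "f \<in> U \<inter> V"
  obtain K d where K: "compact K" "K \<subseteq> S" "d > 0" "ucc_ball S f K d \<subseteq> U"
    using U f by (meson IntD1 ucc_openD)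
  obtain L e where L: "compact L" "L \<subseteq> S" "e > 0" "ucc_ball S f L e \<subseteq> V"
    using V f by (meson IntD2 ucc_openD)
  have "ucc_ball S f (K \<union> L) (min d e) \<subseteq> ucc_ball S f K d \<inter> ucc_ball S f L e"
    by (auto simp: ucc_ball_def)
  then have "ucc_ball S f (K \<union> L) (min d e) \<subseteq> U \<inter> V"
    using K(4) L(4) by blast
  moreover have "compact (K \<union> L)" "K \<union> L \<subseteq> S" "min d e > 0"
    using K L by (simp_all add: compact_Un)
  ultimately show "\<exists>K e. compact K \<and> K \<subseteq> S \<and> e > 0 \<and> ucc_ball S f K e \<subseteq> U \<inter> V"
    by meson
qed

lemma ucc_open_Union:
  assumes "\<forall>U\<in>\<U>. ucc_open S U"
  shows "ucc_open S (\<Union>\<U>)"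
  unfolding ucc_open_def
proof (intro conjI ballI)
  show "\<Union>\<U> \<subseteq> cts_on S" using assms by (auto simp: ucc_open_def)
  fix f assume "f \<in> \<Union>\<U>"
  then obtain U where U: "U \<in> \<U>" "f \<in> U" by (rule UnionE)
  obtain K e where K: "compact K" "K \<subseteq> S" "e > 0" "ucc_ball S f K e \<subseteq> U"
    using assms U by (meson ucc_openD)
  have "ucc_ball S f K e \<subseteq> \<Union>\<U>"
    using K(4) U(1) by (meson Union_upper subset_trans)
  then show "\<exists>K e. compact K \<and> K \<subseteq> S \<and> e > 0 \<and> ucc_ball S f K e \<subseteq> \<Union>\<U>"
    using K(1-3) by meson
qed

lemma openin_ucc_topology: "openin (ucc_topology S) U \<longleftrightarrow> ucc_open S U"
proof -
  have "istopology (ucc_open S)"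
    unfolding istopology_def using ucc_open_Int[of S] ucc_open_Union[of _ S] by simp
  then show ?thesis
    by (simp add: ucc_topology_def topology_inverse')
qed

lemma topspace_ucc_topology: "topspace (ucc_topology S) = cts_on S"
proof
  have "ucc_open S (topspace (ucc_topology S))"
    using openin_topspace[of "ucc_topology S"] unfolding openin_ucc_topology .
  then show "topspace (ucc_topology S) \<subseteq> cts_on S"
    by (simp add: ucc_open_def)
  have "ucc_ball S f {} 1 \<subseteq> cts_on S" for f
    by (auto simp: ucc_ball_def)
  then have "ucc_open S (cts_on S)"
    unfolding ucc_open_def using compact_empty empty_subsetI zero_less_one by (metis order_refl)
  then show "cts_on S \<subseteq> topspace (ucc_topology S)"
    by (simp add: openin_ucc_topology openin_subset)
qed

definition borel_cts :: "'t::metric_space set \<Rightarrow> ('t \<Rightarrow> real) measure" where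
  "borel_cts S = sigma (cts_on S) {U. openin (ucc_topology S) U}"

(* The law of a field is taken on the product sigma-field, i.e. it encodes
   exactly the finite-dimensional distributions. *)
definition field_law :: "'w measure \<Rightarrow> ('t \<Rightarrow> 'w \<Rightarrow> real) \<Rightarrow> ('t \<Rightarrow> real) measure" where
  "field_law M X = distr M (PiM UNIV (\<lambda>_. borel)) (\<lambda>\<omega> t. X t \<omega>)"

(* The n i.i.d. copies of \<eta> are realised on the n-fold product of M,
   the i-th copy being \<eta> evaluated at the i-th coordinate. *)
definition simple_max_stable :: "'w measure \<Rightarrow> ('t::metric_space \<Rightarrow> 'w \<Rightarrow> real) \<Rightarrow> bool" where
  "simple_max_stable M \<eta> \<longleftrightarrow>
     prob_space M \<and>
     (\<forall>t. \<eta> t \<in> borel_measurable M) \<and>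
     (\<forall>\<omega>\<in>space M. continuous_on UNIV (\<lambda>t. \<eta> t \<omega>)) \<and>
     (\<forall>t y. measure M {\<omega> \<in> space M. \<eta> t \<omega> \<le> y} = (if y > 0 then exp (- (1 / y)) else 0)) \<and>
     (\<forall>n::nat. n \<ge> 1 \<longrightarrow>
        field_law (PiM {..<n} (\<lambda>_. M)) (\<lambda>t \<omega>. MAX i\<in>{..<n}. \<eta> t (\<omega> i))
          = field_law M (\<lambda>t \<omega>. real n * \<eta> t \<omega>))"

(* The supremum is formed in ereal, so that it is also defined for empty S. *)
definition extremal_coeff :: "'w measure \<Rightarrow> ('t::metric_space \<Rightarrow> 'w \<Rightarrow> real) \<Rightarrow> 't set \<Rightarrow> real" where
  "extremal_coeff M \<eta> S = (THE \<theta>. \<forall>y>0.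
     measure M {\<omega> \<in> space M. (SUP s\<in>S. ereal (\<eta> s \<omega>)) \<le> ereal y} = exp (- (\<theta> / y)))"

(* The inverse is formed in ennreal, where the inverse of 0 is infinity (in real it would be 0). *)
definition inv_sup_expectation :: "'w measure \<Rightarrow> ('t::metric_space \<Rightarrow> 'w \<Rightarrow> real) \<Rightarrow> 't set \<Rightarrow> ennreal" where
  "inv_sup_expectation M \<eta> S = (\<integral>\<^sup>+\<omega>. (SUP s\<in>S. inverse (ennreal (\<eta> s \<omega>))) \<partial>M)"

definition restr_law :: "'w measure \<Rightarrow> ('t::metric_space \<Rightarrow> 'w \<Rightarrow> real) \<Rightarrow> 't set \<Rightarrow> ('t \<Rightarrow> real) measure" where
  "restr_law M \<eta> S = distr M (borel_cts S) (\<lambda>\<omega>. restrict (\<lambda>t. \<eta> t \<omega>) S)"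

(* The map merge S1 S2 glues functions on S1 and on S2 to a function on their union;
   it is the identification of C(S1) x C(S2) with C(S1 Un S2). *)
definition mixing_coeff :: "'w measure \<Rightarrow> ('t::metric_space \<Rightarrow> 'w \<Rightarrow> real) \<Rightarrow> 't set \<Rightarrow> 't set \<Rightarrow> real" where
  "mixing_coeff M \<eta> S1 S2 =
     (SUP C\<in>sets (borel_cts (S1 \<union> S2)).
        \<bar>measure (restr_law M \<eta> (S1 \<union> S2)) C
          - measure (distr (restr_law M \<eta> S1 \<Otimes>\<^sub>M restr_law M \<eta> S2)
                       (borel_cts (S1 \<union> S2)) (merge S1 S2)) C\<bar>)"

end

theory Submission
  imports Defs
begin

text \<open>The bound is obtained by Lindeberg replacement. By max-stability \<open>\<eta>\<close> has the law of the maximum of \<open>n\<close>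
  independent copies of \<open>\<eta> / n\<close>; in each copy the restriction to \<open>S2\<close> is replaced, one copy at a time, by
  that of a fresh independent copy, which leads from the law of \<open>\<eta>\<close> on \<open>S1 \<union> S2\<close> to the product law.
  A replacement can change the probability of an event only if the copy exceeds the maximum of all
  the other copies both somewhere on \<open>S1\<close> and somewhere on \<open>S2\<close>. Let \<open>1 / z\<close> be the infimum of that maximum;
  writing \<open>\<theta>12\<close> for the extremal coefficient of \<open>S1 \<union> S2\<close>, the probability that \<open>\<eta> / n\<close> exceeds \<open>1 / z\<close>
  on both sets is \<open>(\<theta>1 + \<theta>2 - \<theta>12) z / n + O(z\<^sup>2 / n\<^sup>2)\<close>, and the expectation of \<open>z\<close> is asymptotically
  at most \<open>C(S1) + C(S2)\<close>. Summing the \<open>n\<close> steps and letting \<open>n\<close> tend to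
  infinity gives the bound with its factor 2; events are first reduced to finitely many coordinates,
  so that only finitely many pieces of \<open>S1\<close> and \<open>S2\<close> matter. Finiteness of \<open>C(S)\<close> comes from
  \<open>P(inf \<eta> < y / n) \<le> P(inf \<eta> < y) ^ n\<close> on small balls.\<close>

section \<open>Continuous functions with the compact-open topology\<close>

text \<open>On each of S1 and S2 separately the maximum of the other copies has the law of a
  multiple of \<eta>, however many copies have been replaced; only the dependence between the two
  sets changes. So the expectations needed are the same at every step, and the reciprocal of the
  infimum over both sets is bounded by the sum of the two reciprocals, whence C(S1) + C(S2). The
  factor 2 bounds a mixed difference of a [0,1]-valued function. The terms quadratic in z, among
  them all that the independent copies contribute (their chance of a double exceedance is a
  product), vanish in the limit, but only if z is square integrable; this is why second moments are
  estimated. Two obstacles shape the rest. Max-stability concerns finite-dimensional distributions,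
  whereas \<beta> concerns Borel sets of functions on a space that need not be separable; hence
  Borel sets are written as traces of product-measurable sets. And \<eta>(t) > 0 holds only almost
  surely, for each t separately; the algebra of maxima is therefore carried out with truncated
  paths, which agree with \<eta> almost surely on every finite set of points.\<close>

lemma compact_countable_dense:
  fixes S :: "'t::metric_space set"
  assumes "compact S"
  obtains D where "countable D" "D \<subseteq> S" "S \<subseteq> closure D"
proof -
  have "\<forall>n::nat. \<exists>k. finite k \<and> k \<subseteq> S \<and> S \<subseteq> (\<Union>x\<in>k. ball x (1 / Suc n))"
    using seq_compact_imp_totally_bounded[of S] assms
    by (simp add: compact_imp_seq_compact)
  then obtain k where k: "\<And>n. finite (k n)" "\<And>n. k n \<subseteq> S"
      "\<And>n. S \<subseteq> (\<Union>x\<in>k n. ball x (1 / Suc n))"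
    by metis
  have "S \<subseteq> closure (\<Union>n. k n)"
  proof
    fix x assume "x \<in> S"
    show "x \<in> closure (\<Union>n. k n)"
      unfolding closure_approachable
    proof (intro allI impI)
      fix e :: real assume "e > 0"
      then obtain n where n: "1 / Suc n < e" using nat_approx_posE by blast
      obtain y where "y \<in> k n" "dist y x < 1 / Suc n" using k(3)[of n] \<open>x \<in> S\<close> by auto
      then show "\<exists>y\<in>\<Union>(range k). dist y x < e" using n by force
    qed
  qed
  then show thesis using k that[of "\<Union>n. k n"] by (auto intro: countable_finite)
qed

text \<open>Each \<open>A i\<close> is covered by finitely many open sets that lie in compact sets;
  the finite unions of these compact sets, cut down to the closed union, absorb every compact
  subset. Local compactness is the point: the rationals are a countable union of points without such
  a family. It makes compact convergence countable enough for
  \<open>ucc_open_trace_PiM\<close>.\<close>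

lemma hemicompact:
  fixes A :: "'i \<Rightarrow> 't::metric_space set"
  assumes lc: "locally_compact_space (euclidean :: 't topology)"
    and I: "countable I" and A: "\<And>i. i \<in> I \<Longrightarrow> compact (A i)" and cl: "closed (\<Union>i\<in>I. A i)"
  obtains \<K> where "countable \<K>" "\<And>K. K \<in> \<K> \<Longrightarrow> compact K \<and> K \<subseteq> (\<Union>i\<in>I. A i)"
    "\<And>K. compact K \<Longrightarrow> K \<subseteq> (\<Union>i\<in>I. A i) \<Longrightarrow> \<exists>L\<in>\<K>. K \<subseteq> L"
proof -
  let ?S = "\<Union>i\<in>I. A i"
  have "\<forall>x::'t. \<exists>U K. open U \<and> compact K \<and> x \<in> U \<and> U \<subseteq> K"
    using lc by (simp add: locally_compact_space_def)
  then obtain U K where UK: "\<And>x::'t. open (U x)" "\<And>x. compact (K x)" "\<And>x. x \<in> U x" "\<And>x. U x \<subseteq> K x"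
    by metis
  have "\<exists>F. finite F \<and> A i \<subseteq> (\<Union>x\<in>F. U x)" if "i \<in> I" for i
  proof -
    have "A i \<subseteq> (\<Union>x\<in>A i. U x)" using UK(3) by auto
    then show ?thesis using compactE_image[OF A[OF that], of "A i" U] UK(1) by metis
  qed
  then obtain F where F: "\<And>i. i \<in> I \<Longrightarrow> finite (F i)" "\<And>i. i \<in> I \<Longrightarrow> A i \<subseteq> (\<Union>x\<in>F i. U x)"
    by metis
  define P where "P = (\<Union>i\<in>I. F i)"
  have P: "countable P" using F(1) I by (auto simp: P_def intro: countable_finite)
  define \<K> where "\<K> = (\<lambda>G. ?S \<inter> (\<Union>x\<in>G. K x)) ` {G. finite G \<and> G \<subseteq> P}"
  show thesis
  proof
    show "countable \<K>" unfolding \<K>_def using P by (intro countable_image countable_Collect_finite_subset)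
    show "compact L \<and> L \<subseteq> ?S" if "L \<in> \<K>" for L
      using that cl UK(2) by (auto simp: \<K>_def intro!: closed_Int_compact compact_UN)
    show "\<exists>L\<in>\<K>. C \<subseteq> L" if C: "compact C" "C \<subseteq> ?S" for C
    proof -
      have "C \<subseteq> (\<Union>x\<in>P. U x)" using C(2) F(2) unfolding P_def by blast
      then obtain G where G: "G \<subseteq> P" "finite G" "C \<subseteq> (\<Union>x\<in>G. U x)"
        using compactE_image[OF C(1), of P U] UK(1) by metis
      have "(\<Union>x\<in>G. U x) \<subseteq> (\<Union>x\<in>G. K x)" using UK(4) by (rule UN_mono[OF order_refl])
      then have "C \<subseteq> ?S \<inter> (\<Union>x\<in>G. K x)" using C(2) G(3) by simp
      then show ?thesis using G by (auto simp: \<K>_def)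
    qed
  qed
qed

section \<open>Borel sets of the function space as traces of product-measurable sets\<close>

lemma space_borel_cts [simp]: "space (borel_cts S) = cts_on S"
  unfolding borel_cts_def using openin_subset[of "ucc_topology S"]
  by (subst space_measure_of) (auto simp: topspace_ucc_topology)

lemma sets_borel_cts: "sets (borel_cts S) = sigma_sets (cts_on S) {U. ucc_open S U}"
  unfolding borel_cts_def openin_ucc_topology
  by (subst sets_measure_of) (auto simp: ucc_open_def)

lemma measurable_eval_borel_cts:
  assumes "t \<in> S"
  shows "(\<lambda>f. f t) \<in> borel_measurable (borel_cts S)"
proof (rule borel_measurableI)
  fix V :: "real set" assume V: "open V"
  have "ucc_open S {f \<in> cts_on S. f t \<in> V}"
    unfolding ucc_open_def
  proof (intro conjI ballI)
    fix f assume f: "f \<in> {f \<in> cts_on S. f t \<in> V}"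
    then obtain e where e: "e > 0" "\<And>y. dist y (f t) < e \<Longrightarrow> y \<in> V"
      using V unfolding open_dist by blast
    then have "ucc_ball S f {t} e \<subseteq> {f \<in> cts_on S. f t \<in> V}"
      by (auto simp: ucc_ball_def dist_real_def)
    then show "\<exists>K e. compact K \<and> K \<subseteq> S \<and> e > 0 \<and> ucc_ball S f K e \<subseteq> {f \<in> cts_on S. f t \<in> V}"
      using e assms by (intro exI[of _ "{t}"] exI[of _ e]) auto
  qed auto
  moreover have "(\<lambda>f. f t) -` V \<inter> space (borel_cts S) = {f \<in> cts_on S. f t \<in> V}" by auto
  ultimately show "(\<lambda>f. f t) -` V \<inter> space (borel_cts S) \<in> sets (borel_cts S)"
    by (simp add: sets_borel_cts sigma_sets.Basic)
qed

lemma measurable_borel_cts_PiM: "(\<lambda>f. f) \<in> measurable (borel_cts S) (PiM S (\<lambda>_. borel))"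
  by (rule measurable_PiM_single')
    (auto simp: measurable_eval_borel_cts space_borel_cts cts_on_def PiE_def)

text \<open>The approximating sets prescribe rational values, up to \<open>1 / k\<close>, on finitely many small balls
  covering a compact set; there are only countably many of them.\<close>

lemma ucc_open_trace_PiM:
  fixes S :: "'t::metric_space set"
  assumes \<K>: "countable \<K>" "\<And>K. K \<in> \<K> \<Longrightarrow> compact K \<and> K \<subseteq> S"
    "\<And>K. compact K \<Longrightarrow> K \<subseteq> S \<Longrightarrow> \<exists>L\<in>\<K>. K \<subseteq> L"
    and U: "ucc_open S U"
  shows "\<exists>E\<in>sets (PiM S (\<lambda>_. borel)). U = E \<inter> cts_on S"
proof -
  have "\<exists>D. countable D \<and> D \<subseteq> K \<and> K \<subseteq> closure D" if "K \<in> \<K>" for K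
    using compact_countable_dense[of K] \<K>(2)[OF that] by metis
  then obtain D where D: "\<And>K. K \<in> \<K> \<Longrightarrow> countable (D K)" "\<And>K. K \<in> \<K> \<Longrightarrow> D K \<subseteq> K"
      "\<And>K. K \<in> \<K> \<Longrightarrow> K \<subseteq> closure (D K)"
    by metis
  \<comment> \<open>\<open>K\<close> is the compact set, \<open>1 / Suc m\<close> the radius of the
    balls, \<open>1 / Suc k\<close> the tolerance, and \<open>L\<close> pairs centres with values.
    The condition is tested only on the countable dense set \<open>D K\<close>, which keeps
    \<open>W\<close> product-measurable; for continuous \<open>g\<close> it extends by closure to
    all points of \<open>K\<close> in these balls.\<close>
  define W where "W = (\<lambda>(K, m::nat, k::nat, L). {g \<in> PiE S (\<lambda>_. UNIV :: real set).
      \<forall>(d,q)\<in>L. \<forall>x\<in>D K \<inter> ball d (1 / Suc m). \<bar>g x - q\<bar> \<le> 1 / Suc k})"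
  define \<I> where "\<I> = (SIGMA K:\<K>. (UNIV::nat set) \<times> (UNIV::nat set) \<times> {L. finite L \<and> L \<subseteq> D K \<times> (\<rat> :: real set)})"
  have cI: "countable \<I>"
    unfolding \<I>_def using \<K>(1) D(1) countable_rat
    by (intro countable_SIGMA countable_Collect_finite_subset) auto
  have Wm: "W i \<in> sets (PiM S (\<lambda>_. borel))" if "i \<in> \<I>" for i
  proof -
    obtain K m k L where i: "i = (K,m,k,L)" "K \<in> \<K>" "finite L" using \<open>i \<in> \<I>\<close> by (auto simp: \<I>_def)
    have "{g \<in> space (PiM S (\<lambda>_. borel)). \<forall>l\<in>L. \<forall>x\<in>D K \<inter> ball (fst l) (1 / Suc m). \<bar>g x - snd l\<bar> \<le> 1 / Suc k}
        \<in> sets (PiM S (\<lambda>_. borel :: real measure))"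
    proof (intro sets.sets_Collect_countable_All' sets.sets_Collect_countable_Ball)
      show "countable L" using i(3) by (rule countable_finite)
      show "countable (D K \<inter> ball (fst l) (1 / Suc m))" for l :: "'t \<times> real"
        using D(1)[OF i(2)] by blast
      fix l :: "'t \<times> real" and x assume "x \<in> D K \<inter> ball (fst l) (1 / Suc m)"
      then have [measurable]: "(\<lambda>g. g x) \<in> borel_measurable (PiM S (\<lambda>_. borel :: real measure))"
        using D(2) \<K>(2) i(2) by (intro measurable_component_singleton) blast
      show "{g \<in> space (PiM S (\<lambda>_. borel)). \<bar>g x - snd l\<bar> \<le> 1 / Suc k} \<in> sets (PiM S (\<lambda>_. borel :: real measure))"
        by measurable
    qed
    then show ?thesis by (simp add: W_def i space_PiM case_prod_unfold)
  qed
  define E where "E = (\<Union>i\<in>{i\<in>\<I>. W i \<inter> cts_on S \<subseteq> U}. W i)"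
  have "E \<in> sets (PiM S (\<lambda>_. borel))"
    unfolding E_def by (intro sets.countable_UN'') (auto intro: Wm countable_subset[OF _ cI])
  moreover have "U = E \<inter> cts_on S"
  proof
    show "E \<inter> cts_on S \<subseteq> U" by (auto simp: E_def)
    show "U \<subseteq> E \<inter> cts_on S"
    proof
      fix f assume f: "f \<in> U"
      then have fS: "f \<in> cts_on S" using U by (auto simp: ucc_open_def)
      obtain K0 e where K0: "compact K0" "K0 \<subseteq> S" "e > 0" "ucc_ball S f K0 e \<subseteq> U"
        using ucc_openD[OF U f] by metis
      obtain K where K: "K \<in> \<K>" "K0 \<subseteq> K" using \<K>(3) K0 by blast
      have cK: "compact K" "K \<subseteq> S" using \<K>(2) K by auto
      obtain k where k: "1 / Suc k < e / 2" using nat_approx_posE[of "e/2"] K0 by auto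
      have "continuous_on K f" using fS cK(2) continuous_on_subset by (auto simp: cts_on_def)
      then have "uniformly_continuous_on K f" using cK(1) by (rule compact_uniformly_continuous)
      \<comment> \<open>Half of the tolerance is for the oscillation of \<open>f\<close> on a ball,
        half for the rational approximation \<open>q d\<close> of \<open>f d\<close>; continuous
        members of \<open>W\<close> then differ from \<open>f\<close> by at most twice the
        tolerance, which is below \<open>e\<close>.\<close>
      moreover have "0 < 1 / (2 * real (Suc k))" by simp
      ultimately obtain \<delta> where \<delta>: "\<delta> > 0" "\<And>x y. x \<in> K \<Longrightarrow> y \<in> K \<Longrightarrow> dist y x < \<delta> \<Longrightarrow> dist (f y) (f x) < 1 / (2 * real (Suc k))"
        unfolding uniformly_continuous_on_def by meson
      obtain m where m: "1 / Suc m < \<delta>" using nat_approx_posE \<delta>(1) by blast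
      have "K \<subseteq> (\<Union>d\<in>D K. ball d (1 / Suc m))"
      proof
        fix x assume "x \<in> K"
        then have "x \<in> closure (D K)" using D(3) K(1) by auto
        then show "x \<in> (\<Union>d\<in>D K. ball d (1 / Suc m))"
          unfolding closure_approachable by (auto dest!: spec[of _ "1 / Suc m"])
      qed
      then obtain F where F: "F \<subseteq> D K" "finite F" "K \<subseteq> (\<Union>d\<in>F. ball d (1 / Suc m))"
        using compactE_image[OF cK(1), of "D K" "\<lambda>d. ball d (1 / Suc m)"] by auto
      have "\<exists>q\<in>\<rat>. \<bar>q - f d\<bar> < 1 / (2 * real (Suc k))" for d
      proof -
        have "f d - 1 / (2 * real (Suc k)) < f d + 1 / (2 * real (Suc k))" by (simp add: field_simps)
        then show ?thesis using Rats_dense_in_real[of "f d - 1 / (2 * real (Suc k))" "f d + 1 / (2 * real (Suc k))"]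
          by (metis abs_diff_less_iff add.commute)
      qed
      then obtain q where q: "\<And>d. q d \<in> \<rat>" "\<And>d. \<bar>q d - f d\<bar> < 1 / (2 * real (Suc k))" by metis
      define L where "L = (\<lambda>d. (d, q d)) ` F"
      have half: "1 / (2 * real (Suc k)) + 1 / (2 * real (Suc k)) = 1 / Suc k"
        by (simp add: field_simps)
      have fq: "\<bar>f x - q d\<bar> \<le> 1 / Suc k" if "d \<in> F" "x \<in> K" "x \<in> ball d (1 / Suc m)" for d x
      proof -
        have "dist (f x) (f d) < 1 / (2 * real (Suc k))"
          using \<delta>(2)[of d x] that F(1) D(2)[OF K(1)] m by (force simp: dist_commute)
        moreover have "\<bar>a - c\<bar> \<le> R" if "\<bar>a - b\<bar> < r" "\<bar>c - b\<bar> < r" "r + r = R" for a b c r R :: real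
          using that by linarith
        ultimately show ?thesis using q(2)[of d] half unfolding dist_real_def by blast
      qed
      have "f \<in> W (K, m, k, L)"
        unfolding W_def L_def using fS fq D(2)[OF K(1)] by (auto simp: cts_on_def PiE_def)
      moreover have "W (K, m, k, L) \<inter> cts_on S \<subseteq> ucc_ball S f K0 e"
      proof
        fix g assume g: "g \<in> W (K, m, k, L) \<inter> cts_on S"
        have "\<bar>g x - f x\<bar> < e" if "x \<in> K0" for x
        proof -
          have xK: "x \<in> K" using that K by auto
          obtain d where d: "d \<in> F" "x \<in> ball d (1 / Suc m)" using F(3) xK by auto
          have "x \<in> closure (D K \<inter> ball d (1 / Suc m))"
            using open_Int_closure_subset[of "ball d (1 / Suc m)" "D K"] d(2) D(3)[OF K(1)] xK
            by (auto simp: Int_commute)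
          moreover have "closedin (top_of_set K) {y\<in>K. \<bar>g y - q d\<bar> \<le> 1 / Suc k}"
          proof -
            have "continuous_on K g" using g cK(2) continuous_on_subset by (auto simp: cts_on_def)
            then have "continuous_on K (\<lambda>y. \<bar>g y - q d\<bar>)" by (intro continuous_intros)
            then show ?thesis using continuous_closedin_preimage[of K "\<lambda>y. \<bar>g y - q d\<bar>" "{..1 / Suc k}"]
              by (simp add: vimage_def Int_def conj_commute)
          qed
          then have "closed {y\<in>K. \<bar>g y - q d\<bar> \<le> 1 / Suc k}"
            using cK(1) compact_imp_closed closedin_closed_trans by blast
          moreover have "D K \<inter> ball d (1 / Suc m) \<subseteq> {y\<in>K. \<bar>g y - q d\<bar> \<le> 1 / Suc k}"
            using g d(1) D(2)[OF K(1)] unfolding W_def L_def by fastforce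
          ultimately have "\<bar>g x - q d\<bar> \<le> 1 / Suc k" using closure_minimal by blast
          then show ?thesis using fq[OF d(1) xK d(2)] k by linarith
        qed
        then show "g \<in> ucc_ball S f K0 e" using g by (auto simp: ucc_ball_def)
      qed
      moreover have "(K, m, k, L) \<in> \<I>" using K F q(1) by (auto simp: \<I>_def L_def)
      ultimately show "f \<in> E \<inter> cts_on S" using fS K0(4) unfolding E_def by blast
    qed
  qed
  ultimately show ?thesis by blast
qed

text \<open>A product-measurable set depends on countably many coordinates only, so over an
  uncountable S the set \<open>cts_on\<close> S is in general not of this kind, and a trace is the
  form to aim at. It is enough, since restricted paths always lie in \<open>cts_on\<close> S: the
  trace and the full set have the same preimage.\<close>

lemma borel_cts_trace_PiM:
  fixes A :: "'i \<Rightarrow> 't::metric_space set"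
  assumes lc: "locally_compact_space (euclidean :: 't topology)"
    and I: "countable I" and A: "\<And>i. i \<in> I \<Longrightarrow> compact (A i)" and cl: "closed (\<Union>i\<in>I. A i)"
    and C: "C \<in> sets (borel_cts (\<Union>i\<in>I. A i))"
  shows "\<exists>E\<in>sets (PiM (\<Union>i\<in>I. A i) (\<lambda>_. borel)). C = E \<inter> cts_on (\<Union>i\<in>I. A i)"
proof -
  let ?S = "\<Union>i\<in>I. A i"
  obtain \<K> where \<K>: "countable \<K>" "\<And>K. K \<in> \<K> \<Longrightarrow> compact K \<and> K \<subseteq> ?S"
    "\<And>K. compact K \<Longrightarrow> K \<subseteq> ?S \<Longrightarrow> \<exists>L\<in>\<K>. K \<subseteq> L"
    using hemicompact[OF lc I A cl] by metis
  have "C \<in> sigma_sets (cts_on ?S) {U. ucc_open ?S U}" using C by (simp add: sets_borel_cts)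
  then show ?thesis
  proof induction
    case (Basic a)
    then show ?case using ucc_open_trace_PiM[OF \<K>] by simp
  next
    case Empty
    then show ?case by blast
  next
    case (Compl a)
    then obtain E where E: "E\<in>sets (PiM ?S (\<lambda>_. borel))" "a = E \<inter> cts_on ?S" by blast
    have "space (PiM ?S (\<lambda>_. borel)) - E \<in> sets (PiM ?S (\<lambda>_. borel))" using E by blast
    moreover have "cts_on ?S - a = (space (PiM ?S (\<lambda>_. borel)) - E) \<inter> cts_on ?S"
      using E(2) by (auto simp: space_PiM cts_on_def PiE_def)
    ultimately show ?case by blast
  next
    case (Union a)
    then obtain E where E: "\<And>i::nat. E i \<in>sets (PiM ?S (\<lambda>_. borel))" "\<And>i. a i = E i \<inter> cts_on ?S" by metis
    then have "(\<Union>i. E i) \<in> sets (PiM ?S (\<lambda>_. borel))" by blast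
    moreover have "\<Union>(range a) = (\<Union>i. E i) \<inter> cts_on ?S" using E(2) by auto
    ultimately show ?case by blast
  qed
qed

section \<open>Approximation and tail lemmas\<close>

text \<open>Approximation by an algebra for two measures at once: the joint law and the product law
  will be compared on the approximating set, so one and the same \<open>G\<close> has to serve
  both.\<close>

lemma sigma_sets_approx:
  assumes P: "finite_measure P" "sets P = sigma_sets \<Omega> \<G>" and Q: "finite_measure Q" "sets Q = sigma_sets \<Omega> \<G>"
    and alg: "algebra \<Omega> \<G>" and E: "E \<in> sigma_sets \<Omega> \<G>" and e: "e > 0"
  shows "\<exists>G\<in>\<G>. measure P (sym_diff E G) < e \<and> measure Q (sym_diff E G) < e"
proof -
  interpret P: finite_measure P by fact
  interpret Q: finite_measure Q by fact
  interpret \<G>: algebra \<Omega> \<G> by fact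
  have GP: "G \<in> \<G> \<Longrightarrow> G \<in> sets P" and GQ: "G \<in> \<G> \<Longrightarrow> G \<in> sets Q" for G using P Q by auto
  have PQ: "sets P = sets Q" using P Q by simp
  define ap where "ap E \<longleftrightarrow> E \<in> sets P \<and>
    (\<forall>e>0. \<exists>G\<in>\<G>. measure P (sym_diff E G) < e \<and> measure Q (sym_diff E G) < e)" for E
  have ap_G: "ap G" if "G \<in> \<G>" for G
    unfolding ap_def using that GP by (auto intro!: bexI[of _ G])
  have ap_Un: "ap (A \<union> B)" if A: "ap A" and B: "ap B" for A B
    unfolding ap_def
  proof (intro conjI allI impI)
    show "A \<union> B \<in> sets P" using A B by (auto simp: ap_def)
    fix e :: real assume "e > 0"
    then have "e / 2 > 0" by simp
    then obtain G H where G: "G \<in> \<G>" "measure P (sym_diff A G) < e / 2" "measure Q (sym_diff A G) < e / 2"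
      and H: "H \<in> \<G>" "measure P (sym_diff B H) < e / 2" "measure Q (sym_diff B H) < e / 2"
      using A B unfolding ap_def by meson
    have m: "A \<in> sets P" "B \<in> sets P" "G \<in> sets P" "H \<in> sets P" using A[unfolded ap_def, THEN conjunct1] B[unfolded ap_def, THEN conjunct1] GP[OF G(1)] GP[OF H(1)]
      by simp_all
    note mQ = m[unfolded PQ]
    have sub: "sym_diff (A \<union> B) (G \<union> H) \<subseteq> sym_diff A G \<union> sym_diff B H" by blast
    have "measure P (sym_diff (A \<union> B) (G \<union> H)) \<le> measure P (sym_diff A G) + measure P (sym_diff B H)"
      by (rule order_trans[OF P.finite_measure_mono[OF sub] measure_Un_le]; intro sets.Un sets.Diff m)
    moreover have "measure Q (sym_diff (A \<union> B) (G \<union> H)) \<le> measure Q (sym_diff A G) + measure Q (sym_diff B H)"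
      by (rule order_trans[OF Q.finite_measure_mono[OF sub] measure_Un_le]; intro sets.Un sets.Diff mQ)
    ultimately show "\<exists>K\<in>\<G>. measure P (sym_diff (A \<union> B) K) < e \<and> measure Q (sym_diff (A \<union> B) K) < e"
      using G H by (intro bexI[of _ "G \<union> H"] conjI \<G>.Un) linarith+
  qed
  have "ap E"
    using E
  proof induction
    case (Basic a)
    then show ?case by (rule ap_G)
  next
    case Empty
    then show ?case by (intro ap_G) simp
  next
    case (Compl a)
    have a: "a \<in> sets P" using Compl.IH by (simp add: ap_def)
    have sp: "a \<subseteq> \<Omega>" using Compl.hyps sigma_sets_into_sp[OF \<G>.space_closed] by blast
    show ?case unfolding ap_def
    proof (intro conjI allI impI)
      show "\<Omega> - a \<in> sets P" using Compl.hyps P(2) by (simp add: sigma_sets.Compl)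
      fix e :: real assume "e > 0"
      then obtain G where G: "G \<in> \<G>" "measure P (sym_diff a G) < e" "measure Q (sym_diff a G) < e"
        using Compl.IH unfolding ap_def by meson
      have "sym_diff (\<Omega> - a) (\<Omega> - G) = sym_diff a G" using sp \<G>.sets_into_space[OF G(1)] by blast
      then show "\<exists>G\<in>\<G>. measure P (sym_diff (\<Omega> - a) G) < e \<and> measure Q (sym_diff (\<Omega> - a) G) < e"
        using G by (intro bexI[of _ "\<Omega> - G"]) auto
    qed
  next
    case (Union a)
    have a: "a i \<in> sets P" for i using Union.IH by (simp add: ap_def)
    \<comment> \<open>Approximability passes to finite unions only; the countable union is therefore
      cut off at an \<open>n\<close> that is good for both measures, at the price of half of
      \<open>e\<close>.\<close>
    define b where "b n = (\<Union>i<n. a i)" for n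
    have apb: "ap (b n)" for n
    proof (induction n)
      case 0
      then show ?case by (auto simp: b_def intro: ap_G)
    next
      case (Suc n)
      have "b (Suc n) = b n \<union> a n" by (auto simp: b_def less_Suc_eq)
      then show ?case using ap_Un[OF Suc Union.IH] by simp
    qed
    have bm: "b n \<in> sets P" for n using apb by (simp add: ap_def)
    have Ub: "\<Union>(range a) = (\<Union>n. b n)" by (auto simp: b_def)
    have inc: "incseq b" by (force simp: b_def incseq_def)
    show ?case unfolding ap_def
    proof (intro conjI allI impI)
      show Um: "\<Union>(range a) \<in> sets P" using a by blast
      fix e :: real assume "e > 0"
      then have e: "e / 2 > 0" by simp
      have "(\<lambda>n. measure P (b n)) \<longlonglongrightarrow> measure P (\<Union>(range a))"
        unfolding Ub using bm inc by (intro P.finite_Lim_measure_incseq) auto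
      then have "\<forall>\<^sub>F n in sequentially. measure P (b n) > measure P (\<Union>(range a)) - e / 2"
        using e by (intro order_tendstoD) auto
      moreover have "(\<lambda>n. measure Q (b n)) \<longlonglongrightarrow> measure Q (\<Union>(range a))"
        unfolding Ub using bm inc PQ by (intro Q.finite_Lim_measure_incseq) auto
      then have "\<forall>\<^sub>F n in sequentially. measure Q (b n) > measure Q (\<Union>(range a)) - e / 2"
        using e by (intro order_tendstoD) auto
      ultimately obtain n where n: "measure P (b n) > measure P (\<Union>(range a)) - e / 2"
          "measure Q (b n) > measure Q (\<Union>(range a)) - e / 2"
        using eventually_happens'[OF sequentially_bot eventually_conj] by blast
      obtain G where G: "G \<in> \<G>" "measure P (sym_diff (b n) G) < e / 2" "measure Q (sym_diff (b n) G) < e / 2"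
        using apb[of n] e unfolding ap_def by meson
      let ?U = "\<Union>(range a)"
      have bU: "b n \<subseteq> ?U" by (auto simp: b_def)
      have sub: "sym_diff ?U G \<subseteq> (?U - b n) \<union> sym_diff (b n) G" using bU by blast
      have mm: "G \<in> sets P" "b n \<in> sets P" "?U \<in> sets P" using G(1) GP bm Um by auto
      note mmQ = mm[unfolded PQ]
      have "measure P (sym_diff ?U G) \<le> measure P (?U - b n) + measure P (sym_diff (b n) G)"
        by (rule order_trans[OF P.finite_measure_mono[OF sub] measure_Un_le]; intro sets.Un sets.Diff mm)
      moreover have "measure P (?U - b n) = measure P ?U - measure P (b n)"
        by (intro P.finite_measure_Diff bU mm)
      moreover have "measure Q (sym_diff ?U G) \<le> measure Q (?U - b n) + measure Q (sym_diff (b n) G)"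
        by (rule order_trans[OF Q.finite_measure_mono[OF sub] measure_Un_le]; intro sets.Un sets.Diff mmQ)
      moreover have "measure Q (?U - b n) = measure Q ?U - measure Q (b n)"
        by (intro Q.finite_measure_Diff bU mmQ)
      ultimately show "\<exists>G\<in>\<G>. measure P (sym_diff ?U G) < e \<and> measure Q (sym_diff ?U G) < e"
        using G n by (intro bexI[of _ G] conjI) linarith+
    qed
  qed
  then show ?thesis using e by (simp add: ap_def)
qed

text \<open>Cylinder sets, described by the coordinates that decide membership instead of a base
  set: complements keep \<open>F\<close>, and for unions the two sets of coordinates are
  united.\<close>

definition finitely_determined :: "'t set \<Rightarrow> ('t \<Rightarrow> real) set \<Rightarrow> bool" where
  "finitely_determined S E \<longleftrightarrow> (\<exists>F. finite F \<and> F \<subseteq> S \<and>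
     (\<forall>f\<in>extensional S. \<forall>g\<in>extensional S. (\<forall>t\<in>F. f t = g t) \<longrightarrow> (f \<in> E \<longleftrightarrow> g \<in> E)))"

lemma PiM_approx_finitely_determined:
  fixes S :: "'t set"
  assumes P: "finite_measure P" "sets P = sets (PiM S (\<lambda>_. borel))"
    and Q: "finite_measure Q" "sets Q = sets (PiM S (\<lambda>_. borel))"
    and E: "E \<in> sets (PiM S (\<lambda>_. borel :: real measure))" and e: "e > 0"
  shows "\<exists>G\<in>sets (PiM S (\<lambda>_. borel)). finitely_determined S G \<and>
    measure P (sym_diff E G) < e \<and> measure Q (sym_diff E G) < e"
proof -
  let ?B = "PiM S (\<lambda>_. borel :: real measure)"
  define \<G> where "\<G> = {G \<in> sets ?B. finitely_determined S G}"
  have spB: "space ?B = extensional S" by (auto simp: space_PiM PiE_def)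
  have fd_compl: "finitely_determined S (extensional S - G)" if G: "finitely_determined S G" for G
  proof -
    obtain A where A: "finite A" "A \<subseteq> S" "\<forall>f\<in>extensional S. \<forall>g\<in>extensional S. (\<forall>t\<in>A. f t = g t) \<longrightarrow> (f \<in> G \<longleftrightarrow> g \<in> G)"
      using G unfolding finitely_determined_def by (elim exE conjE)
    then have "\<forall>f\<in>extensional S. \<forall>g\<in>extensional S. (\<forall>t\<in>A. f t = g t) \<longrightarrow>
        (f \<in> extensional S - G \<longleftrightarrow> g \<in> extensional S - G)" by blast
    then show ?thesis unfolding finitely_determined_def using A(1,2) by (intro exI conjI)
  qed
  have fd_Un: "finitely_determined S (G \<union> H)" if G: "finitely_determined S G" and H: "finitely_determined S H" for G H
  proof -
    obtain A where A: "finite A" "A \<subseteq> S" "\<forall>f\<in>extensional S. \<forall>g\<in>extensional S. (\<forall>t\<in>A. f t = g t) \<longrightarrow> (f \<in> G \<longleftrightarrow> g \<in> G)"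
      using G unfolding finitely_determined_def by (elim exE conjE)
    obtain B where B: "finite B" "B \<subseteq> S" "\<forall>f\<in>extensional S. \<forall>g\<in>extensional S. (\<forall>t\<in>B. f t = g t) \<longrightarrow> (f \<in> H \<longleftrightarrow> g \<in> H)"
      using H unfolding finitely_determined_def by (elim exE conjE)
    have "\<forall>f\<in>extensional S. \<forall>g\<in>extensional S. (\<forall>t\<in>A \<union> B. f t = g t) \<longrightarrow>
        (f \<in> G \<union> H \<longleftrightarrow> g \<in> G \<union> H)"
    proof (intro ballI impI)
      fix f g :: "'t \<Rightarrow> real" assume fg: "f \<in> extensional S" "g \<in> extensional S" "\<forall>t\<in>A \<union> B. f t = g t"
      have "f \<in> G \<longleftrightarrow> g \<in> G"
        by (rule mp[OF bspec[OF bspec[OF A(3) fg(1)] fg(2)]]) (use fg(3) in blast)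
      moreover have "f \<in> H \<longleftrightarrow> g \<in> H"
        by (rule mp[OF bspec[OF bspec[OF B(3) fg(1)] fg(2)]]) (use fg(3) in blast)
      ultimately show "f \<in> G \<union> H \<longleftrightarrow> g \<in> G \<union> H" unfolding Un_iff by (rule arg_cong2)
    qed
    moreover have "finite (A \<union> B)" "A \<union> B \<subseteq> S" using A(1,2) B(1,2) by auto
    ultimately show ?thesis unfolding finitely_determined_def by blast
  qed
  have alg: "algebra (space ?B) \<G>"
    unfolding algebra_iff_Un
  proof (intro conjI ballI)
    show "\<G> \<subseteq> Pow (space ?B)" using sets.sets_into_space by (auto simp: \<G>_def)
    show "{} \<in> \<G>" by (auto simp: \<G>_def finitely_determined_def)
    show "space ?B - G \<in> \<G>" if "G \<in> \<G>" for G
      using that fd_compl[of G] sets.compl_sets[of G ?B] spB by (auto simp: \<G>_def)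
    show "G \<union> H \<in> \<G>" if "G \<in> \<G>" "H \<in> \<G>" for G H using that fd_Un by (auto simp: \<G>_def)
  qed
  have gen: "sets ?B = sigma_sets (space ?B) \<G>"
  proof
    show "sigma_sets (space ?B) \<G> \<subseteq> sets ?B"
      by (rule sets.sigma_sets_subset) (auto simp: \<G>_def)
    have "{{f \<in> \<Pi>\<^sub>E i\<in>S. space borel. f i \<in> A} |i A. i \<in> S \<and> A \<in> sets (borel :: real measure)} \<subseteq> \<G>"
    proof clarify
      fix i and A :: "real set" assume i: "i \<in> S" "A \<in> sets borel"
      have "{f \<in> space ?B. f i \<in> A} \<in> sets ?B"
        using measurable_sets[OF measurable_component_singleton[OF i(1), of "\<lambda>_. borel"] i(2)]
        by (simp add: vimage_def Int_def conj_commute)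
      moreover have "finitely_determined S {f \<in> space ?B. f i \<in> A}"
        unfolding finitely_determined_def spB using i by (intro exI[of _ "{i}"]) auto
      ultimately show "{f \<in> \<Pi>\<^sub>E i\<in>S. space borel. f i \<in> A} \<in> \<G>" by (simp add: \<G>_def space_PiM)
    qed
    then show "sets ?B \<subseteq> sigma_sets (space ?B) \<G>"
      unfolding sets_PiM_single space_PiM by (rule sigma_sets_mono')
  qed
  have "\<exists>G\<in>\<G>. measure P (sym_diff E G) < e \<and> measure Q (sym_diff E G) < e"
    using P Q E e gen by (intro sigma_sets_approx[OF _ _ _ _ alg]) auto
  then show ?thesis by (auto simp: \<G>_def)
qed

text \<open>With \<open>L z = - ln (g (1 / z))\<close> the power relation reads
  \<open>L (n * z) = n * L z\<close>, and a monotone function with this integer homogeneity is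
  linear. This is what makes extremal coefficients exist.\<close>

lemma exp_of_power_scaling:
  fixes g :: "real \<Rightarrow> real"
  assumes mono: "\<And>x y. 0 < x \<Longrightarrow> x \<le> y \<Longrightarrow> g x \<le> g y"
    and pow: "\<And>n y. n \<ge> 1 \<Longrightarrow> y > 0 \<Longrightarrow> g (y / real n) = g y ^ n"
    and pos: "y0 > 0" "g y0 > 0"
  shows "\<exists>\<theta>. \<forall>y>0. g y = exp (- (\<theta> / y))"
proof -
  \<comment> \<open>Positivity spreads from the single point \<open>y0\<close>: down through
    \<open>g (y0 / n) = g y0 ^ n\<close>, up by monotonicity.\<close>
  have gpos: "g y > 0" if y: "y > 0" for y
  proof -
    obtain n where n: "y0 / y < real n" using reals_Archimedean2 by blast
    then have n1: "n \<ge> 1" using pos y by (cases n) (auto simp: field_simps)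
    have "0 < g (y0 / real n)" using pow[OF n1 pos(1)] pos(2) by simp
    also have "\<dots> \<le> g y" using n n1 pos y by (intro mono) (auto simp: field_simps)
    finally show ?thesis .
  qed
  define L where "L z = - ln (g (1 / z))" for z
  have Lmono: "L x \<le> L y" if "0 < x" "x \<le> y" for x y
    unfolding L_def using mono[of "1/y" "1/x"] gpos[of "1/y"] gpos[of "1/x"] that by (simp add: frac_le)
  have Lmult: "L (real n * z) = real n * L z" if "n \<ge> 1" "z > 0" for n z
  proof -
    have "g (1 / (real n * z)) = g (1 / z) ^ n" using pow[OF that(1), of "1/z"] that by (simp add: mult.commute)
    then show ?thesis using gpos[of "1/z"] that by (simp add: L_def ln_realpow)
  qed
  have L1: "L 1 \<ge> 0"
    using Lmult[of 2 1] Lmono[of 1 2] by simp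
  have lin: "L z = z * L 1" if z: "z > 0" for z
  proof -
    \<comment> \<open>\<open>n * z\<close> lies between consecutive integers, where \<open>L\<close>
      is known exactly. The error \<open>L 1\<close> does not grow with \<open>n\<close>, while a
      deviation of \<open>L\<close> from linearity would be multiplied by \<open>n\<close>.\<close>
    have bd: "real n * \<bar>L z - z * L 1\<bar> \<le> L 1" if n: "real n * z \<ge> 1" "n \<ge> 1" for n
    proof -
      define m where "m = nat \<lfloor>real n * z\<rfloor>"
      have m: "m \<ge> 1" "real m \<le> real n * z" "real n * z \<le> real (Suc m)"
        using n unfolding m_def by (auto simp: le_nat_floor) linarith
      have "real m * L 1 \<le> real n * L z"
        using Lmult[OF m(1), of 1] Lmult[OF n(2) z] Lmono[OF _ m(2)] m(1) by simp
      moreover have "real n * L z \<le> real (Suc m) * L 1"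
        using Lmult[of "Suc m" 1] Lmult[OF n(2) z] Lmono[OF _ m(3)] n(1) by simp
      moreover have "real m * L 1 \<le> (real n * z) * L 1" "(real n * z) * L 1 \<le> real (Suc m) * L 1"
        using m L1 by (auto intro: mult_right_mono)
      moreover have "real (Suc m) * L 1 = real m * L 1 + L 1" by (simp add: algebra_simps)
      ultimately have "\<bar>real n * L z - (real n * z) * L 1\<bar> \<le> L 1" by linarith
      moreover have "real n * L z - (real n * z) * L 1 = real n * (L z - z * L 1)" by (simp add: algebra_simps)
      ultimately show ?thesis by (simp add: abs_mult)
    qed
    show ?thesis
    proof (rule ccontr)
      assume "L z \<noteq> z * L 1"
      then have d: "\<bar>L z - z * L 1\<bar> > 0" by simp
      obtain n where n: "real n > max (1 / z) (L 1 / \<bar>L z - z * L 1\<bar>)" using reals_Archimedean2 by blast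
      then have "real n * z \<ge> 1" "n \<ge> 1" "real n * \<bar>L z - z * L 1\<bar> > L 1"
        using z d by (auto simp: field_simps) (cases n; simp)
      then show False using bd by force
    qed
  qed
  show ?thesis
  proof (intro exI allI impI)
    fix y :: real assume y: "y > 0"
    have "ln (g y) = - (L 1 / y)" using lin[of "1/y"] y by (simp add: L_def)
    then show "g y = exp (- (L 1 / y))" using gpos[OF y] by (metis exp_ln)
  qed
qed

text \<open>A layer-cake sum in steps of width \<open>c\<close>: the increments of squares satisfy
  \<open>2 * n + 1 \<le> 2 * (n + 1)\<close>, so \<open>X ^ 2\<close> is at most the sum of
  \<open>2 * c^2 * (n + 1)\<close> over all \<open>n\<close> with \<open>n * c < X\<close>, and the
  series of \<open>(n + 1) * q ^ n\<close> converges.\<close>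

lemma nn_integral_square_finite_of_geometric_tail:
  assumes X[measurable]: "X \<in> borel_measurable M" and c: "c > 0" and q: "0 \<le> q" "q < 1"
    and tail: "\<And>n. emeasure M {\<omega> \<in> space M. ennreal (real n * c) < X \<omega>} \<le> ennreal (q ^ n)"
  shows "(\<integral>\<^sup>+\<omega>. X \<omega> ^ 2 \<partial>M) < \<infinity>"
proof -
  define T where "T \<omega> = (\<Sum>n. ennreal (2 * c^2 * real (Suc n)) * indicator {\<omega> \<in> space M. ennreal (real n * c) < X \<omega>} \<omega>)" for \<omega>
  have partial: "ennreal ((real m * c)^2) \<le> T \<omega>" if w: "\<omega> \<in> space M" and m: "\<And>n. n < m \<Longrightarrow> ennreal (real n * c) < X \<omega>" for m \<omega>
  proof -
    have gs: "(real m * c)^2 \<le> (\<Sum>n<m. 2 * c^2 * real (Suc n))"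
    proof (induction m)
      case (Suc m)
      have "(real (Suc m) * c)^2 = (real m * c)^2 + c^2 * (2 * real m + 1)" by (simp add: algebra_simps power2_eq_square)
      also have "\<dots> \<le> (\<Sum>n<m. 2 * c^2 * real (Suc n)) + c^2 * (2 * real (Suc m))"
        using Suc by (intro add_mono mult_left_mono) auto
      finally show ?case by (simp add: algebra_simps)
    qed simp
    have "ennreal ((real m * c)^2) \<le> ennreal (\<Sum>n<m. 2 * c^2 * real (Suc n))" using gs by (rule ennreal_leI)
    also have "\<dots> = (\<Sum>n<m. ennreal (2 * c^2 * real (Suc n)))" by (subst sum_ennreal) auto
    also have "\<dots> = (\<Sum>n<m. ennreal (2 * c^2 * real (Suc n)) * indicator {\<omega> \<in> space M. ennreal (real n * c) < X \<omega>} \<omega>)"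
      using w m by (intro sum.cong) auto
    also have "\<dots> \<le> T \<omega>" unfolding T_def by (intro sum_le_suminf) auto
    finally show ?thesis .
  qed
  have le: "X \<omega> ^ 2 \<le> T \<omega>" if w: "\<omega> \<in> space M" for \<omega>
  proof (cases "X \<omega>")
    case (real x)
    define m where "m = nat \<lceil>x / c\<rceil>"
    have "x \<le> real m * c"
      using c real_nat_ceiling_ge[of "x/c"] by (simp add: m_def pos_divide_le_eq)
    then have "X \<omega> ^ 2 \<le> ennreal ((real m * c)^2)"
      using real c by (simp add: ennreal_power ennreal_leI power_mono)
    also have "\<dots> \<le> T \<omega>"
    proof (rule partial[OF w])
      fix n assume "n < m"
      then have "real n < x / c" unfolding m_def by linarith
      then have "real n * c < x" using c by (simp add: pos_less_divide_eq)
      then show "ennreal (real n * c) < X \<omega>" using real c by (simp add: ennreal_less_iff)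
    qed
    finally show ?thesis .
  next
    case top
    have "T \<omega> = \<top>"
    proof (rule ccontr)
      assume "T \<omega> \<noteq> \<top>"
      then obtain t where t: "T \<omega> = ennreal t" "t \<ge> 0" by (cases "T \<omega>") auto
      obtain m where m: "real m > max 1 (t / c^2)" using reals_Archimedean2 by blast
      have "t < real m * c^2" using m c by (simp add: pos_divide_less_eq)
      also have "\<dots> \<le> real m ^ 2 * c^2" using m by (intro mult_right_mono) (auto simp: power2_eq_square)
      finally have "t < (real m * c)^2" by (simp add: power_mult_distrib)
      moreover have "ennreal ((real m * c)^2) \<le> T \<omega>" using top by (intro partial[OF w]) auto
      ultimately show False using t by (simp add: ennreal_le_iff)
    qed
    then show ?thesis by simp
  qed
  have sm: "summable (\<lambda>n. 2 * c^2 * real (Suc n) * q ^ n)"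
    using geometric_deriv_sums[of q] q summable_mult[of "\<lambda>n. real (Suc n) * q ^ n" "2 * c^2"]
    by (simp add: sums_iff mult.assoc)
  have "(\<integral>\<^sup>+\<omega>. X \<omega> ^ 2 \<partial>M) \<le> (\<integral>\<^sup>+\<omega>. T \<omega> \<partial>M)" using le by (intro nn_integral_mono)
  also have "\<dots> = (\<Sum>n. ennreal (2 * c^2 * real (Suc n)) * emeasure M {\<omega> \<in> space M. ennreal (real n * c) < X \<omega>})"
    unfolding T_def by (subst nn_integral_suminf) (auto simp: nn_integral_cmult_indicator)
  also have "\<dots> \<le> (\<Sum>n. ennreal (2 * c^2 * real (Suc n) * q ^ n))"
    using tail q by (intro suminf_le) (auto simp: ennreal_mult intro: mult_left_mono)
  also have "\<dots> = ennreal (\<Sum>n. 2 * c^2 * real (Suc n) * q ^ n)"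
    using sm q by (intro suminf_ennreal2) auto
  finally show ?thesis using le_less_trans by fastforce
qed

section \<open>Max-stability on the path space\<close>

lemma measurable_path_PiM:
  assumes "\<And>t. (\<lambda>x. f x t) \<in> borel_measurable N"
  shows "f \<in> measurable N (PiM UNIV (\<lambda>_. borel))"
  using assms by (intro measurable_PiM_single') auto

locale max_stable_field =
  fixes M :: "'w measure" and \<eta> :: "'t::metric_space \<Rightarrow> 'w \<Rightarrow> real"
  assumes simple_max_stable: "simple_max_stable M \<eta>"
begin

sublocale prob_space M
  using simple_max_stable by (simp add: simple_max_stable_def)

abbreviation paths :: "('t \<Rightarrow> real) measure" where
  "paths \<equiv> PiM UNIV (\<lambda>_. borel)"

lemma eta_measurable [measurable]: "\<eta> t \<in> borel_measurable M"
  using simple_max_stable by (simp add: simple_max_stable_def)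

lemma eta_continuous: "\<omega> \<in> space M \<Longrightarrow> continuous_on UNIV (\<lambda>t. \<eta> t \<omega>)"
  using simple_max_stable by (simp add: simple_max_stable_def)

lemma eta_frechet: "measure M {\<omega> \<in> space M. \<eta> t \<omega> \<le> y} = (if y > 0 then exp (- (1 / y)) else 0)"
  using simple_max_stable by (simp add: simple_max_stable_def)

lemma field_law_max:
  assumes "n \<ge> 1"
  shows "field_law (PiM {..<n} (\<lambda>_. M)) (\<lambda>t \<omega>. MAX i\<in>{..<n}. \<eta> t (\<omega> i))
          = field_law M (\<lambda>t \<omega>. real n * \<eta> t \<omega>)"
  using simple_max_stable assms by (simp add: simple_max_stable_def)

lemma eta_pos: "AE \<omega> in M. 0 < \<eta> t \<omega>"
proof -
  have "prob {\<omega> \<in> space M. \<eta> t \<omega> \<le> 0} = 0" using eta_frechet[of t 0] by simp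
  then have "AE \<omega> in M. \<not> (\<eta> t \<omega> \<le> 0)" by (subst (asm) prob_eq_0) auto
  then show ?thesis by eventually_elim simp
qed

lemma nn_integral_scaled_eta:
  assumes n: "n \<ge> 1" and G: "G \<in> borel_measurable paths"
  shows "(\<integral>\<^sup>+\<omega>. G (\<lambda>t. real n * \<eta> t \<omega>) \<partial>M) = (\<integral>\<^sup>+\<omega>. G (\<lambda>t. MAX i\<in>{..<n}. \<eta> t (\<omega> i)) \<partial>PiM {..<n} (\<lambda>_. M))"
proof -
  have 1: "(\<lambda>\<omega> t. MAX i\<in>{..<n}. \<eta> t (\<omega> i)) \<in> measurable (PiM {..<n} (\<lambda>_. M)) paths"
  proof (rule measurable_path_PiM)
    fix t
    have "(\<lambda>\<omega>. Max ((\<lambda>i. \<eta> t (\<omega> i)) ` {..<n})) \<in> borel_measurable (PiM {..<n} (\<lambda>_. M))"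
      by (rule borel_measurable_Max) auto
    then show "(\<lambda>\<omega>. MAX i\<in>{..<n}. \<eta> t (\<omega> i)) \<in> borel_measurable (PiM {..<n} (\<lambda>_. M))" .
  qed
  have 2: "(\<lambda>\<omega> t. real n * \<eta> t \<omega>) \<in> measurable M paths" by (rule measurable_path_PiM) measurable
  show ?thesis
    using arg_cong[OF field_law_max[OF n], of "\<lambda>N. \<integral>\<^sup>+f. G f \<partial>N"] G
    unfolding field_law_def by (simp add: nn_integral_distr[OF 1] nn_integral_distr[OF 2])
qed

text \<open>Fubini splits the last copy off the product space, and the first \<open>k\<close> are
  turned back into one copy of \<open>k * \<eta>\<close>. After this only iterated integrals over
  \<open>M\<close> occur, and no product with a variable number of factors. The case
  \<open>k = 0\<close> is excluded, as the maximum of no copies has no meaning.\<close>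

lemma nn_integral_max_eta:
  assumes k: "k \<ge> 1" and G[measurable]: "G \<in> borel_measurable paths"
  shows "(\<integral>\<^sup>+\<omega>. G (\<lambda>t. real (Suc k) * \<eta> t \<omega>) \<partial>M)
    = (\<integral>\<^sup>+\<omega>. \<integral>\<^sup>+\<omega>'. G (\<lambda>t. max (real k * \<eta> t \<omega>) (\<eta> t \<omega>')) \<partial>M \<partial>M)"
proof -
  interpret product_sigma_finite "\<lambda>_::nat. M"
    by (simp add: product_sigma_finite_def sigma_finite_measure_axioms)
  have Gm: "(\<lambda>\<omega>. G (\<lambda>t. MAX i\<in>{..<n}. \<eta> t (\<omega> i))) \<in> borel_measurable (PiM {..<n} (\<lambda>_. M))" for n :: nat
  proof (rule measurable_compose[OF _ G], rule measurable_path_PiM)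
    fix t
    have "(\<lambda>\<omega>. Max ((\<lambda>i. \<eta> t (\<omega> i)) ` {..<n})) \<in> borel_measurable (PiM {..<n} (\<lambda>_. M))"
      by (rule borel_measurable_Max) auto
    then show "(\<lambda>\<omega>. MAX i\<in>{..<n}. \<eta> t (\<omega> i)) \<in> borel_measurable (PiM {..<n} (\<lambda>_. M))" .
  qed
  have ins: "{..<Suc k} = insert k {..<k}" by auto
  have mx: "(MAX i\<in>{..<Suc k}. \<eta> t ((fun_upd \<omega> k \<omega>') i)) = max (Max ((\<lambda>i. \<eta> t (\<omega> i)) ` {..<k})) (\<eta> t \<omega>')" for t \<omega> \<omega>'
  proof -
    have "(\<lambda>i. \<eta> t ((fun_upd \<omega> k \<omega>') i)) ` {..<Suc k} = insert (\<eta> t \<omega>') ((\<lambda>i. \<eta> t (\<omega> i)) ` {..<k})"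
      unfolding ins by auto
    moreover have "(\<lambda>i. \<eta> t (\<omega> i)) ` {..<k} \<noteq> {}" using k by (auto simp: lessThan_empty_iff)
    ultimately show ?thesis by (simp add: max.commute)
  qed
  have "(\<lambda>x. (\<lambda>t. max (fst x t) (\<eta> t (snd x)))) \<in> measurable (paths \<Otimes>\<^sub>M M) paths"
    by (rule measurable_path_PiM) measurable
  then have [measurable]: "(\<lambda>x. G (\<lambda>t. max (fst x t) (\<eta> t (snd x)))) \<in> borel_measurable (paths \<Otimes>\<^sub>M M)"
    by (rule measurable_compose) (rule G)
  have H: "(\<lambda>h. \<integral>\<^sup>+\<omega>'. G (\<lambda>t. max (h t) (\<eta> t \<omega>')) \<partial>M) \<in> borel_measurable paths"
    by (rule borel_measurable_nn_integral) (simp add: case_prod_unfold)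
  have "(\<integral>\<^sup>+\<omega>. G (\<lambda>t. real (Suc k) * \<eta> t \<omega>) \<partial>M)
      = (\<integral>\<^sup>+\<omega>. G (\<lambda>t. MAX i\<in>{..<Suc k}. \<eta> t (\<omega> i)) \<partial>PiM {..<Suc k} (\<lambda>_. M))"
    by (rule nn_integral_scaled_eta[OF _ G]) simp
  also have "\<dots> = (\<integral>\<^sup>+\<omega>. \<integral>\<^sup>+\<omega>'. G (\<lambda>t. MAX i\<in>{..<Suc k}. \<eta> t ((fun_upd \<omega> k \<omega>') i)) \<partial>M \<partial>PiM {..<k} (\<lambda>_. M))"
    using product_nn_integral_insert[of "{..<k}" k "\<lambda>\<omega>. G (\<lambda>t. MAX i\<in>{..<Suc k}. \<eta> t (\<omega> i))"] Gm[of "Suc k"]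
    by (simp add: ins)
  also have "\<dots> = (\<integral>\<^sup>+\<omega>. \<integral>\<^sup>+\<omega>'. G (\<lambda>t. max (MAX i\<in>{..<k}. \<eta> t (\<omega> i)) (\<eta> t \<omega>')) \<partial>M \<partial>PiM {..<k} (\<lambda>_. M))"
    unfolding mx ..
  also have "\<dots> = (\<integral>\<^sup>+\<omega>. \<integral>\<^sup>+\<omega>'. G (\<lambda>t. max (real k * \<eta> t \<omega>) (\<eta> t \<omega>')) \<partial>M \<partial>M)"
    using nn_integral_scaled_eta[OF k H] by simp
  finally show ?thesis .
qed

text \<open>Every copy inherits the event from the maximum, so independence yields a power. It is
  meant for events of a low value somewhere, and for upper bounds on the path; the latter are also
  closed under maxima, so that \<open>emeasure_scaled_ge_power\<close> turns the inequality into an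
  equality.\<close>

lemma emeasure_scaled_le_power:
  assumes E: "E \<in> sets paths" and max: "\<And>f g. (\<lambda>t. max (f t) (g t)) \<in> E \<Longrightarrow> f \<in> E \<and> g \<in> E" and n: "n \<ge> 1"
  shows "emeasure M {\<omega> \<in> space M. (\<lambda>t. real n * \<eta> t \<omega>) \<in> E} \<le> emeasure M {\<omega> \<in> space M. (\<lambda>t. \<eta> t \<omega>) \<in> E} ^ n"
  using n
proof (induction n rule: nat_induct_at_least)
  case base
  then show ?case by simp
next
  case (Suc n)
  have [measurable]: "(\<lambda>\<omega> t. c * \<eta> t \<omega>) \<in> measurable M paths" for c by (rule measurable_path_PiM) measurable
  have [measurable]: "(\<lambda>\<omega> t. \<eta> t \<omega>) \<in> measurable M paths" by (rule measurable_path_PiM) measurable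
  note E[measurable]
  let ?A = "\<lambda>n. {\<omega> \<in> space M. (\<lambda>t. real n * \<eta> t \<omega>) \<in> E}" and ?B = "{\<omega> \<in> space M. (\<lambda>t. \<eta> t \<omega>) \<in> E}"
  have ptw: "indicator E (\<lambda>t. max (real n * \<eta> t \<omega>) (\<eta> t \<omega>')) \<le> (indicator (?A n) \<omega> * indicator ?B \<omega>' :: ennreal)"
    if "\<omega> \<in> space M" "\<omega>' \<in> space M" for \<omega> \<omega>'
  proof (cases "(\<lambda>t. max (real n * \<eta> t \<omega>) (\<eta> t \<omega>')) \<in> E")
    case True
    from max[OF True] show ?thesis using that True by simp
  qed simp
  have "emeasure M (?A (Suc n)) = (\<integral>\<^sup>+\<omega>. indicator (?A (Suc n)) \<omega> \<partial>M)"
    by (rule nn_integral_indicator[symmetric]) measurable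
  also have "\<dots> = (\<integral>\<^sup>+\<omega>. indicator E (\<lambda>t. real (Suc n) * \<eta> t \<omega>) \<partial>M)"
    by (intro nn_integral_cong) (simp add: indicator_def)
  finally have indA: "emeasure M (?A (Suc n)) = (\<integral>\<^sup>+\<omega>. indicator E (\<lambda>t. real (Suc n) * \<eta> t \<omega>) \<partial>M)" .
  note indA
  also have "(\<integral>\<^sup>+\<omega>. indicator E (\<lambda>t. real (Suc n) * \<eta> t \<omega>) \<partial>M)
      = (\<integral>\<^sup>+\<omega>. \<integral>\<^sup>+\<omega>'. indicator E (\<lambda>t. max (real n * \<eta> t \<omega>) (\<eta> t \<omega>')) \<partial>M \<partial>M)"
    by (rule nn_integral_max_eta[OF Suc.hyps]) measurable
  also have "\<dots> \<le> (\<integral>\<^sup>+\<omega>. \<integral>\<^sup>+\<omega>'. indicator (?A n) \<omega> * indicator ?B \<omega>' \<partial>M \<partial>M)"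
    by (intro nn_integral_mono ptw)
  also have "\<dots> = emeasure M (?A n) * emeasure M ?B"
    by (simp add: nn_integral_cmult nn_integral_multc)
  also have "\<dots> \<le> emeasure M ?B ^ n * emeasure M ?B" by (intro mult_right_mono Suc.IH) simp
  finally show ?case by (simp add: mult.commute)
qed

lemma emeasure_scaled_ge_power:
  assumes E: "E \<in> sets paths" and max: "\<And>f g. f \<in> E \<Longrightarrow> g \<in> E \<Longrightarrow> (\<lambda>t. max (f t) (g t)) \<in> E" and n: "n \<ge> 1"
  shows "emeasure M {\<omega> \<in> space M. (\<lambda>t. real n * \<eta> t \<omega>) \<in> E} \<ge> emeasure M {\<omega> \<in> space M. (\<lambda>t. \<eta> t \<omega>) \<in> E} ^ n"
  using n
proof (induction n rule: nat_induct_at_least)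
  case base
  then show ?case by simp
next
  case (Suc n)
  have [measurable]: "(\<lambda>\<omega> t. c * \<eta> t \<omega>) \<in> measurable M paths" for c by (rule measurable_path_PiM) measurable
  have [measurable]: "(\<lambda>\<omega> t. \<eta> t \<omega>) \<in> measurable M paths" by (rule measurable_path_PiM) measurable
  note E[measurable]
  let ?A = "\<lambda>n. {\<omega> \<in> space M. (\<lambda>t. real n * \<eta> t \<omega>) \<in> E}" and ?B = "{\<omega> \<in> space M. (\<lambda>t. \<eta> t \<omega>) \<in> E}"
  have ptw: "(indicator (?A n) \<omega> * indicator ?B \<omega>' :: ennreal) \<le> indicator E (\<lambda>t. max (real n * \<eta> t \<omega>) (\<eta> t \<omega>'))" for \<omega> \<omega>'
  proof (cases "\<omega> \<in> ?A n \<and> \<omega>' \<in> ?B")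
    case True
    then show ?thesis using max[of "\<lambda>t. real n * \<eta> t \<omega>" "\<lambda>t. \<eta> t \<omega>'"] by simp
  qed auto
  have "emeasure M (?A (Suc n)) = (\<integral>\<^sup>+\<omega>. indicator (?A (Suc n)) \<omega> \<partial>M)"
    by (rule nn_integral_indicator[symmetric]) measurable
  also have "\<dots> = (\<integral>\<^sup>+\<omega>. indicator E (\<lambda>t. real (Suc n) * \<eta> t \<omega>) \<partial>M)"
    by (intro nn_integral_cong) (simp add: indicator_def)
  finally have indA: "emeasure M (?A (Suc n)) = (\<integral>\<^sup>+\<omega>. indicator E (\<lambda>t. real (Suc n) * \<eta> t \<omega>) \<partial>M)" .
  have "emeasure M ?B ^ Suc n \<le> emeasure M (?A n) * emeasure M ?B"
    using mult_right_mono[OF Suc.IH, of "emeasure M ?B"] by (simp add: mult.commute)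
  also have "\<dots> = (\<integral>\<^sup>+\<omega>. \<integral>\<^sup>+\<omega>'. indicator (?A n) \<omega> * indicator ?B \<omega>' \<partial>M \<partial>M)"
    by (simp add: nn_integral_cmult nn_integral_multc)
  also have "\<dots> \<le> (\<integral>\<^sup>+\<omega>. \<integral>\<^sup>+\<omega>'. indicator E (\<lambda>t. max (real n * \<eta> t \<omega>) (\<eta> t \<omega>')) \<partial>M \<partial>M)"
    by (intro nn_integral_mono ptw)
  also have "\<dots> = (\<integral>\<^sup>+\<omega>. indicator E (\<lambda>t. real (Suc n) * \<eta> t \<omega>) \<partial>M)"
    by (rule nn_integral_max_eta[OF Suc.hyps, symmetric]) measurable
  also have "\<dots> = emeasure M (?A (Suc n))"
    by (rule indA[symmetric])
  finally show ?case .
qed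

text \<open>A path with weight 0 has to be neutral for the maximum, so that the interpolation below
  can start and end with weight 0. This needs paths that are nonnegative everywhere, and truncation
  at 0 commutes with maxima and with nonnegative scaling.\<close>

definition pos_path :: "'w \<Rightarrow> 't \<Rightarrow> real" where
  "pos_path \<omega> t = max 0 (\<eta> t \<omega>)"

lemma pos_path_nonneg [simp]: "0 \<le> pos_path \<omega> t"
  by (simp add: pos_path_def)

lemma pos_path_measurable [measurable]: "(\<lambda>\<omega>. pos_path \<omega> t) \<in> borel_measurable M"
  unfolding pos_path_def by measurable

lemma pos_path_AE: "AE \<omega> in M. pos_path \<omega> t = \<eta> t \<omega>"
  using eta_pos[of t] by eventually_elim (simp add: pos_path_def)

lemma nn_integral_max_pos_path_step:
  assumes G[measurable]: "G \<in> borel_measurable paths"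
  shows "(\<integral>\<^sup>+\<omega>. G (\<lambda>t. real (Suc k) * pos_path \<omega> t) \<partial>M)
    = (\<integral>\<^sup>+\<omega>. \<integral>\<^sup>+\<omega>'. G (\<lambda>t. max (real k * pos_path \<omega> t) (pos_path \<omega>' t)) \<partial>M \<partial>M)"
proof (cases "k = 0")
  case True
  then show ?thesis by (simp add: max_def emeasure_space_1)
next
  case False
  then have k: "k \<ge> 1" by simp
  have "(\<lambda>f t. max 0 (f t)) \<in> measurable paths paths"
    by (rule measurable_path_PiM) measurable
  then have "(\<lambda>f. G (\<lambda>t. max 0 (f t))) \<in> borel_measurable paths"
    by (rule measurable_compose) (rule G)
  from nn_integral_max_eta[OF k this]
  have "(\<integral>\<^sup>+\<omega>. G (\<lambda>t. max 0 (real (Suc k) * \<eta> t \<omega>)) \<partial>M)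
      = (\<integral>\<^sup>+\<omega>. \<integral>\<^sup>+\<omega>'. G (\<lambda>t. max 0 (max (real k * \<eta> t \<omega>) (\<eta> t \<omega>'))) \<partial>M \<partial>M)" .
  moreover have "max 0 (c * x) = c * max 0 x" if "c \<ge> 0" for c x :: real
    using max_mult_distrib_left[of c 0 x] that by simp
  then have "(\<lambda>t. max 0 (real (Suc k) * \<eta> t \<omega>)) = (\<lambda>t. real (Suc k) * pos_path \<omega> t)"
    and "(\<lambda>t. max 0 (max (real k * \<eta> t \<omega>) (\<eta> t \<omega>'))) = (\<lambda>t. max (real k * pos_path \<omega> t) (pos_path \<omega>' t))" for \<omega> \<omega>'
    by (auto simp: pos_path_def fun_eq_iff max.assoc max.left_commute simp flip: \<open>\<And>c x. _ \<Longrightarrow> max 0 (c * x) = c * max 0 x\<close>)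
  ultimately show ?thesis by simp
qed

text \<open>One of the \<open>j + k + 1\<close> copies is split off, the others are divided by the
  induction hypothesis, and the copy is reattached to the right-hand path. The hypothesis is used
  for the functional with that copy integrated out, hence the induction over arbitrary
  \<open>G\<close>.\<close>

lemma nn_integral_max_pos_path:
  assumes G[measurable]: "G \<in> borel_measurable paths"
  shows "(\<integral>\<^sup>+\<omega>. G (\<lambda>t. real (j + k) * pos_path \<omega> t) \<partial>M)
    = (\<integral>\<^sup>+\<omega>. \<integral>\<^sup>+\<omega>'. G (\<lambda>t. max (real j * pos_path \<omega> t) (real k * pos_path \<omega>' t)) \<partial>M \<partial>M)"
  using G
proof (induction k arbitrary: G)
  case 0
  then show ?case by (simp add: max_absorb1 emeasure_space_1)
next
  case (Suc k)
  note G[measurable] = Suc.prems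
  have Gm: "(\<lambda>h. G (\<lambda>t. max (f t) (h t))) \<in> borel_measurable paths" for f
    by (rule measurable_compose[OF _ G], rule measurable_path_PiM) measurable
  have "(\<lambda>x. (\<lambda>t. max (fst x t) (pos_path (snd x) t))) \<in> measurable (paths \<Otimes>\<^sub>M M) paths"
    by (rule measurable_path_PiM) measurable
  then have "(\<lambda>x. G (\<lambda>t. max (fst x t) (pos_path (snd x) t))) \<in> borel_measurable (paths \<Otimes>\<^sub>M M)"
    by (rule measurable_compose) (rule G)
  then have H: "(\<lambda>h. \<integral>\<^sup>+\<omega>''. G (\<lambda>t. max (h t) (pos_path \<omega>'' t)) \<partial>M) \<in> borel_measurable paths"
    by (intro borel_measurable_nn_integral) (simp add: case_prod_unfold)
  have "(\<integral>\<^sup>+\<omega>. G (\<lambda>t. real (j + Suc k) * pos_path \<omega> t) \<partial>M)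
      = (\<integral>\<^sup>+\<omega>. \<integral>\<^sup>+\<omega>''. G (\<lambda>t. max (real (j + k) * pos_path \<omega> t) (pos_path \<omega>'' t)) \<partial>M \<partial>M)"
    using nn_integral_max_pos_path_step[OF G, of "j + k"] by simp
  also have "\<dots> = (\<integral>\<^sup>+\<omega>. \<integral>\<^sup>+\<omega>'. \<integral>\<^sup>+\<omega>''. G (\<lambda>t. max (max (real j * pos_path \<omega> t) (real k * pos_path \<omega>' t)) (pos_path \<omega>'' t)) \<partial>M \<partial>M \<partial>M)"
    by (rule Suc.IH[OF H])
  also have "\<dots> = (\<integral>\<^sup>+\<omega>. \<integral>\<^sup>+\<omega>'. \<integral>\<^sup>+\<omega>''. G (\<lambda>t. max (real j * pos_path \<omega> t) (max (real k * pos_path \<omega>' t) (pos_path \<omega>'' t))) \<partial>M \<partial>M \<partial>M)"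
    by (simp add: max.assoc)
  also have "\<dots> = (\<integral>\<^sup>+\<omega>. \<integral>\<^sup>+\<omega>'. G (\<lambda>t. max (real j * pos_path \<omega> t) (real (Suc k) * pos_path \<omega>' t)) \<partial>M \<partial>M)"
    by (subst nn_integral_max_pos_path_step[OF Gm, symmetric]) (rule refl)
  finally show ?case .
qed

end

section \<open>Extremal coefficients and inverse moments\<close>

context max_stable_field
begin

text \<open>The index space need not be separable, but its compact subsets are; continuity of the
  paths then replaces an uncountable condition by a countable, measurable one.\<close>

lemma eta_le_dense_iff:
  assumes \<omega>: "\<omega> \<in> space M" and D: "D \<subseteq> S" "S \<subseteq> closure D"
  shows "(\<forall>s\<in>S. \<eta> s \<omega> \<le> y) \<longleftrightarrow> (\<forall>s\<in>D. \<eta> s \<omega> \<le> y)"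
proof
  assume "\<forall>s\<in>D. \<eta> s \<omega> \<le> y"
  then have "D \<subseteq> {t. \<eta> t \<omega> \<le> y}" by auto
  moreover have "closed {t. \<eta> t \<omega> \<le> y}"
    using eta_continuous[OF \<omega>] by (intro closed_Collect_le continuous_on_const) auto
  ultimately show "\<forall>s\<in>S. \<eta> s \<omega> \<le> y" using D(2) closure_minimal by blast
qed (use D in blast)

lemma sets_all_eta_le [measurable]:
  assumes "compact S"
  shows "{\<omega> \<in> space M. \<forall>s\<in>S. \<eta> s \<omega> \<le> y} \<in> sets M"
proof -
  obtain D where D: "countable D" "D \<subseteq> S" "S \<subseteq> closure D"
    using compact_countable_dense[OF assms] by metis
  have "{\<omega> \<in> space M. \<forall>s\<in>D. \<eta> s \<omega> \<le> y} \<in> sets M"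
    using D(1) by (intro sets.sets_Collect_countable_All') auto
  moreover have "{\<omega> \<in> space M. \<forall>s\<in>S. \<eta> s \<omega> \<le> y} = {\<omega> \<in> space M. \<forall>s\<in>D. \<eta> s \<omega> \<le> y}"
    using eta_le_dense_iff[OF _ D(2,3)] by blast
  ultimately show ?thesis by simp
qed

text \<open>Shows that the description in \<open>extremal_coeff\<close> has exactly one solution: by
  max-stability the distribution function of the supremum satisfies the power relation of
  \<open>exp_of_power_scaling\<close>. The empty set is included, with coefficient 0.\<close>

lemma prob_all_eta_le:
  assumes S: "compact S" and y: "y > 0"
  shows "prob {\<omega> \<in> space M. \<forall>s\<in>S. \<eta> s \<omega> \<le> y} = exp (- (extremal_coeff M \<eta> S / y))"
proof -
  obtain D where D: "countable D" "D \<subseteq> S" "S \<subseteq> closure D"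
    using compact_countable_dense[OF S] by metis
  define g where "g z = prob {\<omega> \<in> space M. \<forall>s\<in>S. \<eta> s \<omega> \<le> z}" for z
  have gD: "g z = prob {\<omega> \<in> space M. \<forall>s\<in>D. \<eta> s \<omega> \<le> z}" for z
    unfolding g_def using eta_le_dense_iff[OF _ D(2,3)] by (intro arg_cong[of _ _ prob]) blast
  have mono: "g z \<le> g z'" if "0 < z" "z \<le> z'" for z z'
    unfolding g_def using that S by (intro finite_measure_mono) (auto intro: order_trans)
  have pow: "g (z / real n) = g z ^ n" if n: "n \<ge> 1" for n z
  proof -
    let ?E = "{f \<in> space paths. \<forall>s\<in>D. f s \<le> z}"
    have E: "?E \<in> sets paths"
      using D(1) by (intro sets.sets_Collect_countable_All') measurable
    have "emeasure M {\<omega> \<in> space M. (\<lambda>t. real n * \<eta> t \<omega>) \<in> ?E} = emeasure M {\<omega> \<in> space M. (\<lambda>t. \<eta> t \<omega>) \<in> ?E} ^ n"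
      by (rule antisym, rule emeasure_scaled_le_power[OF E _ n], simp add: space_PiM,
          rule emeasure_scaled_ge_power[OF E _ n], simp add: space_PiM)
    then have "prob {\<omega> \<in> space M. (\<lambda>t. real n * \<eta> t \<omega>) \<in> ?E} = prob {\<omega> \<in> space M. (\<lambda>t. \<eta> t \<omega>) \<in> ?E} ^ n"
      by (simp add: emeasure_eq_measure ennreal_power)
    moreover have "{\<omega> \<in> space M. (\<lambda>t. real n * \<eta> t \<omega>) \<in> ?E} = {\<omega> \<in> space M. \<forall>s\<in>D. \<eta> s \<omega> \<le> z / real n}"
      using n by (auto simp: space_PiM pos_le_divide_eq mult.commute)
    moreover have "{\<omega> \<in> space M. (\<lambda>t. \<eta> t \<omega>) \<in> ?E} = {\<omega> \<in> space M. \<forall>s\<in>D. \<eta> s \<omega> \<le> z}"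
      by (simp add: space_PiM)
    ultimately show ?thesis by (simp add: gD)
  qed
  \<comment> \<open>The power relation alone would also admit \<open>g = 0\<close>; since paths are
    bounded on the compact set, \<open>g\<close> tends to 1.\<close>
  have "\<exists>n::nat. n \<ge> 1 \<and> g (real n) > 0"
  proof -
    let ?A = "\<lambda>n::nat. {\<omega> \<in> space M. \<forall>s\<in>S. \<eta> s \<omega> \<le> real n}"
    have "(\<Union>n. ?A n) = space M"
    proof
      show "space M \<subseteq> (\<Union>n. ?A n)"
      proof
        fix \<omega> assume \<omega>: "\<omega> \<in> space M"
        have "compact ((\<lambda>s. \<eta> s \<omega>) ` S)"
          using eta_continuous[OF \<omega>] S by (intro compact_continuous_image) (auto intro: continuous_on_subset)
        then have "bdd_above ((\<lambda>s. \<eta> s \<omega>) ` S)" by (intro bounded_imp_bdd_above compact_imp_bounded)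
        then obtain B where B: "\<And>s. s \<in> S \<Longrightarrow> \<eta> s \<omega> \<le> B" by (auto simp: bdd_above_def)
        obtain n :: nat where "B \<le> real n" using real_arch_simple by blast
        then have "\<omega> \<in> ?A n" using \<omega> by (auto intro: order_trans[OF B])
        then show "\<omega> \<in> (\<Union>n. ?A n)" by (rule UN_I[OF UNIV_I])
      qed
    qed auto
    moreover have "(\<lambda>n. prob (?A n)) \<longlonglongrightarrow> prob (\<Union>n. ?A n)"
    proof (rule finite_Lim_measure_incseq)
      show "range ?A \<subseteq> events" using sets_all_eta_le[OF S] by blast
      show "incseq ?A" unfolding incseq_def by (auto intro: order_trans)
    qed
    ultimately have "(\<lambda>n. g (real n)) \<longlonglongrightarrow> 1" by (simp add: g_def prob_space)
    then have "\<forall>\<^sub>F n in sequentially. g (real n) > 0" by (rule order_tendstoD) simp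
    then show ?thesis using eventually_happens'[OF sequentially_bot eventually_conj[OF _ eventually_ge_at_top[of 1]]] by blast
  qed
  then obtain n :: nat where n: "n \<ge> 1" "g (real n) > 0" by blast
  obtain \<theta> where \<theta>: "\<forall>y>0. g y = exp (- (\<theta> / y))"
    using exp_of_power_scaling[of g "real n", OF mono pow] n by auto
  have g_SUP: "measure M {\<omega> \<in> space M. (SUP s\<in>S. ereal (\<eta> s \<omega>)) \<le> ereal y} = g y" for y
    by (simp add: g_def SUP_le_iff)
  have "extremal_coeff M \<eta> S = \<theta>"
    unfolding extremal_coeff_def g_SUP
  proof (rule the_equality)
    show "\<forall>y>0. g y = exp (- (\<theta> / y))" by fact
    fix \<theta>' assume "\<forall>y>0. g y = exp (- (\<theta>' / y))"
    then have "exp (- (\<theta>' / 1)) = exp (- (\<theta> / 1))" using \<theta> zero_less_one by metis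
    then show "\<theta>' = \<theta>" by simp
  qed
  then show ?thesis using \<theta> y by (simp add: g_def)
qed

abbreviation "\<theta> \<equiv> extremal_coeff M \<eta>"

lemma extremal_coeff_nonneg:
  assumes S: "compact S"
  shows "\<theta> S \<ge> 0"
proof -
  have "exp (- (\<theta> S / 1)) = prob {\<omega> \<in> space M. \<forall>s\<in>S. \<eta> s \<omega> \<le> 1}" using prob_all_eta_le[OF S, of 1] by simp
  also have "\<dots> \<le> 1" by (rule prob_le_1)
  finally have "exp (- (\<theta> S / 1)) \<le> 1" .
  then show ?thesis by simp
qed

lemma extremal_coeff_ge_1:
  assumes S: "compact S" "S \<noteq> {}"
  shows "\<theta> S \<ge> 1"
proof -
  obtain s where s: "s \<in> S" using S by blast
  have "exp (- (\<theta> S / 1)) = prob {\<omega> \<in> space M. \<forall>s\<in>S. \<eta> s \<omega> \<le> 1}" using prob_all_eta_le[OF S(1), of 1] by simp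
  also have "\<dots> \<le> prob {\<omega> \<in> space M. \<eta> s \<omega> \<le> 1}" using s by (intro finite_measure_mono) auto
  also have "\<dots> = exp (- 1)" using eta_frechet[of s 1] by simp
  finally show ?thesis by simp
qed

section \<open>Exceedance probabilities for one set and for two sets\<close>

definition exceedance :: "'t set \<Rightarrow> real \<Rightarrow> 'w set" where
  "exceedance S y = {\<omega> \<in> space M. \<exists>s\<in>S. y < \<eta> s \<omega>}"

lemma exceedance_eq: "exceedance S y = space M - {\<omega> \<in> space M. \<forall>s\<in>S. \<eta> s \<omega> \<le> y}"
  by (auto simp: exceedance_def not_le)

lemma exceedance_sets [measurable]: "compact S \<Longrightarrow> exceedance S y \<in> events"
  unfolding exceedance_eq using sets_all_eta_le by blast

lemma prob_exceedance:
  assumes "compact S" "y > 0"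
  shows "prob (exceedance S y) = 1 - exp (- (\<theta> S / y))"
  unfolding exceedance_eq using assms by (simp add: prob_compl prob_all_eta_le)

lemma prob_joint_exceedance:
  assumes A: "compact A" and B: "compact B" and y: "y > 0"
  shows "prob (exceedance A y \<inter> exceedance B y)
    = 1 - exp (- (\<theta> A / y)) - exp (- (\<theta> B / y)) + exp (- (\<theta> (A \<union> B) / y))"
proof -
  have "prob (exceedance A y \<union> exceedance B y)
      = prob (exceedance A y) + prob (exceedance B y) - prob (exceedance A y \<inter> exceedance B y)"
    using A B by (intro measure_Un3) (auto simp: fmeasurable_eq_sets)
  moreover have "exceedance A y \<union> exceedance B y = exceedance (A \<union> B) y" by (auto simp: exceedance_def)
  ultimately show ?thesis using prob_exceedance[OF _ y] A B compact_Un[OF A B] by simp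
qed

definition dependence :: "'t set \<Rightarrow> 't set \<Rightarrow> real" where
  "dependence A B = \<theta> A + \<theta> B - \<theta> (A \<union> B)"

lemma tendsto_exp_scaled: "(\<lambda>n. real n * (1 - exp (- (a / real n)))) \<longlonglongrightarrow> a"
proof (cases "a = 0")
  case False
  have "((\<lambda>h. (exp (0 + h) - exp 0) / h) \<longlongrightarrow> exp (0::real)) (at 0)"
    using DERIV_exp[of "0::real"] by (simp add: DERIV_def)
  moreover have "filterlim (\<lambda>n. - (a / real n)) (at 0) sequentially"
    unfolding filterlim_at using False
    by (auto intro!: tendsto_eq_intros lim_const_over_n eventually_sequentiallyI[of 1])
  ultimately have "(\<lambda>n. (exp (- (a / real n)) - 1) / (- (a / real n))) \<longlonglongrightarrow> 1"
    using filterlim_compose by fastforce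
  then have "(\<lambda>n. a * ((exp (- (a / real n)) - 1) / (- (a / real n)))) \<longlonglongrightarrow> a * 1"
    by (intro tendsto_mult tendsto_const)
  moreover have "\<forall>\<^sub>F n in sequentially. a * ((exp (- (a / real n)) - 1) / (- (a / real n))) = real n * (1 - exp (- (a / real n)))"
    using False by (intro eventually_sequentiallyI[of 1]) (simp add: field_simps)
  ultimately show ?thesis by (simp add: tendsto_cong)
qed simp

text \<open>A combination of three coefficients shows neither sign nor monotonicity; as a limit of
  rescaled probabilities of joint exceedance, \<open>dependence\<close> has both.\<close>

lemma dependence_limit:
  assumes A: "compact A" and B: "compact B"
  shows "(\<lambda>n. real n * prob (exceedance A (real n) \<inter> exceedance B (real n))) \<longlonglongrightarrow> dependence A B"
proof -
  have "(\<lambda>n. real n * (1 - exp (- (\<theta> A / real n))) + real n * (1 - exp (- (\<theta> B / real n)))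
      - real n * (1 - exp (- (\<theta> (A \<union> B) / real n)))) \<longlonglongrightarrow> dependence A B"
    unfolding dependence_def by (intro tendsto_add tendsto_diff tendsto_exp_scaled)
  moreover have "\<forall>\<^sub>F n in sequentially. real n * (1 - exp (- (\<theta> A / real n))) + real n * (1 - exp (- (\<theta> B / real n)))
      - real n * (1 - exp (- (\<theta> (A \<union> B) / real n))) = real n * prob (exceedance A (real n) \<inter> exceedance B (real n))"
  proof (rule eventually_sequentiallyI[of 1])
    fix n :: nat assume "1 \<le> n"
    then have n: "real n > 0" by simp
    show "real n * (1 - exp (- (\<theta> A / real n))) + real n * (1 - exp (- (\<theta> B / real n)))
      - real n * (1 - exp (- (\<theta> (A \<union> B) / real n))) = real n * prob (exceedance A (real n) \<inter> exceedance B (real n))"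
      unfolding prob_joint_exceedance[OF A B n] by (simp add: algebra_simps)
  qed
  ultimately show ?thesis by (simp add: tendsto_cong)
qed

lemma dependence_nonneg: "compact A \<Longrightarrow> compact B \<Longrightarrow> 0 \<le> dependence A B"
  by (rule LIMSEQ_le_const[OF dependence_limit]) auto

lemma dependence_mono:
  assumes "compact A" "compact B" "compact A'" "compact B'" "A \<subseteq> A'" "B \<subseteq> B'"
  shows "dependence A B \<le> dependence A' B'"
proof (rule LIMSEQ_le[OF dependence_limit dependence_limit])
  show "\<exists>N. \<forall>n\<ge>N. real n * prob (exceedance A (real n) \<inter> exceedance B (real n))
      \<le> real n * prob (exceedance A' (real n) \<inter> exceedance B' (real n))"
  proof (intro exI allI impI mult_left_mono finite_measure_mono)
    show "exceedance A y \<inter> exceedance B y \<subseteq> exceedance A' y \<inter> exceedance B' y" for y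
      using assms(5,6) by (auto simp: exceedance_def)
  qed (use assms in \<open>auto intro!: sets.Int\<close>)
qed (use assms in auto)

lemma prob_joint_exceedance_le:
  assumes A: "compact A" and B: "compact B" and z: "z > 0"
  shows "prob (exceedance A (1 / z) \<inter> exceedance B (1 / z)) \<le> dependence A B * z + \<theta> A * \<theta> B * z^2"
proof -
  let ?a = "\<theta> A * z" and ?b = "\<theta> B * z" and ?c = "\<theta> (A \<union> B) * z"
  have ab: "?a \<ge> 0" "?b \<ge> 0" using z extremal_coeff_nonneg A B by auto
  have d: "?a + ?b - ?c \<ge> 0"
    using mult_nonneg_nonneg[OF dependence_nonneg[OF A B], of z] z by (simp add: dependence_def algebra_simps)
  have e1: "0 \<le> 1 - exp (- x) \<and> 1 - exp (- x) \<le> x" if "x \<ge> 0" for x :: real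
    using exp_ge_add_one_self[of "-x"] that by auto
  have "prob (exceedance A (1 / z) \<inter> exceedance B (1 / z)) = 1 - exp (- ?a) - exp (- ?b) + exp (- ?c)"
    using prob_joint_exceedance[OF A B, of "1/z"] z by simp
  \<comment> \<open>Splits the joint probability into the product that independence would give, of
    second order in \<open>z\<close>, and a remainder linear in the dependence. Both are estimated
    by \<open>1 - exp (- x) \<le> x\<close>; the sign of \<open>?a + ?b - ?c\<close> is needed for
    the second.\<close>
  also have "\<dots> = (1 - exp (- ?a)) * (1 - exp (- ?b)) + exp (- ?c) * (1 - exp (- (?a + ?b - ?c)))"
    by (simp add: algebra_simps flip: exp_add)
  also have "\<dots> \<le> ?a * ?b + 1 * (?a + ?b - ?c)"
    using e1[OF ab(1)] e1[OF ab(2)] e1[OF d] extremal_coeff_nonneg[OF compact_Un[OF A B]] z ab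
    by (intro add_mono mult_mono) auto
  also have "\<dots> = dependence A B * z + \<theta> A * \<theta> B * z^2"
    by (simp add: dependence_def algebra_simps power2_eq_square)
  finally show ?thesis .
qed

lemma prob_exceedance_mult_le:
  assumes A: "compact A" and B: "compact B" and z: "z > 0"
  shows "prob (exceedance A (1 / z)) * prob (exceedance B (1 / z)) \<le> \<theta> A * \<theta> B * z^2"
proof -
  have e1: "1 - exp (- x) \<le> x" for x :: real
    using exp_ge_add_one_self[of "-x"] by linarith
  have "prob (exceedance S (1 / z)) \<le> \<theta> S * z" if "compact S" for S
    using prob_exceedance[OF that, of "1/z"] e1[of "\<theta> S * z"] z by simp
  then have "prob (exceedance A (1 / z)) * prob (exceedance B (1 / z)) \<le> (\<theta> A * z) * (\<theta> B * z)"
    using A B z extremal_coeff_nonneg by (intro mult_mono) auto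
  then show ?thesis by (simp add: power2_eq_square algebra_simps)
qed

section \<open>Moments of the reciprocal of the path infimum\<close>

definition inv_sup :: "'t set \<Rightarrow> 'w \<Rightarrow> ennreal" where
  "inv_sup S \<omega> = (SUP s\<in>S. inverse (ennreal (\<eta> s \<omega>)))"

lemma inv_sup_measurable_countable: "countable D \<Longrightarrow> inv_sup D \<in> borel_measurable M"
  unfolding inv_sup_def by (rule borel_measurable_SUP) auto

lemma inv_sup_dense:
  assumes \<omega>: "\<omega> \<in> space M" and D: "D \<subseteq> S" "S \<subseteq> closure D"
  shows "inv_sup S \<omega> = inv_sup D \<omega>"
proof (rule antisym)
  have "continuous_on UNIV (\<lambda>t. inverse (ennreal (\<eta> t \<omega>)))"
    using eta_continuous[OF \<omega>] by (rule continuous_on_inverse_ennreal[OF continuous_on_ennreal])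
  then have "closed {t. inverse (ennreal (\<eta> t \<omega>)) \<le> inv_sup D \<omega>}"
    by (intro closed_Collect_le continuous_on_const) auto
  moreover have "D \<subseteq> {t. inverse (ennreal (\<eta> t \<omega>)) \<le> inv_sup D \<omega>}"
    by (auto simp: inv_sup_def intro: SUP_upper)
  ultimately have "S \<subseteq> {t. inverse (ennreal (\<eta> t \<omega>)) \<le> inv_sup D \<omega>}" using closure_minimal D(2) by blast
  then show "inv_sup S \<omega> \<le> inv_sup D \<omega>" unfolding inv_sup_def[of S] by (auto intro: SUP_least)
  show "inv_sup D \<omega> \<le> inv_sup S \<omega>" unfolding inv_sup_def by (rule SUP_subset_mono[OF D(1)]) simp
qed

lemma inv_sup_measurable [measurable]:
  assumes "compact S"
  shows "inv_sup S \<in> borel_measurable M"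
proof -
  obtain D where D: "countable D" "D \<subseteq> S" "S \<subseteq> closure D"
    using compact_countable_dense[OF assms] by metis
  then show ?thesis
    using inv_sup_measurable_countable[OF D(1)] inv_sup_dense[OF _ D(2,3)]
    by (simp cong: measurable_cong)
qed

text \<open>Radius and level shrink together: a path that falls below \<open>1 / (n + 1)\<close>
  somewhere in the ball of radius \<open>1 / (n + 1)\<close>, for every \<open>n\<close>, satisfies
  \<open>\<eta> t \<le> 0\<close> by continuity, a null event. Hence for some \<open>n\<close> a low
  value has probability q < 1, and \<open>emeasure_scaled_le_power\<close> gives the reciprocal the
  tail \<open>q ^ k\<close>. Intersection with the countable \<open>D\<close> keeps the events
  product-measurable.\<close>

lemma inv_sup_square_finite_local:
  assumes D: "countable D"
  shows "\<exists>r>0. (\<integral>\<^sup>+\<omega>. inv_sup (D \<inter> ball t r) \<omega> ^ 2 \<partial>M) < \<infinity>"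
proof -
  let ?B = "\<lambda>n. D \<inter> ball t (1 / real (Suc n))"
  let ?A = "\<lambda>n. {\<omega> \<in> space M. \<exists>s\<in>?B n. \<eta> s \<omega> < 1 / real (Suc n)}"
  have A[measurable]: "?A n \<in> sets M" for n
    using D by (intro sets.sets_Collect_countable_Ex') auto
  have "decseq ?A"
  proof (intro decseq_SucI subsetI)
    fix n \<omega> assume "\<omega> \<in> ?A (Suc n)"
    then obtain s where s: "\<omega> \<in> space M" "s \<in> D" "dist t s < 1 / real (Suc (Suc n))" "\<eta> s \<omega> < 1 / real (Suc (Suc n))" by auto
    have "1 / real (Suc (Suc n)) \<le> 1 / real (Suc n)" by (simp add: field_simps)
    then have "dist t s < 1 / real (Suc n)" "\<eta> s \<omega> < 1 / real (Suc n)" using s by linarith+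
    then show "\<omega> \<in> ?A n" using s by auto
  qed
  then have lim: "(\<lambda>n. prob (?A n)) \<longlonglongrightarrow> prob (\<Inter>n. ?A n)"
    using A by (intro finite_Lim_measure_decseq) blast+
  have "(\<Inter>n. ?A n) \<subseteq> {\<omega> \<in> space M. \<eta> t \<omega> \<le> 0}"
  proof
    fix \<omega> assume w: "\<omega> \<in> (\<Inter>n. ?A n)"
    then have \<omega>: "\<omega> \<in> space M" by auto
    have "\<forall>n. \<exists>s. dist t s < 1 / real (Suc n) \<and> \<eta> s \<omega> < 1 / real (Suc n)" using w by fastforce
    then obtain s where s: "\<And>n. dist t (s n) < 1 / real (Suc n)" "\<And>n. \<eta> (s n) \<omega> < 1 / real (Suc n)" by metis
    have "s \<longlonglongrightarrow> t"
      by (rule metric_tendsto_imp_tendsto[OF LIMSEQ_inverse_real_of_nat])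
        (use s(1) in \<open>auto simp: dist_commute less_imp_le inverse_eq_divide\<close>)
    then have "(\<lambda>n. \<eta> (s n) \<omega>) \<longlonglongrightarrow> \<eta> t \<omega>"
      using eta_continuous[OF \<omega>] by (auto simp: continuous_on_eq_continuous_at intro: isCont_tendsto_compose)
    then have "\<eta> t \<omega> \<le> 0"
      by (rule LIMSEQ_le[OF _ LIMSEQ_inverse_real_of_nat])
        (use s(2) in \<open>auto simp: less_imp_le inverse_eq_divide\<close>)
    then show "\<omega> \<in> {\<omega> \<in> space M. \<eta> t \<omega> \<le> 0}" using \<omega> by simp
  qed
  then have "prob (\<Inter>n. ?A n) \<le> 0"
    using finite_measure_mono[of "\<Inter>n. ?A n" "{\<omega> \<in> space M. \<eta> t \<omega> \<le> 0}"] eta_frechet[of t 0] by simp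
  then have "prob (\<Inter>n. ?A n) < 1" by linarith
  from eventually_happens'[OF sequentially_bot order_tendstoD(2)[OF lim this]]
  obtain n where n: "prob (?A n) < 1" by blast
  let ?c = "real (Suc n)"
  have "(\<integral>\<^sup>+\<omega>. inv_sup (?B n) \<omega> ^ 2 \<partial>M) < \<infinity>"
  proof (rule nn_integral_square_finite_of_geometric_tail[where c = ?c and q = "prob (?A n)"])
    show "inv_sup (?B n) \<in> borel_measurable M" using D by (intro inv_sup_measurable_countable) auto
    show "emeasure M {\<omega> \<in> space M. ennreal (real k * ?c) < inv_sup (?B n) \<omega>} \<le> ennreal (prob (?A n) ^ k)" for k
    proof (cases "k = 0")
      case True
      then show ?thesis by (simp add: emeasure_eq_measure)
    next
      case False
      then have k: "k \<ge> 1" by simp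
      let ?E = "{f \<in> space paths. \<exists>s\<in>?B n. f s < 1 / ?c}"
      have E: "?E \<in> sets paths"
        using D by (intro sets.sets_Collect_countable_Ex') (auto intro!: borel_measurable_less)
      have "{\<omega> \<in> space M. ennreal (real k * ?c) < inv_sup (?B n) \<omega>} \<subseteq> {\<omega> \<in> space M. (\<lambda>t. real k * \<eta> t \<omega>) \<in> ?E}"
      proof (intro subsetI CollectI)
        fix \<omega> assume "\<omega> \<in> {\<omega> \<in> space M. ennreal (real k * ?c) < inv_sup (?B n) \<omega>}"
        then have \<omega>: "\<omega> \<in> space M" and "ennreal (real k * ?c) < inv_sup (?B n) \<omega>" by auto
        then obtain s where s: "s \<in> ?B n" "ennreal (real k * ?c) < inverse (ennreal (\<eta> s \<omega>))"
          unfolding inv_sup_def less_SUP_iff by blast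
        have "real k * \<eta> s \<omega> < 1 / ?c"
        proof (cases "\<eta> s \<omega> > 0")
          case True
          then have "real k * ?c < inverse (\<eta> s \<omega>)"
            using s(2) by (simp add: inverse_ennreal ennreal_less_iff)
          then show ?thesis using True by (simp add: field_simps)
        next
          \<comment> \<open>A value that is not positive has an infinite reciprocal; it still counts
            as low after scaling.\<close>
          case False
          then have "real k * \<eta> s \<omega> \<le> 0" by (simp add: mult_nonneg_nonpos)
          also have "0 < 1 / ?c" by simp
          finally show ?thesis .
        qed
        then show "\<omega> \<in> space M \<and> (\<lambda>t. real k * \<eta> t \<omega>) \<in> ?E" using s(1) \<omega> by (auto simp: space_PiM)
      qed
      then have "emeasure M {\<omega> \<in> space M. ennreal (real k * ?c) < inv_sup (?B n) \<omega>}
          \<le> emeasure M {\<omega> \<in> space M. (\<lambda>t. real k * \<eta> t \<omega>) \<in> ?E}"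
      proof (rule emeasure_mono)
        have "(\<lambda>\<omega> t. real k * \<eta> t \<omega>) \<in> measurable M paths"
          by (rule measurable_path_PiM) measurable
        from measurable_sets[OF this E] show "{\<omega> \<in> space M. (\<lambda>t. real k * \<eta> t \<omega>) \<in> ?E} \<in> events"
          by (simp add: vimage_def Int_def conj_commute)
      qed
      also have "\<dots> \<le> emeasure M {\<omega> \<in> space M. (\<lambda>t. \<eta> t \<omega>) \<in> ?E} ^ k"
        by (rule emeasure_scaled_le_power[OF E _ k]) (auto simp: space_PiM)
      also have "{\<omega> \<in> space M. (\<lambda>t. \<eta> t \<omega>) \<in> ?E} = ?A n" by (simp add: space_PiM)
      also have "emeasure M (?A n) ^ k = ennreal (prob (?A n) ^ k)" by (simp add: emeasure_eq_measure ennreal_power)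
      finally show ?thesis .
    qed
  qed (use n in auto)
  then show ?thesis by (intro exI[of _ "1 / ?c"]) auto
qed

lemma inv_sup_Un: "inv_sup (A \<union> B) \<omega> = max (inv_sup A \<omega>) (inv_sup B \<omega>)"
  by (simp add: inv_sup_def SUP_union sup_max)

lemma inv_sup_mono: "A \<subseteq> B \<Longrightarrow> inv_sup A \<omega> \<le> inv_sup B \<omega>"
  unfolding inv_sup_def by (rule SUP_subset_mono) auto

text \<open>Finitely many of the balls found locally cover the compact set, and the square of a
  maximum is at most the sum of the squares.\<close>

lemma inv_sup_square_finite:
  assumes S: "compact S"
  shows "(\<integral>\<^sup>+\<omega>. inv_sup S \<omega> ^ 2 \<partial>M) < \<infinity>"
proof -
  obtain D where D: "countable D" "D \<subseteq> S" "S \<subseteq> closure D"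
    using compact_countable_dense[OF S] by metis
  obtain r where r: "\<And>t. r t > 0" "\<And>t. (\<integral>\<^sup>+\<omega>. inv_sup (D \<inter> ball t (r t)) \<omega> ^ 2 \<partial>M) < \<infinity>"
    using inv_sup_square_finite_local[OF D(1)] by metis
  obtain F where F: "finite F" "S \<subseteq> (\<Union>t\<in>F. ball t (r t))"
  proof -
    have "S \<subseteq> (\<Union>t\<in>S. ball t (r t))" using r(1) by force
    then show thesis using compactE_image[OF S, of S "\<lambda>t. ball t (r t)"] that by (metis open_ball)
  qed
  have fin: "(\<integral>\<^sup>+\<omega>. inv_sup (D \<inter> (\<Union>t\<in>G. ball t (r t))) \<omega> ^ 2 \<partial>M) < \<infinity>" if "finite G" for G
    using that
  proof induction
    case empty
    then show ?case by (simp add: inv_sup_def bot_ennreal)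
  next
    case (insert x G)
    let ?a = "inv_sup (D \<inter> ball x (r x))" and ?b = "inv_sup (D \<inter> (\<Union>t\<in>G. ball t (r t)))"
    have [measurable]: "?a \<in> borel_measurable M" "?b \<in> borel_measurable M"
      using D(1) by (auto intro!: inv_sup_measurable_countable)
    have "D \<inter> (\<Union>t\<in>insert x G. ball t (r t)) = (D \<inter> ball x (r x)) \<union> (D \<inter> (\<Union>t\<in>G. ball t (r t)))" by auto
    then have "(\<integral>\<^sup>+\<omega>. inv_sup (D \<inter> (\<Union>t\<in>insert x G. ball t (r t))) \<omega> ^ 2 \<partial>M) = (\<integral>\<^sup>+\<omega>. max (?a \<omega>) (?b \<omega>) ^ 2 \<partial>M)"
      by (simp only: inv_sup_Un)
    also have "\<dots> \<le> (\<integral>\<^sup>+\<omega>. ?a \<omega> ^ 2 + ?b \<omega> ^ 2 \<partial>M)"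
      by (intro nn_integral_mono) (auto simp: max_def)
    also have "\<dots> = (\<integral>\<^sup>+\<omega>. ?a \<omega> ^ 2 \<partial>M) + (\<integral>\<^sup>+\<omega>. ?b \<omega> ^ 2 \<partial>M)"
      by (rule nn_integral_add) measurable
    also have "\<dots> < \<infinity>" using insert.IH r(2)[of x] by simp
    finally show ?case .
  qed
  have "D \<inter> (\<Union>t\<in>F. ball t (r t)) = D" using F(2) D(2) by blast
  then have "(\<integral>\<^sup>+\<omega>. inv_sup D \<omega> ^ 2 \<partial>M) < \<infinity>" using fin[OF F(1)] by simp
  moreover have "(\<integral>\<^sup>+\<omega>. inv_sup S \<omega> ^ 2 \<partial>M) = (\<integral>\<^sup>+\<omega>. inv_sup D \<omega> ^ 2 \<partial>M)"
    using inv_sup_dense[OF _ D(2,3)] by (intro nn_integral_cong) simp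
  ultimately show ?thesis by simp
qed

lemma inv_sup_expectation_eq: "inv_sup_expectation M \<eta> S = (\<integral>\<^sup>+\<omega>. inv_sup S \<omega> \<partial>M)"
  by (simp add: inv_sup_expectation_def inv_sup_def)

lemma inv_sup_expectation_finite:
  assumes S: "compact S"
  shows "inv_sup_expectation M \<eta> S < \<infinity>"
proof -
  have le: "x \<le> 1 + x ^ 2" for x :: ennreal
  proof (cases "x \<le> 1")
    case True
    then show ?thesis by (rule order_trans) simp
  next
    case False
    then have "1 * x \<le> x * x" by (intro mult_right_mono) auto
    then show ?thesis by (simp add: power2_eq_square add_increasing)
  qed
  have [measurable]: "inv_sup S \<in> borel_measurable M" using S by measurable
  have "(\<integral>\<^sup>+\<omega>. inv_sup S \<omega> \<partial>M) \<le> (\<integral>\<^sup>+\<omega>. 1 + inv_sup S \<omega> ^ 2 \<partial>M)" by (intro nn_integral_mono le)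
  also have "\<dots> = 1 + (\<integral>\<^sup>+\<omega>. inv_sup S \<omega> ^ 2 \<partial>M)" by (subst nn_integral_add) (auto simp: emeasure_space_1)
  also have "\<dots> < \<infinity>" using inv_sup_square_finite[OF S] by simp
  finally show ?thesis by (simp add: inv_sup_expectation_eq)
qed

lemma inv_sup_expectation_mono: "A \<subseteq> B \<Longrightarrow> inv_sup_expectation M \<eta> A \<le> inv_sup_expectation M \<eta> B"
  unfolding inv_sup_expectation_eq by (intro nn_integral_mono inv_sup_mono)

end

section \<open>Lindeberg replacement\<close>

definition pmax :: "('t \<Rightarrow> real) \<Rightarrow> ('t \<Rightarrow> real) \<Rightarrow> 't \<Rightarrow> real" where
  "pmax f g = (\<lambda>t. max (f t) (g t))"

definition pscale :: "real \<Rightarrow> ('t \<Rightarrow> real) \<Rightarrow> 't \<Rightarrow> real" where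
  "pscale c f = (\<lambda>t. c * f t)"

lemma pmax_assoc: "pmax (pmax f g) h = pmax f (pmax g h)"
  by (simp add: pmax_def max.assoc)

lemma pmax_right_commute: "pmax (pmax f g) h = pmax (pmax f h) g"
  unfolding pmax_def max.assoc by (subst (2) max.commute) (rule refl)

lemma in_space_PiM_UNIV_borel [simp, measurable]: "f \<in> space (PiM UNIV (\<lambda>_. borel))"
  by (simp add: space_PiM)

lemma measurable_PiM_UNIV_component:
  assumes "f \<in> measurable N (PiM UNIV (\<lambda>_. borel :: real measure))"
  shows "(\<lambda>x. f x t) \<in> borel_measurable N"
  using measurable_compose[OF assms measurable_component_singleton[of t UNIV]] by simp

lemma measurable_pmax [measurable (raw)]:
  assumes "f \<in> measurable N (PiM UNIV (\<lambda>_. borel))" "g \<in> measurable N (PiM UNIV (\<lambda>_. borel))"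
  shows "(\<lambda>x. pmax (f x) (g x)) \<in> measurable N (PiM UNIV (\<lambda>_. borel))"
  unfolding pmax_def
  by (rule measurable_path_PiM, rule borel_measurable_max) (rule measurable_PiM_UNIV_component, fact)+

lemma measurable_pscale [measurable (raw)]:
  assumes "f \<in> measurable N (PiM UNIV (\<lambda>_. borel))"
  shows "(\<lambda>x. pscale c (f x)) \<in> measurable N (PiM UNIV (\<lambda>_. borel))"
  unfolding pscale_def
  by (rule measurable_path_PiM, rule borel_measurable_times[OF borel_measurable_const])
    (rule measurable_PiM_UNIV_component, fact)

text \<open>The functional of a path behind \<open>inv_sup\<close>, separated from \<eta> because it
  is applied to maxima of scaled copies. Values that are not positive have reciprocal infinity, so a
  finite value keeps the path away from 0 on \<open>A\<close>.\<close>

definition inv_sup_path :: "'t set \<Rightarrow> ('t \<Rightarrow> real) \<Rightarrow> ennreal" where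
  "inv_sup_path A f = (SUP t\<in>A. inverse (ennreal (f t)))"

lemma measurable_inv_sup_path:
  assumes "countable A" "f \<in> measurable N (PiM UNIV (\<lambda>_. borel))"
  shows "(\<lambda>x. inv_sup_path A (f x)) \<in> borel_measurable N"
  unfolding inv_sup_path_def
  using assms by (intro borel_measurable_SUP) (auto intro!: borel_measurable_inverse_ennreal measurable_compose[OF measurable_PiM_UNIV_component measurable_ennreal])

lemma inv_sup_path_pscale:
  assumes c: "c > 0"
  shows "inv_sup_path A (pscale c f) = ennreal (1 / c) * inv_sup_path A f"
proof -
  have "inverse (ennreal (c * x)) = ennreal (1 / c) * inverse (ennreal x)" for x
  proof (cases "x > 0")
    case True
    then show ?thesis using c by (simp add: inverse_ennreal ennreal_mult[symmetric] field_simps)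
  next
    case False
    then have "c * x \<le> 0" using c by (simp add: mult_nonneg_nonpos)
    then show ?thesis using False c by (simp add: ennreal_neg ennreal_mult_top)
  qed
  then show ?thesis by (simp add: inv_sup_path_def pscale_def SUP_mult_left_ennreal)
qed

context max_stable_field
begin

lemma measurable_pos_path [measurable]: "pos_path \<in> measurable M paths"
  by (rule measurable_path_PiM) measurable

abbreviation scaled :: "nat \<Rightarrow> 'w \<Rightarrow> 't \<Rightarrow> real" where
  "scaled n \<omega> \<equiv> pscale (real n) (pos_path \<omega>)"

lemma nn_integral_pmax_scaled:
  assumes "G \<in> borel_measurable paths"
  shows "(\<integral>\<^sup>+\<omega>. G (scaled (j + k) \<omega>) \<partial>M) = (\<integral>\<^sup>+\<omega>. \<integral>\<^sup>+\<omega>'. G (pmax (scaled j \<omega>) (scaled k \<omega>')) \<partial>M \<partial>M)"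
  using nn_integral_max_pos_path[OF assms] unfolding pmax_def pscale_def .

lemma nn_integral_pmax_scaled_Suc:
  assumes "G \<in> borel_measurable paths"
  shows "(\<integral>\<^sup>+\<omega>. G (scaled (Suc k) \<omega>) \<partial>M) = (\<integral>\<^sup>+\<omega>. \<integral>\<^sup>+\<omega>'. G (pmax (scaled k \<omega>) (pos_path \<omega>')) \<partial>M \<partial>M)"
  using nn_integral_pmax_scaled[OF assms, of k 1] by (simp add: pscale_def)

lemma nn_integral_swap:
  assumes "(\<lambda>x. F (fst x) (snd x)) \<in> borel_measurable (M \<Otimes>\<^sub>M M)"
  shows "(\<integral>\<^sup>+x. \<integral>\<^sup>+y. F x y \<partial>M \<partial>M) = (\<integral>\<^sup>+y. \<integral>\<^sup>+x. F x y \<partial>M \<partial>M)"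
proof -
  interpret pair_sigma_finite M M by standard
  show ?thesis using assms by (intro Fubini'[symmetric]) (simp add: case_prod_unfold)
qed

lemma nn_integral_swap3:
  assumes F: "(\<lambda>x. F (fst x) (fst (snd x)) (snd (snd x))) \<in> borel_measurable (M \<Otimes>\<^sub>M (M \<Otimes>\<^sub>M M))"
  shows "(\<integral>\<^sup>+x. \<integral>\<^sup>+y. \<integral>\<^sup>+z. F x y z \<partial>M \<partial>M \<partial>M) = (\<integral>\<^sup>+y. \<integral>\<^sup>+z. \<integral>\<^sup>+x. F x y z \<partial>M \<partial>M \<partial>M)"
proof -
  have F'[measurable (raw)]: "(\<lambda>x. F (f x) (g x) (h x)) \<in> borel_measurable N"
    if "f \<in> measurable N M" "g \<in> measurable N M" "h \<in> measurable N M" for N f g h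
    using measurable_compose[OF measurable_Pair[OF that(1) measurable_Pair[OF that(2,3)]] F] by simp
  have "(\<integral>\<^sup>+x. \<integral>\<^sup>+y. \<integral>\<^sup>+z. F x y z \<partial>M \<partial>M \<partial>M) = (\<integral>\<^sup>+y. \<integral>\<^sup>+x. \<integral>\<^sup>+z. F x y z \<partial>M \<partial>M \<partial>M)"
    by (rule nn_integral_swap) measurable
  also have "\<dots> = (\<integral>\<^sup>+y. \<integral>\<^sup>+z. \<integral>\<^sup>+x. F x y z \<partial>M \<partial>M \<partial>M)"
  proof (rule nn_integral_cong)
    fix y assume [measurable]: "y \<in> space M"
    show "(\<integral>\<^sup>+x. \<integral>\<^sup>+z. F x y z \<partial>M \<partial>M) = (\<integral>\<^sup>+z. \<integral>\<^sup>+x. F x y z \<partial>M \<partial>M)"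
      by (rule nn_integral_swap) measurable
  qed
  finally show ?thesis .
qed

text \<open>The law of \<open>(R\<^sub>1, R\<^sub>2)\<close> with a component common to both entries (weight \<open>k\<close>) and components
  independent of each other (weight \<open>l\<close>); it interpolates between complete dependence and independence.\<close>

definition interp :: "nat \<Rightarrow> nat \<Rightarrow> (('t \<Rightarrow> real) \<Rightarrow> ('t \<Rightarrow> real) \<Rightarrow> ennreal) \<Rightarrow> ennreal" where
  "interp k l \<Phi> = (\<integral>\<^sup>+f. \<integral>\<^sup>+u. \<integral>\<^sup>+v. \<Phi> (pmax (scaled k f) (scaled l u)) (pmax (scaled k f) (scaled l v)) \<partial>M \<partial>M \<partial>M)"

definition bimeasurable :: "(('t \<Rightarrow> real) \<Rightarrow> ('t \<Rightarrow> real) \<Rightarrow> ennreal) \<Rightarrow> bool" where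
  "bimeasurable H \<longleftrightarrow> (\<lambda>x. H (fst x) (snd x)) \<in> borel_measurable (paths \<Otimes>\<^sub>M paths)"

lemma bimeasurableD:
  assumes "bimeasurable H" "f \<in> measurable N paths" "g \<in> measurable N paths"
  shows "(\<lambda>x. H (f x) (g x)) \<in> borel_measurable N"
  using measurable_compose[OF measurable_Pair[OF assms(2,3)], of "\<lambda>x. H (fst x) (snd x)"] assms(1)
  by (simp add: bimeasurable_def)

text \<open>The two ways of adding one more copy to a pair of maxima: a common one here, two
  independent ones in \<open>indep_step\<close>. Lowering the first or the second weight of
  \<open>interp\<close> by one produces these operators, so exchanging a copy amounts to comparing
  them.\<close>

definition joint_step where
  "joint_step H r1 r2 = (\<integral>\<^sup>+x. H (pmax r1 (pos_path x)) (pmax r2 (pos_path x)) \<partial>M)"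

definition indep_step where
  "indep_step H r1 r2 = (\<integral>\<^sup>+x. \<integral>\<^sup>+y. H (pmax r1 (pos_path x)) (pmax r2 (pos_path y)) \<partial>M \<partial>M)"

lemma bimeasurable_joint_step:
  assumes "bimeasurable H" shows "bimeasurable (joint_step H)"
proof -
  note [measurable (raw)] = bimeasurableD[OF assms]
  show ?thesis unfolding bimeasurable_def joint_step_def by measurable
qed

lemma bimeasurable_indep_step:
  assumes "bimeasurable H" shows "bimeasurable (indep_step H)"
proof -
  note [measurable (raw)] = bimeasurableD[OF assms]
  show ?thesis unfolding bimeasurable_def indep_step_def by measurable
qed

text \<open>The common path \<open>f\<close> occurs in both entries, so it is decomposed inside a
  functional of \<open>f\<close> alone, with \<open>u\<close> and \<open>v\<close> fixed; for this
  its integral is moved to the inside and back.\<close>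

lemma interp_Suc_left:
  assumes H: "bimeasurable H"
  shows "interp (Suc k) l H = interp k l (joint_step H)"
proof -
  note [measurable (raw)] = bimeasurableD[OF H] bimeasurableD[OF bimeasurable_joint_step[OF H]]
  have "interp (Suc k) l H = (\<integral>\<^sup>+u. \<integral>\<^sup>+v. \<integral>\<^sup>+f. H (pmax (scaled (Suc k) f) (scaled l u)) (pmax (scaled (Suc k) f) (scaled l v)) \<partial>M \<partial>M \<partial>M)"
    unfolding interp_def by (rule nn_integral_swap3) measurable
  also have "\<dots> = (\<integral>\<^sup>+u. \<integral>\<^sup>+v. \<integral>\<^sup>+f. joint_step H (pmax (scaled k f) (scaled l u)) (pmax (scaled k f) (scaled l v)) \<partial>M \<partial>M \<partial>M)"
  proof (rule nn_integral_cong, rule nn_integral_cong)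
    fix u v
    have "(\<integral>\<^sup>+f. H (pmax (scaled (Suc k) f) (scaled l u)) (pmax (scaled (Suc k) f) (scaled l v)) \<partial>M)
        = (\<integral>\<^sup>+f. \<integral>\<^sup>+x. H (pmax (pmax (scaled k f) (pos_path x)) (scaled l u)) (pmax (pmax (scaled k f) (pos_path x)) (scaled l v)) \<partial>M \<partial>M)"
      by (rule nn_integral_pmax_scaled_Suc[of "\<lambda>h. H (pmax h (scaled l u)) (pmax h (scaled l v))"]) measurable
    then show "(\<integral>\<^sup>+f. H (pmax (scaled (Suc k) f) (scaled l u)) (pmax (scaled (Suc k) f) (scaled l v)) \<partial>M)
        = (\<integral>\<^sup>+f. joint_step H (pmax (scaled k f) (scaled l u)) (pmax (scaled k f) (scaled l v)) \<partial>M)"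
      by (simp add: joint_step_def pmax_right_commute[of _ "pos_path _"])
  qed
  also have "\<dots> = interp k l (joint_step H)"
    unfolding interp_def by (rule nn_integral_swap3[symmetric]) measurable
  finally show ?thesis .
qed

lemma interp_Suc_right:
  assumes H: "bimeasurable H"
  shows "interp k (Suc l) H = interp k l (indep_step H)"
  unfolding interp_def
proof (rule nn_integral_cong)
  fix f
  note [measurable (raw)] = bimeasurableD[OF H]
  let ?G = "\<lambda>a b. H (pmax (scaled k f) a) (pmax (scaled k f) b)"
  \<comment> \<open>\<open>u\<close> and \<open>v\<close> are decomposed one after the other; their
    new copies \<open>x\<close> and \<open>y\<close> get integrals of their own, which is the
    independence in \<open>indep_step\<close>.\<close>
  have "(\<integral>\<^sup>+u. \<integral>\<^sup>+v. ?G (scaled (Suc l) u) (scaled (Suc l) v) \<partial>M \<partial>M)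
      = (\<integral>\<^sup>+u. \<integral>\<^sup>+x. \<integral>\<^sup>+v. ?G (pmax (scaled l u) (pos_path x)) (scaled (Suc l) v) \<partial>M \<partial>M \<partial>M)"
    by (rule nn_integral_pmax_scaled_Suc[of "\<lambda>a. \<integral>\<^sup>+v. ?G a (scaled (Suc l) v) \<partial>M"]) measurable
  also have "\<dots> = (\<integral>\<^sup>+u. \<integral>\<^sup>+x. \<integral>\<^sup>+v. \<integral>\<^sup>+y. ?G (pmax (scaled l u) (pos_path x)) (pmax (scaled l v) (pos_path y)) \<partial>M \<partial>M \<partial>M \<partial>M)"
    by (rule nn_integral_cong, rule nn_integral_cong, rule nn_integral_pmax_scaled_Suc) measurable
  also have "\<dots> = (\<integral>\<^sup>+u. \<integral>\<^sup>+v. \<integral>\<^sup>+x. \<integral>\<^sup>+y. ?G (pmax (scaled l u) (pos_path x)) (pmax (scaled l v) (pos_path y)) \<partial>M \<partial>M \<partial>M \<partial>M)"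
    by (rule nn_integral_cong, rule nn_integral_swap) measurable
  also have "\<dots> = (\<integral>\<^sup>+u. \<integral>\<^sup>+v. indep_step H (pmax (scaled k f) (scaled l u)) (pmax (scaled k f) (scaled l v)) \<partial>M \<partial>M)"
    by (simp add: indep_step_def pmax_assoc)
  finally show "(\<integral>\<^sup>+u. \<integral>\<^sup>+v. ?G (scaled (Suc l) u) (scaled (Suc l) v) \<partial>M \<partial>M)
      = (\<integral>\<^sup>+u. \<integral>\<^sup>+v. indep_step H (pmax (scaled k f) (scaled l u)) (pmax (scaled k f) (scaled l v)) \<partial>M \<partial>M)" .
qed

lemma interp_left: "interp n 0 H = (\<integral>\<^sup>+f. H (scaled n f) (scaled n f) \<partial>M)"
proof -
  have "pmax (scaled n f) (scaled 0 u) = scaled n f" for f u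
    by (simp add: pmax_def pscale_def max_absorb1)
  then show ?thesis by (simp add: interp_def emeasure_space_1)
qed

lemma interp_right: "interp 0 n H = (\<integral>\<^sup>+u. \<integral>\<^sup>+v. H (scaled n u) (scaled n v) \<partial>M \<partial>M)"
proof -
  have "pmax (scaled 0 f) (scaled n u) = scaled n u" for f u
    by (simp add: pmax_def pscale_def max_absorb2)
  then show ?thesis by (simp add: interp_def emeasure_space_1)
qed

section \<open>Linearity and marginals of the interpolating law\<close>

lemma interp_mono: "(\<And>r1 r2. \<Phi> r1 r2 \<le> \<Psi> r1 r2) \<Longrightarrow> interp k l \<Phi> \<le> interp k l \<Psi>"
  unfolding interp_def by (intro nn_integral_mono) auto

lemma interp_add:
  assumes "bimeasurable \<Phi>" "bimeasurable \<Psi>"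
  shows "interp k l (\<lambda>r1 r2. \<Phi> r1 r2 + \<Psi> r1 r2) = interp k l \<Phi> + interp k l \<Psi>"
proof -
  note [measurable (raw)] = bimeasurableD[OF assms(1)] bimeasurableD[OF assms(2)]
  show ?thesis unfolding interp_def by (simp add: nn_integral_add)
qed

lemma interp_cmult:
  assumes "bimeasurable \<Phi>"
  shows "interp k l (\<lambda>r1 r2. c * \<Phi> r1 r2) = c * interp k l \<Phi>"
proof -
  note [measurable (raw)] = bimeasurableD[OF assms(1)]
  show ?thesis unfolding interp_def by (simp add: nn_integral_cmult)
qed

lemma interp_sum:
  assumes "finite I" "\<And>i. i \<in> I \<Longrightarrow> bimeasurable (\<Phi> i)"
  shows "interp k l (\<lambda>r1 r2. \<Sum>i\<in>I. \<Phi> i r1 r2) = (\<Sum>i\<in>I. interp k l (\<Phi> i))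
    \<and> bimeasurable (\<lambda>r1 r2. \<Sum>i\<in>I. \<Phi> i r1 r2)"
  using assms
proof (induction I)
  case empty
  then show ?case by (simp add: interp_def bimeasurable_def)
next
  case (insert i I)
  then have "bimeasurable (\<Phi> i)" "bimeasurable (\<lambda>r1 r2. \<Sum>i\<in>I. \<Phi> i r1 r2)" by auto
  moreover from this have "bimeasurable (\<lambda>r1 r2. \<Phi> i r1 r2 + (\<Sum>i\<in>I. \<Phi> i r1 r2))"
    unfolding bimeasurable_def by (rule borel_measurable_add)
  ultimately show ?case using insert by (simp add: interp_add)
qed

text \<open>Each entry by itself has the law of \<open>scaled (k + l)\<close>, whatever the split
  into common and independent weight; so expectations that involve one entry stay constant along the
  interpolation.\<close>

lemma interp_first:
  assumes G[measurable]: "G \<in> borel_measurable paths"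
  shows "interp k l (\<lambda>r1 r2. G r1) = (\<integral>\<^sup>+\<omega>. G (scaled (k + l) \<omega>) \<partial>M)"
  unfolding interp_def nn_integral_pmax_scaled[OF G] by (simp add: emeasure_space_1)

lemma interp_second:
  assumes G[measurable]: "G \<in> borel_measurable paths"
  shows "interp k l (\<lambda>r1 r2. G r2) = (\<integral>\<^sup>+\<omega>. G (scaled (k + l) \<omega>) \<partial>M)"
  unfolding interp_def nn_integral_pmax_scaled[OF G] by (simp add: emeasure_space_1)

text \<open>Exceedance of a path, in use the maximum of the other copies, in place of a constant
  level. For finite \<open>F\<close> this is measurable without any regularity of
  \<open>r\<close>.\<close>

definition overshoot :: "'t set \<Rightarrow> ('t \<Rightarrow> real) \<Rightarrow> 'w set" where
  "overshoot F r = {\<omega> \<in> space M. \<exists>t\<in>F. r t < pos_path \<omega> t}"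

lemma overshoot_sets [measurable]: "finite F \<Longrightarrow> overshoot F r \<in> events"
  unfolding overshoot_def by (rule sets.sets_Collect_countable_Ex') (auto intro: countable_finite)

definition depends_on :: "(('t \<Rightarrow> real) \<Rightarrow> ('t \<Rightarrow> real) \<Rightarrow> ennreal) \<Rightarrow> 't set \<Rightarrow> 't set \<Rightarrow> bool" where
  "depends_on H F1 F2 \<longleftrightarrow>
    (\<forall>f f' g g'. (\<forall>t\<in>F1. f t = f' t) \<longrightarrow> (\<forall>t\<in>F2. g t = g' t) \<longrightarrow> H f g = H f' g')"

lemma depends_onD:
  assumes "depends_on H F1 F2" "\<forall>t\<in>F1. f t = f' t" "\<forall>t\<in>F2. g t = g' t"
  shows "H f g = H f' g'"
  using assms unfolding depends_on_def by blast

text \<open>The mixed difference \<open>h(x, y) - h(x, \<bottom>) - h(\<bottom>, y) + h(\<bottom>, \<bottom>)\<close> of \<open>h(x, y) = H (r1 \<or> x) (r2 \<or> y)\<close>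
  vanishes unless \<open>x\<close> overshoots \<open>r1\<close> and \<open>y\<close> overshoots \<open>r2\<close>, and adding the terms that depend on
  one variable only does not change the difference of the two expectations.\<close>

lemma joint_indep_step:
  assumes H: "bimeasurable H" "\<And>f g. H f g \<le> 1" "depends_on H F1 F2"
    and F: "finite F1" "finite F2"
  defines "err \<equiv> \<lambda>r1 r2. 2 * (emeasure M (overshoot F1 r1 \<inter> overshoot F2 r2)
      + emeasure M (overshoot F1 r1) * emeasure M (overshoot F2 r2))"
  shows "joint_step H r1 r2 \<le> indep_step H r1 r2 + err r1 r2"
    and "indep_step H r1 r2 \<le> joint_step H r1 r2 + err r1 r2"
proof -
  note [measurable (raw)] = bimeasurableD[OF H(1)]
  note [measurable] = overshoot_sets[OF F(1)] overshoot_sets[OF F(2)]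
  let ?h = "\<lambda>x y. H (pmax r1 (pos_path x)) (pmax r2 (pos_path y))"
  let ?h1 = "\<lambda>x. H (pmax r1 (pos_path x)) r2" and ?h2 = "\<lambda>y. H r1 (pmax r2 (pos_path y))"
  let ?A = "overshoot F1 r1" and ?B = "overshoot F2 r2"
  have no1: "H (pmax r1 (pos_path x)) g = H r1 g" if "x \<in> space M" "x \<notin> ?A" for x g
  proof -
    have "\<forall>t\<in>F1. pmax r1 (pos_path x) t = r1 t"
      using that by (auto simp: overshoot_def pmax_def max_absorb1 not_less)
    then show ?thesis by (intro depends_onD[OF H(3)]) auto
  qed
  have no2: "H g (pmax r2 (pos_path x)) = H g r2" if "x \<in> space M" "x \<notin> ?B" for x g
  proof -
    have "\<forall>t\<in>F2. pmax r2 (pos_path x) t = r2 t"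
      using that by (auto simp: overshoot_def pmax_def max_absorb1 not_less)
    then show ?thesis by (intro depends_onD[OF H(3)]) auto
  qed
  \<comment> \<open>Source of the factor 2: each side of the mixed difference is a sum of two values
    of \<open>H\<close>, which are at most 1.\<close>
  have two: "a + b \<le> 2" if "a \<le> 1" "b \<le> 1" for a b :: ennreal
    using add_mono[OF that] by (simp add: one_add_one)
  \<comment> \<open>The bounds from above and below on the mixed difference, written as sums because
    subtraction in \<open>ennreal\<close> is truncated.\<close>
  have sq1: "?h x y + H r1 r2 \<le> ?h1 x + ?h2 y + 2 * (indicator ?A x * indicator ?B y)"
    and sq2: "?h1 x + ?h2 y \<le> ?h x y + H r1 r2 + 2 * (indicator ?A x * indicator ?B y)"
    if "x \<in> space M" "y \<in> space M" for x y
  proof -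
    consider "x \<notin> ?A" | "y \<notin> ?B" | "x \<in> ?A" "y \<in> ?B" by blast
    then have "?h x y + H r1 r2 \<le> ?h1 x + ?h2 y + 2 * (indicator ?A x * indicator ?B y) \<and>
        ?h1 x + ?h2 y \<le> ?h x y + H r1 r2 + 2 * (indicator ?A x * indicator ?B y)"
    proof cases
      case 1
      then show ?thesis using no1[OF that(1)] by (simp add: add.commute)
    next
      case 2
      then show ?thesis using no2[OF that(2)] by (simp add: add.commute)
    next
      case 3
      have "a + b \<le> c + d + 2 * (indicator ?A x * indicator ?B y)" if "a \<le> 1" "b \<le> 1" for a b c d :: ennreal
        using two[OF that] 3 by (simp add: add_increasing)
      then show ?thesis using H(2) by blast
    qed
    then show "?h x y + H r1 r2 \<le> ?h1 x + ?h2 y + 2 * (indicator ?A x * indicator ?B y)"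
      and "?h1 x + ?h2 y \<le> ?h x y + H r1 r2 + 2 * (indicator ?A x * indicator ?B y)" by auto
  qed
  have hm: "(\<lambda>x. ?h x x) \<in> borel_measurable M" "\<And>x. x \<in> space M \<Longrightarrow> (\<lambda>y. ?h x y) \<in> borel_measurable M"
    "(\<lambda>x. \<integral>\<^sup>+y. ?h x y \<partial>M) \<in> borel_measurable M" "?h1 \<in> borel_measurable M" "?h2 \<in> borel_measurable M"
    by measurable
  define p where "p = emeasure M (?A \<inter> ?B)"
  define q where "q = emeasure M ?A * emeasure M ?B"
  let ?m1 = "\<integral>\<^sup>+x. ?h1 x \<partial>M" and ?m2 = "\<integral>\<^sup>+y. ?h2 y \<partial>M"
  have ind: "indicator ?A x * indicator ?B x = (indicator (?A \<inter> ?B) x :: ennreal)" for x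
    by (simp add: indicator_inter_arith)
  have J: "(\<integral>\<^sup>+x. ?h x x + H r1 r2 \<partial>M) = joint_step H r1 r2 + H r1 r2"
    by (subst nn_integral_add) (auto simp: hm joint_step_def emeasure_space_1)
  have M2: "(\<integral>\<^sup>+x. ?h1 x + ?h2 x + 2 * (indicator ?A x * indicator ?B x) \<partial>M) = ?m1 + ?m2 + 2 * p"
    unfolding ind p_def by (simp add: hm nn_integral_add nn_integral_cmult)
  have J2: "(\<integral>\<^sup>+x. ?h x x + H r1 r2 + 2 * (indicator ?A x * indicator ?B x) \<partial>M) = joint_step H r1 r2 + H r1 r2 + 2 * p"
    unfolding ind p_def J[symmetric] by (simp add: hm nn_integral_add nn_integral_cmult)
  have M1: "(\<integral>\<^sup>+x. ?h1 x + ?h2 x \<partial>M) = ?m1 + ?m2"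
    by (simp add: hm nn_integral_add)
  have I: "(\<integral>\<^sup>+x. \<integral>\<^sup>+y. ?h x y + H r1 r2 \<partial>M \<partial>M) = indep_step H r1 r2 + H r1 r2"
    by (simp add: hm nn_integral_add indep_step_def emeasure_space_1)
  have MI: "(\<integral>\<^sup>+x. \<integral>\<^sup>+y. ?h1 x + ?h2 y \<partial>M \<partial>M) = ?m1 + ?m2"
    by (simp add: hm nn_integral_add emeasure_space_1)
  have MI2: "(\<integral>\<^sup>+x. \<integral>\<^sup>+y. ?h1 x + ?h2 y + 2 * (indicator ?A x * indicator ?B y) \<partial>M \<partial>M) = ?m1 + ?m2 + 2 * q"
    unfolding q_def by (simp add: hm nn_integral_add nn_integral_cmult nn_integral_multc emeasure_space_1)
  have I2: "(\<integral>\<^sup>+x. \<integral>\<^sup>+y. ?h x y + H r1 r2 + 2 * (indicator ?A x * indicator ?B y) \<partial>M \<partial>M) = indep_step H r1 r2 + H r1 r2 + 2 * q"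
    unfolding q_def by (simp add: hm nn_integral_add nn_integral_cmult nn_integral_multc indep_step_def emeasure_space_1)
  have a: "joint_step H r1 r2 + H r1 r2 \<le> ?m1 + ?m2 + 2 * p"
    unfolding J[symmetric] M2[symmetric] by (intro nn_integral_mono sq1)
  have b: "?m1 + ?m2 \<le> joint_step H r1 r2 + H r1 r2 + 2 * p"
    unfolding J2[symmetric] M1[symmetric] by (intro nn_integral_mono sq2)
  have c: "indep_step H r1 r2 + H r1 r2 \<le> ?m1 + ?m2 + 2 * q"
    unfolding I[symmetric] MI2[symmetric] by (intro nn_integral_mono sq1)
  have d: "?m1 + ?m2 \<le> indep_step H r1 r2 + H r1 r2 + 2 * q"
    unfolding I2[symmetric] MI[symmetric] by (intro nn_integral_mono sq2)
  have e: "err r1 r2 = 2 * p + 2 * q" by (simp add: err_def p_def q_def distrib_left)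
  have fin: "H r1 r2 < top" using H(2)[of r1 r2] by (simp add: le_less_trans)
  \<comment> \<open>From the joint expectation to the one-variable terms costs \<open>2 * p\<close>,
    from these to the independent expectation \<open>2 * q\<close>; being finite,
    \<open>H r1 r2\<close> can be cancelled.\<close>
  have "H r1 r2 + joint_step H r1 r2 \<le> H r1 r2 + (indep_step H r1 r2 + err r1 r2)"
    using order_trans[OF a add_right_mono[OF d, of "2 * p"]] unfolding e by (simp only: ac_simps)
  then show "joint_step H r1 r2 \<le> indep_step H r1 r2 + err r1 r2"
    using fin by (auto simp: ennreal_add_left_cancel_le)
  have "H r1 r2 + indep_step H r1 r2 \<le> H r1 r2 + (joint_step H r1 r2 + err r1 r2)"
    using order_trans[OF c add_right_mono[OF b, of "2 * q"]] unfolding e by (simp only: ac_simps)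
  then show "indep_step H r1 r2 \<le> joint_step H r1 r2 + err r1 r2"
    using fin by (auto simp: ennreal_add_left_cancel_le)
qed

text \<open>A finite bound \<open>z\<close> on the reciprocal says that \<open>r\<close> is positive
  and at least \<open>1 / z\<close> on \<open>A\<close>; so overshooting \<open>r\<close> implies
  exceeding a constant level, whose probability is known exactly.\<close>

lemma overshoot_subset_exceedance:
  assumes "inv_sup_path A r \<le> ennreal z" "z > 0"
  shows "overshoot A r \<subseteq> exceedance A (1 / z)"
proof
  fix \<omega> assume "\<omega> \<in> overshoot A r"
  then obtain t where t: "\<omega> \<in> space M" "t \<in> A" "r t < pos_path \<omega> t" by (auto simp: overshoot_def)
  have le: "inverse (ennreal (r t)) \<le> ennreal z"
    using assms(1) t(2) unfolding inv_sup_path_def by (meson SUP_upper order_trans)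
  have "r t > 0"
  proof (rule ccontr)
    assume "\<not> r t > 0"
    then show False using le by (simp add: ennreal_neg top_unique)
  qed
  then have "inverse (r t) \<le> z" using le assms(2) by (simp add: inverse_ennreal)
  then have "1 / z \<le> r t" using \<open>r t > 0\<close> assms(2) by (simp add: field_simps)
  then have "1 / z < pos_path \<omega> t" using t(3) by simp
  \<comment> \<open>Above a positive level, \<open>pos_path\<close> and \<open>\<eta>\<close> have
    the same exceedances.\<close>
  moreover have "0 < 1 / z" using assms(2) by simp
  ultimately have "1 / z < \<eta> t \<omega>" by (simp add: pos_path_def max_def split: if_splits)
  then show "\<omega> \<in> exceedance A (1 / z)" using t by (auto simp: exceedance_def)
qed

text \<open>The sum \<open>J\<close> dominates both reciprocals, so \<open>1 / J\<close> is a common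
  lower level for \<open>r1\<close> on \<open>A\<close> and \<open>r2\<close> on \<open>B\<close>.
  The 2 in the quadratic coefficient counts one term from the joint probability and one from the
  product.\<close>

lemma emeasure_overshoot_le:
  assumes A: "finite A" and B: "finite B"
  defines "J \<equiv> \<lambda>r1 r2. inv_sup_path A r1 + inv_sup_path B r2"
  shows "emeasure M (overshoot A r1 \<inter> overshoot B r2) + emeasure M (overshoot A r1) * emeasure M (overshoot B r2)
    \<le> ennreal (dependence A B) * J r1 r2 + ennreal (2 * \<theta> A * \<theta> B) * J r1 r2 ^ 2"
proof (cases "A = {} \<or> B = {}")
  case True
  then show ?thesis by (auto simp: overshoot_def)
next
  case False
  have cA: "compact A" "compact B" using A B by (auto intro: finite_imp_compact)
  have \<theta>: "\<theta> A \<ge> 1" "\<theta> B \<ge> 1" using extremal_coeff_ge_1 cA False by auto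
  \<comment> \<open>A positive coefficient makes the right-hand side infinite as soon as
    \<open>J\<close> is; this is what the bound \<open>\<theta> \<ge> 1\<close> for nonempty sets is
    for.\<close>
  have tt: "2 * \<theta> A * \<theta> B > 0" using \<theta> by simp
  show ?thesis
  proof (cases "J r1 r2")
    case top
    then have "ennreal (2 * \<theta> A * \<theta> B) * J r1 r2 ^ 2 = \<top>"
      using tt by (metis ennreal_eq_0_iff ennreal_mult_top linorder_not_le power2_eq_square)
    then show ?thesis by simp
  next
    case (real z)
    have A1: "inv_sup_path A r1 \<le> ennreal z" and B1: "inv_sup_path B r2 \<le> ennreal z"
      unfolding real(2)[symmetric] J_def by auto
    have z: "z > 0"
    proof (rule ccontr)
      assume "\<not> z > 0"
      then have "inv_sup_path A r1 = 0" using A1 real(1) by simp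
      moreover obtain t where "t \<in> A" using False by blast
      then have "inverse (ennreal (r1 t)) \<le> inv_sup_path A r1" unfolding inv_sup_path_def by (rule SUP_upper)
      ultimately show False by simp
    qed
    have P: "emeasure M (overshoot A r1 \<inter> overshoot B r2) \<le> ennreal (prob (exceedance A (1/z) \<inter> exceedance B (1/z)))"
      using overshoot_subset_exceedance[OF A1 z] overshoot_subset_exceedance[OF B1 z] cA
      by (subst emeasure_eq_measure[symmetric]) (intro emeasure_mono Int_mono sets.Int exceedance_sets)
    have "emeasure M (overshoot A r1) * emeasure M (overshoot B r2)
        \<le> ennreal (prob (exceedance A (1/z))) * ennreal (prob (exceedance B (1/z)))"
      using overshoot_subset_exceedance[OF A1 z] overshoot_subset_exceedance[OF B1 z] cA
      by (subst (1 2) emeasure_eq_measure[symmetric]) (intro mult_mono emeasure_mono exceedance_sets; simp)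
    then have Q: "emeasure M (overshoot A r1) * emeasure M (overshoot B r2)
        \<le> ennreal (prob (exceedance A (1/z)) * prob (exceedance B (1/z)))" by (simp add: ennreal_mult)
    have "emeasure M (overshoot A r1 \<inter> overshoot B r2) + emeasure M (overshoot A r1) * emeasure M (overshoot B r2)
      \<le> ennreal (prob (exceedance A (1/z) \<inter> exceedance B (1/z)) + prob (exceedance A (1/z)) * prob (exceedance B (1/z)))"
      using add_mono[OF P Q] by simp
    also have "\<dots> \<le> ennreal (dependence A B * z + 2 * \<theta> A * \<theta> B * z^2)"
      using prob_joint_exceedance_le[OF cA z] prob_exceedance_mult_le[OF cA z] by (intro ennreal_leI) simp
    also have "\<dots> = ennreal (dependence A B) * J r1 r2 + ennreal (2 * \<theta> A * \<theta> B) * J r1 r2 ^ 2"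
      using z tt dependence_nonneg[OF cA] unfolding real(2)
      by (simp add: ennreal_plus ennreal_mult ennreal_power)
    finally show ?thesis .
  qed
qed

end

text \<open>The crude constant 4 enters only the second-order error, which vanishes in the
  limit.\<close>

lemma ennreal_add_square_le: "(a + b) ^ 2 \<le> 4 * (a ^ 2 + b ^ 2 :: ennreal)"
proof -
  have "a + b \<le> max a b + max a b" by (intro add_mono) auto
  then have "(a + b) ^ 2 \<le> (2 * max a b) ^ 2" by (intro power_mono) (simp_all add: mult_2)
  also have "\<dots> = 4 * max a b ^ 2" by (simp add: power_mult_distrib)
  also have "\<dots> \<le> 4 * (a ^ 2 + b ^ 2)" by (intro mult_left_mono) (auto simp: max_def)
  finally show ?thesis .
qed

text \<open>There are \<open>m + 1\<close> exchanges, but in each the exchanged copy competes with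
  only \<open>m\<close> others, which is why the cost of one is \<open>K / m + L / m^2\<close>. The
  total still tends to \<open>K\<close>.\<close>

lemma ennreal_le_of_scaled_errors:
  fixes x y K L :: ennreal
  assumes K: "K < \<top>" and L: "L < \<top>"
    and le: "\<And>m. m \<ge> 1 \<Longrightarrow> x \<le> y + of_nat (Suc m) * (ennreal (1 / real m) * K + ennreal (1 / real m) ^ 2 * L)"
  shows "x \<le> y + K"
proof (rule ennreal_le_epsilon)
  fix e :: real assume e: "e > 0"
  obtain k where k: "k \<ge> 0" "K = ennreal k" using K by (cases K) auto
  obtain l where l: "l \<ge> 0" "L = ennreal l" using L by (cases L) auto
  \<comment> \<open>The total is \<open>k + (k + (1 + 1 / m) * l) / m\<close>, hence at most
    \<open>k + (k + 2 * l) / m\<close>.\<close>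
  obtain m :: nat where m: "real m > (k + 2 * l) / e" using reals_Archimedean2 by blast
  moreover have "(k + 2 * l) / e \<ge> 0" using k l e by simp
  ultimately have "real m > 0" by linarith
  then have m1: "m \<ge> 1" by simp
  have kl: "k + 2 * l \<le> e * real m" using m e by (simp add: field_simps)
  have "real (Suc m) * (1 / real m * k + (1 / real m)^2 * l) \<le> k + e"
  proof -
    have "real (Suc m) * (1 / real m * k + (1 / real m)^2 * l) = k + (k + (1 + 1 / real m) * l) / real m"
      using m1 by (simp add: field_simps power2_eq_square)
    also have "\<dots> \<le> k + (k + 2 * l) / real m"
      using m1 l by (intro add_left_mono divide_right_mono mult_right_mono) auto
    also have "\<dots> \<le> k + e" using kl m1 by (simp add: field_simps)
    finally show ?thesis .
  qed
  then have "ennreal (real (Suc m) * (1 / real m * k + (1 / real m)^2 * l)) \<le> ennreal (k + e)" by (rule ennreal_leI)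
  moreover have "ennreal (real (Suc m) * (1 / real m * k + (1 / real m)^2 * l))
      = of_nat (Suc m) * (ennreal (1 / real m) * K + ennreal (1 / real m) ^ 2 * L)"
  proof -
    have "ennreal (a * (b * k + b^2 * l)) = ennreal a * (ennreal b * ennreal k + ennreal b ^ 2 * ennreal l)"
      if "a \<ge> 0" "b \<ge> 0" for a b
      using that k(1) l(1) by (simp add: ennreal_mult ennreal_plus ennreal_power)
    from this[of "real (Suc m)" "1 / real m"] show ?thesis
      unfolding k(2) l(2) ennreal_of_nat_eq_real_of_nat by simp
  qed
  ultimately have "x \<le> y + ennreal (k + e)" using order_trans[OF le[OF m1] add_left_mono] by simp
  then show "x \<le> y + K + ennreal e" using k e by (simp add: add.assoc ennreal_plus)
qed

context max_stable_field
begin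

section \<open>Expected cost of an exchange, and its summation\<close>

lemma inv_sup_path_pos_path: "inv_sup_path A (pos_path \<omega>) = inv_sup A \<omega>"
  by (simp add: inv_sup_path_def inv_sup_def pos_path_def ennreal_def max.assoc[symmetric])

lemma bimeasurable_compose_first: "G \<in> borel_measurable paths \<Longrightarrow> bimeasurable (\<lambda>r1 r2. G r1)"
  unfolding bimeasurable_def by (rule measurable_compose[OF measurable_fst])

lemma bimeasurable_compose_second: "G \<in> borel_measurable paths \<Longrightarrow> bimeasurable (\<lambda>r1 r2. G r2)"
  unfolding bimeasurable_def by (rule measurable_compose[OF measurable_snd])

lemma bimeasurable_add: "bimeasurable \<Phi> \<Longrightarrow> bimeasurable \<Psi> \<Longrightarrow> bimeasurable (\<lambda>r1 r2. \<Phi> r1 r2 + \<Psi> r1 r2)"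
  unfolding bimeasurable_def by (rule borel_measurable_add)

lemma bimeasurable_cmult: "bimeasurable \<Phi> \<Longrightarrow> bimeasurable (\<lambda>r1 r2. c * \<Phi> r1 r2)"
  unfolding bimeasurable_def by measurable

lemma bimeasurable_power: "bimeasurable \<Phi> \<Longrightarrow> bimeasurable (\<lambda>r1 r2. \<Phi> r1 r2 ^ 2)"
  unfolding bimeasurable_def by measurable

text \<open>Each entry is distributed as \<open>m\<close> times a path, and
  \<open>inv_sup_path\<close> is homogeneous of degree -1: this gives the factors
  \<open>1 / m\<close> and \<open>(1 / m)^2\<close>, independent of the stage.\<close>

lemma interp_inv_sup_path:
  assumes AB: "finite A" "finite B" and m: "k + l = m" "m \<ge> 1"
  defines "J \<equiv> \<lambda>r1 r2. inv_sup_path A r1 + inv_sup_path B r2"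
  shows "bimeasurable J"
    and "interp k l J = ennreal (1 / real m) * (inv_sup_expectation M \<eta> A + inv_sup_expectation M \<eta> B)"
    and "interp k l (\<lambda>r1 r2. J r1 r2 ^ 2) \<le> ennreal (1 / real m) ^ 2 *
      (4 * ((\<integral>\<^sup>+\<omega>. inv_sup A \<omega> ^ 2 \<partial>M) + (\<integral>\<^sup>+\<omega>. inv_sup B \<omega> ^ 2 \<partial>M)))"
proof -
  have im: "inv_sup_path S \<in> borel_measurable paths" if "finite S" for S
    using measurable_inv_sup_path[OF countable_finite[OF that], of "\<lambda>f. f" paths] by simp
  have im2: "(\<lambda>f. inv_sup_path S f ^ 2) \<in> borel_measurable paths" if "finite S" for S
    using im[OF that] by measurable
  have ism: "inv_sup S \<in> borel_measurable M" if "finite S" for S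
    using inv_sup_measurable[OF finite_imp_compact[OF that]] .
  have sc: "inv_sup_path S (scaled m \<omega>) = ennreal (1 / real m) * inv_sup S \<omega>" for S \<omega>
    using m(2) by (subst inv_sup_path_pscale) (auto simp: inv_sup_path_pos_path)
  have bm: "bimeasurable (\<lambda>r1 r2. inv_sup_path A r1)" "bimeasurable (\<lambda>r1 r2. inv_sup_path B r2)"
    using im[OF AB(1)] im[OF AB(2)] bimeasurable_compose_first bimeasurable_compose_second by blast+
  show bJ: "bimeasurable J" unfolding J_def by (rule bimeasurable_add[OF bm])
  have "interp k l J = (\<integral>\<^sup>+\<omega>. inv_sup_path A (scaled m \<omega>) \<partial>M) + (\<integral>\<^sup>+\<omega>. inv_sup_path B (scaled m \<omega>) \<partial>M)"
    unfolding J_def interp_add[OF bm] interp_first[OF im[OF AB(1)]] interp_second[OF im[OF AB(2)]] m(1) ..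
  also have "\<dots> = ennreal (1 / real m) * (inv_sup_expectation M \<eta> A + inv_sup_expectation M \<eta> B)"
    unfolding sc inv_sup_expectation_eq by (simp add: nn_integral_cmult ism AB distrib_left)
  finally show "interp k l J = ennreal (1 / real m) * (inv_sup_expectation M \<eta> A + inv_sup_expectation M \<eta> B)" .
  have bm2: "bimeasurable (\<lambda>r1 r2. inv_sup_path A r1 ^ 2)" "bimeasurable (\<lambda>r1 r2. inv_sup_path B r2 ^ 2)"
    using bm by (auto intro: bimeasurable_power)
  have "interp k l (\<lambda>r1 r2. J r1 r2 ^ 2) \<le> interp k l (\<lambda>r1 r2. 4 * (inv_sup_path A r1 ^ 2 + inv_sup_path B r2 ^ 2))"
    unfolding J_def by (intro interp_mono ennreal_add_square_le)
  also have "\<dots> = 4 * ((\<integral>\<^sup>+\<omega>. inv_sup_path A (scaled m \<omega>) ^ 2 \<partial>M) + (\<integral>\<^sup>+\<omega>. inv_sup_path B (scaled m \<omega>) ^ 2 \<partial>M))"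
    unfolding interp_cmult[OF bimeasurable_add[OF bm2]] interp_add[OF bm2]
      interp_first[OF im2[OF AB(1)]] interp_second[OF im2[OF AB(2)]] m(1) ..
  also have "\<dots> = ennreal (1 / real m) ^ 2 *
      (4 * ((\<integral>\<^sup>+\<omega>. inv_sup A \<omega> ^ 2 \<partial>M) + (\<integral>\<^sup>+\<omega>. inv_sup B \<omega> ^ 2 \<partial>M)))"
  proof -
    have "(\<integral>\<^sup>+\<omega>. ennreal (1 / real m) ^ 2 * inv_sup S \<omega> ^ 2 \<partial>M) = ennreal (1 / real m) ^ 2 * (\<integral>\<^sup>+\<omega>. inv_sup S \<omega> ^ 2 \<partial>M)"
      if "finite S" for S
      by (rule nn_integral_cmult[OF measurable_compose[OF ism[OF that]]]) measurable
    from this[OF AB(1)] this[OF AB(2)] show ?thesis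
      unfolding sc power_mult_distrib by (simp only: distrib_left mult_ac)
  qed
  finally show "interp k l (\<lambda>r1 r2. J r1 r2 ^ 2) \<le> ennreal (1 / real m) ^ 2 *
      (4 * ((\<integral>\<^sup>+\<omega>. inv_sup A \<omega> ^ 2 \<partial>M) + (\<integral>\<^sup>+\<omega>. inv_sup B \<omega> ^ 2 \<partial>M)))" .
qed

text \<open>The union bound is taken before any level is chosen, so every pair of pieces keeps its
  own reciprocals and its own dependence; hence the double sum in the final bound.\<close>

lemma emeasure_overshoot_UN_le:
  assumes I: "finite I" "\<And>i. i \<in> I \<Longrightarrow> finite (A i)" and J: "finite J" "\<And>j. j \<in> J \<Longrightarrow> finite (B j)"
  shows "emeasure M (overshoot (\<Union>i\<in>I. A i) r1 \<inter> overshoot (\<Union>j\<in>J. B j) r2)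
      + emeasure M (overshoot (\<Union>i\<in>I. A i) r1) * emeasure M (overshoot (\<Union>j\<in>J. B j) r2)
    \<le> (\<Sum>i\<in>I. \<Sum>j\<in>J. emeasure M (overshoot (A i) r1 \<inter> overshoot (B j) r2)
      + emeasure M (overshoot (A i) r1) * emeasure M (overshoot (B j) r2))"
proof -
  have sA: "overshoot (A i) r1 \<in> events" if "i \<in> I" for i using I(2)[OF that] by (rule overshoot_sets)
  have sB: "overshoot (B j) r2 \<in> events" if "j \<in> J" for j using J(2)[OF that] by (rule overshoot_sets)
  have UA: "overshoot (\<Union>i\<in>I. A i) r1 = (\<Union>i\<in>I. overshoot (A i) r1)"
    and UB: "overshoot (\<Union>j\<in>J. B j) r2 = (\<Union>j\<in>J. overshoot (B j) r2)" by (auto simp: overshoot_def)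
  have "emeasure M (overshoot (\<Union>i\<in>I. A i) r1 \<inter> overshoot (\<Union>j\<in>J. B j) r2)
      = emeasure M (\<Union>i\<in>I. \<Union>j\<in>J. overshoot (A i) r1 \<inter> overshoot (B j) r2)"
    unfolding UA UB by (rule arg_cong[of _ _ "emeasure M"]) blast
  also have "\<dots> \<le> (\<Sum>i\<in>I. emeasure M (\<Union>j\<in>J. overshoot (A i) r1 \<inter> overshoot (B j) r2))"
    using I(1) J(1) sA sB by (intro emeasure_subadditive_finite) auto
  also have "\<dots> \<le> (\<Sum>i\<in>I. \<Sum>j\<in>J. emeasure M (overshoot (A i) r1 \<inter> overshoot (B j) r2))"
    using J(1) sA sB by (intro sum_mono emeasure_subadditive_finite) auto
  finally have 1: "emeasure M (overshoot (\<Union>i\<in>I. A i) r1 \<inter> overshoot (\<Union>j\<in>J. B j) r2)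
      \<le> (\<Sum>i\<in>I. \<Sum>j\<in>J. emeasure M (overshoot (A i) r1 \<inter> overshoot (B j) r2))" .
  have "emeasure M (overshoot (\<Union>i\<in>I. A i) r1) \<le> (\<Sum>i\<in>I. emeasure M (overshoot (A i) r1))"
    unfolding UA using I(1) sA by (intro emeasure_subadditive_finite) auto
  moreover have "emeasure M (overshoot (\<Union>j\<in>J. B j) r2) \<le> (\<Sum>j\<in>J. emeasure M (overshoot (B j) r2))"
    unfolding UB using J(1) sB by (intro emeasure_subadditive_finite) auto
  ultimately have "emeasure M (overshoot (\<Union>i\<in>I. A i) r1) * emeasure M (overshoot (\<Union>j\<in>J. B j) r2)
      \<le> (\<Sum>i\<in>I. emeasure M (overshoot (A i) r1)) * (\<Sum>j\<in>J. emeasure M (overshoot (B j) r2))"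
    by (intro mult_mono) auto
  also have "\<dots> = (\<Sum>i\<in>I. \<Sum>j\<in>J. emeasure M (overshoot (A i) r1) * emeasure M (overshoot (B j) r2))"
    by (rule sum_product)
  finally show ?thesis using add_mono[OF 1] by (simp add: sum.distrib)
qed

definition pair_bound :: "'t set \<Rightarrow> 't set \<Rightarrow> ennreal" where
  "pair_bound A B = (inv_sup_expectation M \<eta> A + inv_sup_expectation M \<eta> B) * ennreal (dependence A B)"

lemma pair_bound_finite: "compact A \<Longrightarrow> compact B \<Longrightarrow> pair_bound A B < \<top>"
  using inv_sup_expectation_finite by (simp add: pair_bound_def ennreal_mult_less_top)

text \<open>Finite pieces suffice here, because \<open>H\<close> looks at finitely many coordinates
  only. The first-order cost is \<open>K\<close>; a second-order cost \<open>L\<close> appears only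
  inside the proof and has to be finite for the limit.\<close>

lemma lindeberg_bound:
  assumes H: "bimeasurable H" "\<And>f g. H f g \<le> 1" "depends_on H (\<Union>i\<in>I. A i) (\<Union>j\<in>J. B j)"
    and I: "finite I" "\<And>i. i \<in> I \<Longrightarrow> finite (A i)" and J: "finite J" "\<And>j. j \<in> J \<Longrightarrow> finite (B j)"
  defines "K \<equiv> 2 * (\<Sum>i\<in>I. \<Sum>j\<in>J. pair_bound (A i) (B j))"
  shows "(\<integral>\<^sup>+\<omega>. H (pos_path \<omega>) (pos_path \<omega>) \<partial>M) \<le> (\<integral>\<^sup>+\<omega>. \<integral>\<^sup>+\<omega>'. H (pos_path \<omega>) (pos_path \<omega>') \<partial>M \<partial>M) + K"
    and "(\<integral>\<^sup>+\<omega>. \<integral>\<^sup>+\<omega>'. H (pos_path \<omega>) (pos_path \<omega>') \<partial>M \<partial>M) \<le> (\<integral>\<^sup>+\<omega>. H (pos_path \<omega>) (pos_path \<omega>) \<partial>M) + K"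
proof -
  define D where "D i j = 4 * ((\<integral>\<^sup>+\<omega>. inv_sup (A i) \<omega> ^ 2 \<partial>M) + (\<integral>\<^sup>+\<omega>. inv_sup (B j) \<omega> ^ 2 \<partial>M))" for i j
  define L where "L = 2 * (\<Sum>i\<in>I. \<Sum>j\<in>J. ennreal (2 * \<theta> (A i) * \<theta> (B j)) * D i j)"
  have cA: "compact (A i)" if "i \<in> I" for i using I(2)[OF that] by (rule finite_imp_compact)
  have cB: "compact (B j)" if "j \<in> J" for j using J(2)[OF that] by (rule finite_imp_compact)
  have D: "D i j < \<top>" if "i \<in> I" "j \<in> J" for i j
    using inv_sup_square_finite[OF cA[OF that(1)]] inv_sup_square_finite[OF cB[OF that(2)]]
    by (simp add: D_def ennreal_mult_less_top)
  have Kfin: "K < \<top>"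
    using cA cB I(1) J(1) unfolding K_def by (auto simp: ennreal_mult_less_top pair_bound_finite)
  have Lfin: "L < \<top>"
    using D I(1) J(1) unfolding L_def by (auto simp: ennreal_mult_less_top)
  define Jf where "Jf i j r1 r2 = inv_sup_path (A i) r1 + inv_sup_path (B j) r2" for i j r1 r2
  \<comment> \<open>Bound on the cost of one exchange, given the maxima \<open>r1\<close> and
    \<open>r2\<close> of the other copies.\<close>
  define \<Psi> where "\<Psi> r1 r2 = 2 * (\<Sum>i\<in>I. \<Sum>j\<in>J. ennreal (dependence (A i) (B j)) * Jf i j r1 r2
      + ennreal (2 * \<theta> (A i) * \<theta> (B j)) * Jf i j r1 r2 ^ 2)" for r1 r2
  have bJ: "bimeasurable (Jf i j)" if "i \<in> I" "j \<in> J" for i j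
    using interp_inv_sup_path(1)[OF I(2)[OF that(1)] J(2)[OF that(2)], of 0 1 1] unfolding Jf_def by simp
  have bt: "bimeasurable (\<lambda>r1 r2. c * Jf i j r1 r2 + d * Jf i j r1 r2 ^ 2)" if "i \<in> I" "j \<in> J" for i j c d
    using bJ[OF that] by (intro bimeasurable_add bimeasurable_cmult bimeasurable_power)
  have bi: "bimeasurable (\<lambda>r1 r2. \<Sum>j\<in>J. c i j * Jf i j r1 r2 + d i j * Jf i j r1 r2 ^ 2)" if "i \<in> I" for i c d
    by (rule conjunct2[OF interp_sum[OF J(1) bt[OF that]]])
  have b\<Psi>: "bimeasurable \<Psi>"
    unfolding \<Psi>_def by (intro bimeasurable_cmult conjunct2[OF interp_sum[OF I(1) bi]])
  have int\<Psi>: "interp k l \<Psi> \<le> ennreal (1 / real m) * K + ennreal (1 / real m) ^ 2 * L"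
    if m: "k + l = m" "m \<ge> 1" for k l m
  proof -
    have summand: "interp k l (\<lambda>r1 r2. ennreal (dependence (A i) (B j)) * Jf i j r1 r2
      + ennreal (2 * \<theta> (A i) * \<theta> (B j)) * Jf i j r1 r2 ^ 2)
      \<le> ennreal (1 / real m) * pair_bound (A i) (B j) + ennreal (1 / real m) ^ 2 * (ennreal (2 * \<theta> (A i) * \<theta> (B j)) * D i j)"
      if ij: "i \<in> I" "j \<in> J" for i j
    proof -
      have "interp k l (\<lambda>r1 r2. ennreal (dependence (A i) (B j)) * Jf i j r1 r2 + ennreal (2 * \<theta> (A i) * \<theta> (B j)) * Jf i j r1 r2 ^ 2)
          = ennreal (dependence (A i) (B j)) * interp k l (Jf i j) + ennreal (2 * \<theta> (A i) * \<theta> (B j)) * interp k l (\<lambda>r1 r2. Jf i j r1 r2 ^ 2)"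
        using bJ[OF ij] by (simp add: interp_add interp_cmult bimeasurable_cmult bimeasurable_power)
      also have "\<dots> \<le> ennreal (dependence (A i) (B j)) * (ennreal (1 / real m) * (inv_sup_expectation M \<eta> (A i) + inv_sup_expectation M \<eta> (B j)))
          + ennreal (2 * \<theta> (A i) * \<theta> (B j)) * (ennreal (1 / real m) ^ 2 * D i j)"
        using interp_inv_sup_path(2,3)[OF I(2)[OF ij(1)] J(2)[OF ij(2)] m] unfolding Jf_def D_def
        by (intro add_mono mult_left_mono) auto
      also have "\<dots> = ennreal (1 / real m) * pair_bound (A i) (B j) + ennreal (1 / real m) ^ 2 * (ennreal (2 * \<theta> (A i) * \<theta> (B j)) * D i j)"
        by (simp add: pair_bound_def mult_ac)
      finally show ?thesis .
    qed
    have "interp k l \<Psi> = 2 * (\<Sum>i\<in>I. \<Sum>j\<in>J. interp k l (\<lambda>r1 r2. ennreal (dependence (A i) (B j)) * Jf i j r1 r2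
      + ennreal (2 * \<theta> (A i) * \<theta> (B j)) * Jf i j r1 r2 ^ 2))"
    proof -
      have "interp k l \<Psi> = 2 * interp k l (\<lambda>r1 r2. \<Sum>i\<in>I. \<Sum>j\<in>J. ennreal (dependence (A i) (B j)) * Jf i j r1 r2
          + ennreal (2 * \<theta> (A i) * \<theta> (B j)) * Jf i j r1 r2 ^ 2)"
        unfolding \<Psi>_def by (rule interp_cmult[OF conjunct2[OF interp_sum[OF I(1) bi]]])
      also have "interp k l (\<lambda>r1 r2. \<Sum>i\<in>I. \<Sum>j\<in>J. ennreal (dependence (A i) (B j)) * Jf i j r1 r2
          + ennreal (2 * \<theta> (A i) * \<theta> (B j)) * Jf i j r1 r2 ^ 2)
          = (\<Sum>i\<in>I. interp k l (\<lambda>r1 r2. \<Sum>j\<in>J. ennreal (dependence (A i) (B j)) * Jf i j r1 r2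
          + ennreal (2 * \<theta> (A i) * \<theta> (B j)) * Jf i j r1 r2 ^ 2))"
        by (rule conjunct1[OF interp_sum[OF I(1) bi]])
      also have "\<dots> = (\<Sum>i\<in>I. \<Sum>j\<in>J. interp k l (\<lambda>r1 r2. ennreal (dependence (A i) (B j)) * Jf i j r1 r2
          + ennreal (2 * \<theta> (A i) * \<theta> (B j)) * Jf i j r1 r2 ^ 2))"
        by (rule sum.cong[OF refl]) (rule conjunct1[OF interp_sum[OF J(1) bt]])
      finally show ?thesis .
    qed
    also have "\<dots> \<le> 2 * (\<Sum>i\<in>I. \<Sum>j\<in>J. ennreal (1 / real m) * pair_bound (A i) (B j) + ennreal (1 / real m) ^ 2 * (ennreal (2 * \<theta> (A i) * \<theta> (B j)) * D i j))"
      by (intro mult_left_mono sum_mono summand) auto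
    also have "\<dots> = ennreal (1 / real m) * K + ennreal (1 / real m) ^ 2 * L"
      unfolding K_def L_def by (simp add: sum.distrib distrib_left sum_distrib_left mult.left_commute)
    finally show ?thesis .
  qed
  \<comment> \<open>The functional is general because the one it is applied to is rescaled by a
    factor depending on \<open>m\<close>.\<close>
  have main: "interp (Suc m) 0 H' \<le> interp 0 (Suc m) H' + of_nat (Suc m) * E \<and>
      interp 0 (Suc m) H' \<le> interp (Suc m) 0 H' + of_nat (Suc m) * E"
    if H': "bimeasurable H'" "\<And>f g. H' f g \<le> 1" "depends_on H' (\<Union>i\<in>I. A i) (\<Union>j\<in>J. B j)"
      and m: "m \<ge> 1" and E: "E = ennreal (1 / real m) * K + ennreal (1 / real m) ^ 2 * L" for H' m E
  proof -
    have fU: "finite (\<Union>i\<in>I. A i)" "finite (\<Union>j\<in>J. B j)" using I J by auto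
    have err: "2 * (emeasure M (overshoot (\<Union>i\<in>I. A i) r1 \<inter> overshoot (\<Union>j\<in>J. B j) r2)
      + emeasure M (overshoot (\<Union>i\<in>I. A i) r1) * emeasure M (overshoot (\<Union>j\<in>J. B j) r2)) \<le> \<Psi> r1 r2" for r1 r2
      unfolding \<Psi>_def Jf_def
      by (intro mult_left_mono order_trans[OF emeasure_overshoot_UN_le[OF I J]] sum_mono
          emeasure_overshoot_le I(2) J(2)) auto
    have js: "joint_step H' r1 r2 \<le> indep_step H' r1 r2 + \<Psi> r1 r2"
      and ijs: "indep_step H' r1 r2 \<le> joint_step H' r1 r2 + \<Psi> r1 r2" for r1 r2
      using order_trans[OF joint_indep_step(1)[OF H' fU] add_left_mono[OF err]]
        order_trans[OF joint_indep_step(2)[OF H' fU] add_left_mono[OF err]] by auto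
    note bj = bimeasurable_joint_step[OF H'(1)] and bi' = bimeasurable_indep_step[OF H'(1)]
    have step: "interp (Suc k) l H' \<le> interp k (Suc l) H' + E \<and> interp k (Suc l) H' \<le> interp (Suc k) l H' + E"
      if kl: "k + l = m" for k l
    proof
      have "interp k l (joint_step H') \<le> interp k l (indep_step H') + interp k l \<Psi>"
        using interp_mono[of "joint_step H'" "\<lambda>r1 r2. indep_step H' r1 r2 + \<Psi> r1 r2" k l, OF js]
        by (simp add: interp_add[OF bi' b\<Psi>])
      then show "interp (Suc k) l H' \<le> interp k (Suc l) H' + E"
        unfolding interp_Suc_left[OF H'(1)] interp_Suc_right[OF H'(1)] E
        using int\<Psi>[OF kl m] by (meson add_left_mono order_trans)
      have "interp k l (indep_step H') \<le> interp k l (joint_step H') + interp k l \<Psi>"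
        using interp_mono[of "indep_step H'" "\<lambda>r1 r2. joint_step H' r1 r2 + \<Psi> r1 r2" k l, OF ijs]
        by (simp add: interp_add[OF bj b\<Psi>])
      then show "interp k (Suc l) H' \<le> interp (Suc k) l H' + E"
        unfolding interp_Suc_left[OF H'(1)] interp_Suc_right[OF H'(1)] E
        using int\<Psi>[OF kl m] by (meson add_left_mono order_trans)
    qed
    \<comment> \<open>Telescoping: from \<open>k\<close> common copies it takes \<open>k\<close>
      exchanges to reach full independence.\<close>
    have "interp k (Suc m - k) H' \<le> interp 0 (Suc m) H' + of_nat k * E \<and>
        interp 0 (Suc m) H' \<le> interp k (Suc m - k) H' + of_nat k * E" if "k \<le> Suc m" for k
      using that
    proof (induction k)
      case (Suc k)
      then have kl: "k + (m - k) = m" and eq: "Suc m - k = Suc (m - k)" "Suc m - Suc k = m - k" by auto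
      have SucE: "of_nat (Suc k) * E = of_nat k * E + E" by (simp add: distrib_right add.commute)
      have 1: "interp (Suc k) (m - k) H' \<le> interp k (Suc (m - k)) H' + E"
        and 2: "interp k (Suc (m - k)) H' \<le> interp (Suc k) (m - k) H' + E" using step[OF kl] by auto
      have 3: "interp k (Suc (m - k)) H' \<le> interp 0 (Suc m) H' + of_nat k * E"
        and 4: "interp 0 (Suc m) H' \<le> interp k (Suc (m - k)) H' + of_nat k * E" using Suc eq by auto
      have "interp (Suc k) (m - k) H' \<le> interp 0 (Suc m) H' + of_nat (Suc k) * E"
        using order_trans[OF 1 add_right_mono[OF 3]] unfolding SucE by (simp only: ac_simps)
      moreover have "interp 0 (Suc m) H' \<le> interp (Suc k) (m - k) H' + of_nat (Suc k) * E"
        using order_trans[OF 4 add_right_mono[OF 2]] unfolding SucE by (simp only: ac_simps)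
      ultimately show ?case unfolding eq by blast
    qed simp
    from this[of "Suc m"] show ?thesis by simp
  qed
  have scaled_main: "(\<integral>\<^sup>+\<omega>. H (pos_path \<omega>) (pos_path \<omega>) \<partial>M) \<le> (\<integral>\<^sup>+\<omega>. \<integral>\<^sup>+\<omega>'. H (pos_path \<omega>) (pos_path \<omega>') \<partial>M \<partial>M) + of_nat (Suc m) * E \<and>
    (\<integral>\<^sup>+\<omega>. \<integral>\<^sup>+\<omega>'. H (pos_path \<omega>) (pos_path \<omega>') \<partial>M \<partial>M) \<le> (\<integral>\<^sup>+\<omega>. H (pos_path \<omega>) (pos_path \<omega>) \<partial>M) + of_nat (Suc m) * E"
    if m: "m \<ge> 1" and E: "E = ennreal (1 / real m) * K + ennreal (1 / real m) ^ 2 * L" for m E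
  proof -
    \<comment> \<open>\<open>interp\<close> has integer weights with total \<open>Suc m\<close>; the
      division that restores the law of a single path is absorbed into the functional.\<close>
    define H' where "H' f g = H (pscale (1 / real (Suc m)) f) (pscale (1 / real (Suc m)) g)" for f g
    have "bimeasurable H'"
      unfolding bimeasurable_def[of H'] H'_def by (rule bimeasurableD[OF H(1)]) measurable
    moreover have "H' f g \<le> 1" for f g by (simp add: H'_def H(2))
    moreover have "depends_on H' (\<Union>i\<in>I. A i) (\<Union>j\<in>J. B j)"
      unfolding depends_on_def H'_def by (intro allI impI depends_onD[OF H(3)]) (simp_all add: pscale_def)
    moreover have "pscale (1 / real (Suc m)) (scaled (Suc m) \<omega>) = pos_path \<omega>" for \<omega>
      by (simp add: pscale_def)
    then have "interp (Suc m) 0 H' = (\<integral>\<^sup>+\<omega>. H (pos_path \<omega>) (pos_path \<omega>) \<partial>M)"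
      and "interp 0 (Suc m) H' = (\<integral>\<^sup>+\<omega>. \<integral>\<^sup>+\<omega>'. H (pos_path \<omega>) (pos_path \<omega>') \<partial>M \<partial>M)"
      by (simp_all add: interp_left interp_right H'_def)
    ultimately show ?thesis using main[OF _ _ _ m E, of H'] by simp
  qed
  show "(\<integral>\<^sup>+\<omega>. H (pos_path \<omega>) (pos_path \<omega>) \<partial>M) \<le> (\<integral>\<^sup>+\<omega>. \<integral>\<^sup>+\<omega>'. H (pos_path \<omega>) (pos_path \<omega>') \<partial>M \<partial>M) + K"
    by (rule ennreal_le_of_scaled_errors[OF Kfin Lfin conjunct1[OF scaled_main[OF _ refl]]])
  show "(\<integral>\<^sup>+\<omega>. \<integral>\<^sup>+\<omega>'. H (pos_path \<omega>) (pos_path \<omega>') \<partial>M \<partial>M) \<le> (\<integral>\<^sup>+\<omega>. H (pos_path \<omega>) (pos_path \<omega>) \<partial>M) + K"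
    by (rule ennreal_le_of_scaled_errors[OF Kfin Lfin conjunct2[OF scaled_main[OF _ refl]]])
qed

end

section \<open>Reduction to finitely many coordinates\<close>

lemma finite_sum_le_infsum_ennreal:
  fixes f :: "'a \<Rightarrow> ennreal"
  assumes "finite F" "F \<subseteq> A"
  shows "sum f F \<le> infsum f A"
proof -
  have "infsum f A = (SUP F\<in>{F. finite F \<and> F \<subseteq> A}. sum f F)"
    by (rule nonneg_infsum_complete) simp
  then show ?thesis using assms by (auto intro: SUP_upper)
qed

section \<open>Measurability into the space of continuous functions\<close>

definition sigma_compact :: "'t::topological_space set \<Rightarrow> bool" where
  "sigma_compact S \<longleftrightarrow> (\<exists>\<A>. countable \<A> \<and> (\<forall>K\<in>\<A>. compact K) \<and> S = \<Union>\<A>)"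

lemma sigma_compact_UN:
  assumes "countable I" "\<And>i. i \<in> I \<Longrightarrow> compact (A i)"
  shows "sigma_compact (\<Union>i\<in>I. A i)"
  unfolding sigma_compact_def using assms by (intro exI[of _ "A ` I"]) auto

lemma sigma_compact_Un: "sigma_compact S \<Longrightarrow> sigma_compact T \<Longrightarrow> sigma_compact (S \<union> T)"
  unfolding sigma_compact_def
  by (elim exE conjE, rule_tac x = "\<A> \<union> \<A>'" for \<A> \<A>' in exI, intro conjI, rule countable_Un) auto

lemma borel_cts_trace_sigma_compact:
  fixes S :: "'t::metric_space set"
  assumes lc: "locally_compact_space (euclidean :: 't topology)"
    and S: "closed S" "sigma_compact S" and C: "C \<in> sets (borel_cts S)"
  obtains E where "E \<in> sets (PiM S (\<lambda>_. borel))" "C = E \<inter> cts_on S"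
proof -
  obtain \<A> where \<A>: "countable \<A>" "\<And>K. K \<in> \<A> \<Longrightarrow> compact K" "S = (\<Union>K\<in>\<A>. K)"
    using S(2) unfolding sigma_compact_def by auto
  have "\<exists>E\<in>sets (PiM (\<Union>K\<in>\<A>. K) (\<lambda>_. borel)). C = E \<inter> cts_on (\<Union>K\<in>\<A>. K)"
    by (rule borel_cts_trace_PiM[OF lc \<A>(1,2)]) (use S(1) C \<A>(3) in simp_all)
  then show thesis using that unfolding \<A>(3)[symmetric] by blast
qed

text \<open>For a map into \<open>cts_on S\<close> a Borel set and the product set of which it is
  the trace have the same preimage.\<close>

lemma measurable_borel_ctsI:
  fixes S :: "'t::metric_space set"
  assumes lc: "locally_compact_space (euclidean :: 't topology)"
    and S: "closed S" "sigma_compact S"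
    and f: "f \<in> measurable N (PiM S (\<lambda>_. borel))" "\<And>x. x \<in> space N \<Longrightarrow> f x \<in> cts_on S"
  shows "f \<in> measurable N (borel_cts S)"
proof (rule measurableI)
  fix C assume "C \<in> sets (borel_cts S)"
  then obtain E where E: "E \<in> sets (PiM S (\<lambda>_. borel))" "C = E \<inter> cts_on S"
    by (rule borel_cts_trace_sigma_compact[OF lc S])
  have "f -` C \<inter> space N = f -` E \<inter> space N" using f(2) E(2) by auto
  then show "f -` C \<inter> space N \<in> sets N" using measurable_sets[OF f(1) E(1)] by simp
qed (use f(2) in simp)

lemma merge_cts_on:
  assumes S: "closed S1" "closed S2" "S1 \<inter> S2 = {}" and f: "f \<in> cts_on S1" "g \<in> cts_on S2"
  shows "merge S1 S2 (f, g) \<in> cts_on (S1 \<union> S2)"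
proof -
  have "continuous_on S1 (merge S1 S2 (f, g)) \<longleftrightarrow> continuous_on S1 f"
    by (rule continuous_on_cong) (auto simp: merge_def)
  moreover have "continuous_on S2 (merge S1 S2 (f, g)) \<longleftrightarrow> continuous_on S2 g"
    using S(3) by (intro continuous_on_cong) (auto simp: merge_def)
  ultimately have "continuous_on (S1 \<union> S2) (merge S1 S2 (f, g))"
    using f S by (intro continuous_on_closed_Un) (auto simp: cts_on_def)
  then show ?thesis by (simp add: cts_on_def)
qed

text \<open>Ensures that the image of the product measure in \<open>mixing_coeff\<close> is what it
  should be. Gluing is measurable already between the product sigma-fields, and it preserves
  continuity on disjoint closed sets.\<close>

lemma measurable_merge_borel_cts:
  fixes S1 S2 :: "'t::metric_space set"
  assumes lc: "locally_compact_space (euclidean :: 't topology)"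
    and S: "closed S1" "sigma_compact S1" "closed S2" "sigma_compact S2" "S1 \<inter> S2 = {}"
  shows "merge S1 S2 \<in> measurable (borel_cts S1 \<Otimes>\<^sub>M borel_cts S2) (borel_cts (S1 \<union> S2))"
proof (rule measurable_borel_ctsI[OF lc closed_Un[OF S(1,3)] sigma_compact_Un[OF S(2,4)]])
  have "(\<lambda>x. (fst x, snd x)) \<in> measurable (borel_cts S1 \<Otimes>\<^sub>M borel_cts S2) (PiM S1 (\<lambda>_. borel) \<Otimes>\<^sub>M PiM S2 (\<lambda>_. borel))"
    by (intro measurable_Pair measurable_compose[OF measurable_fst measurable_borel_cts_PiM]
        measurable_compose[OF measurable_snd measurable_borel_cts_PiM])
  from measurable_compose[OF this measurable_merge]
  show "merge S1 S2 \<in> measurable (borel_cts S1 \<Otimes>\<^sub>M borel_cts S2) (PiM (S1 \<union> S2) (\<lambda>_. borel))" by simp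
  show "merge S1 S2 x \<in> cts_on (S1 \<union> S2)" if "x \<in> space (borel_cts S1 \<Otimes>\<^sub>M borel_cts S2)" for x
    using that merge_cts_on[OF S(1,3,5)] by (auto simp: space_pair_measure)
qed

context max_stable_field
begin

section \<open>Joint and independent laws on finitely many coordinates\<close>

definition sample_path :: "'w \<Rightarrow> 't \<Rightarrow> real" where
  "sample_path \<omega> = (\<lambda>t. \<eta> t \<omega>)"

lemma measurable_sample_path [measurable]: "sample_path \<in> measurable M paths"
  unfolding sample_path_def by (rule measurable_path_PiM) measurable

lemma measurable_merge_paths:
  assumes "f \<in> measurable N paths" "g \<in> measurable N paths"
  shows "(\<lambda>x. merge S1 S2 (f x, g x)) \<in> measurable N (PiM (S1 \<union> S2) (\<lambda>_. borel))"
proof (rule measurable_PiM_single')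
  fix t assume "t \<in> S1 \<union> S2"
  then show "(\<lambda>x. merge S1 S2 (f x, g x) t) \<in> borel_measurable N"
    using assms[THEN measurable_PiM_UNIV_component, of t] by (auto simp: merge_def)
qed (auto simp: merge_def PiE_def extensional_def)

lemma merge_path_self: "merge S1 S2 (f, f) = restrict f (S1 \<union> S2)"
  by (auto simp: merge_def fun_eq_iff)

text \<open>This law and \<open>indep_law\<close> are images under the same \<open>merge\<close>,
  with equal and with independent arguments, so that one functional \<open>H\<close> covers both
  ends of the interpolation.\<close>

definition joint_law :: "'t set \<Rightarrow> 't set \<Rightarrow> ('t \<Rightarrow> real) measure" where
  "joint_law S1 S2 = distr M (PiM (S1 \<union> S2) (\<lambda>_. borel)) (\<lambda>\<omega>. merge S1 S2 (sample_path \<omega>, sample_path \<omega>))"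

definition indep_law :: "'t set \<Rightarrow> 't set \<Rightarrow> ('t \<Rightarrow> real) measure" where
  "indep_law S1 S2 = distr (M \<Otimes>\<^sub>M M) (PiM (S1 \<union> S2) (\<lambda>_. borel)) (\<lambda>x. merge S1 S2 (sample_path (fst x), sample_path (snd x)))"

lemma joint_law_measurable: "(\<lambda>\<omega>. merge S1 S2 (sample_path \<omega>, sample_path \<omega>)) \<in> measurable M (PiM (S1 \<union> S2) (\<lambda>_. borel))"
  by (intro measurable_merge_paths measurable_sample_path)

lemma indep_law_measurable: "(\<lambda>x. merge S1 S2 (sample_path (fst x), sample_path (snd x))) \<in> measurable (M \<Otimes>\<^sub>M M) (PiM (S1 \<union> S2) (\<lambda>_. borel))"
  by (intro measurable_merge_paths measurable_compose[OF _ measurable_sample_path] measurable_fst measurable_snd)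

lemma prob_space_joint_law: "prob_space (joint_law S1 S2)"
  unfolding joint_law_def by (rule prob_space_distr[OF joint_law_measurable])

lemma prob_space_indep_law: "prob_space (indep_law S1 S2)"
proof -
  interpret MM: pair_prob_space M M ..
  show ?thesis unfolding indep_law_def by (rule MM.prob_space_distr[OF indep_law_measurable])
qed

text \<open>Only a finite set \<open>F\<close> of coordinates matters, so each piece shrinks to
  \<open>F \<inter> A i\<close> and finitely many pieces suffice. \<open>pair_bound\<close> is
  monotone in both arguments, which leads back to the full compact pieces and to a bound free of
  \<open>F\<close>.\<close>

lemma finitely_determined_bound:
  assumes G: "G \<in> sets (PiM (S1 \<union> S2) (\<lambda>_. borel))" "finitely_determined (S1 \<union> S2) G"
    and A: "\<And>i. i \<in> I \<Longrightarrow> compact (A i)" "S1 = (\<Union>i\<in>I. A i)"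
    and B: "\<And>j. j \<in> J \<Longrightarrow> compact (B j)" "S2 = (\<Union>j\<in>J. B j)"
    and disj: "S1 \<inter> S2 = {}"
  defines "K \<equiv> 2 * (\<Sum>\<^sub>\<infinity>i\<in>I. \<Sum>\<^sub>\<infinity>j\<in>J. pair_bound (A i) (B j))"
  shows "emeasure (joint_law S1 S2) G \<le> emeasure (indep_law S1 S2) G + K"
    and "emeasure (indep_law S1 S2) G \<le> emeasure (joint_law S1 S2) G + K"
proof -
  obtain F where F: "finite F" "F \<subseteq> S1 \<union> S2"
      "\<And>f g. f \<in> extensional (S1 \<union> S2) \<Longrightarrow> g \<in> extensional (S1 \<union> S2) \<Longrightarrow> (\<forall>t\<in>F. f t = g t) \<Longrightarrow> (f \<in> G \<longleftrightarrow> g \<in> G)"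
    using G(2) unfolding finitely_determined_def by metis
  have "\<exists>i. i \<in> I \<and> t \<in> A i" if "t \<in> F \<inter> S1" for t using that A(2) by blast
  then obtain ii where ii: "\<And>t. t \<in> F \<inter> S1 \<Longrightarrow> ii t \<in> I \<and> t \<in> A (ii t)" by metis
  have "\<exists>j. j \<in> J \<and> t \<in> B j" if "t \<in> F \<inter> S2" for t using that B(2) by blast
  then obtain jj where jj: "\<And>t. t \<in> F \<inter> S2 \<Longrightarrow> jj t \<in> J \<and> t \<in> B (jj t)" by metis
  define I0 where "I0 = ii ` (F \<inter> S1)"
  define J0 where "J0 = jj ` (F \<inter> S2)"
  have I0: "finite I0" "I0 \<subseteq> I" and J0: "finite J0" "J0 \<subseteq> J"
    using F(1) ii jj by (auto simp: I0_def J0_def)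
  have UA: "(\<Union>i\<in>I0. F \<inter> A i) = F \<inter> S1"
  proof
    show "(\<Union>i\<in>I0. F \<inter> A i) \<subseteq> F \<inter> S1" using I0(2) A(2) by blast
    show "F \<inter> S1 \<subseteq> (\<Union>i\<in>I0. F \<inter> A i)" using ii by (auto simp: I0_def)
  qed
  have UB: "(\<Union>j\<in>J0. F \<inter> B j) = F \<inter> S2"
  proof
    show "(\<Union>j\<in>J0. F \<inter> B j) \<subseteq> F \<inter> S2" using J0(2) B(2) by blast
    show "F \<inter> S2 \<subseteq> (\<Union>j\<in>J0. F \<inter> B j)" using jj by (auto simp: J0_def)
  qed
  define H :: "('t \<Rightarrow> real) \<Rightarrow> ('t \<Rightarrow> real) \<Rightarrow> ennreal" where "H f g = indicator G (merge S1 S2 (f, g))" for f g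
  have mem: "merge S1 S2 (f, g) \<in> G \<longleftrightarrow> merge S1 S2 (f', g') \<in> G"
    if "\<forall>t\<in>F \<inter> S1. f t = f' t" "\<forall>t\<in>F \<inter> S2. g t = g' t" for f g f' g'
    using that F(2) by (intro F(3)) (auto simp: merge_def extensional_def)
  have Hdep: "depends_on H (\<Union>i\<in>I0. F \<inter> A i) (\<Union>j\<in>J0. F \<inter> B j)"
  proof -
    have ind: "indicator G f = (indicator G g :: ennreal)" if "f \<in> G \<longleftrightarrow> g \<in> G" for f g
      using that by (simp add: indicator_def)
    show ?thesis unfolding depends_on_def UA UB H_def by (intro allI impI ind mem)
  qed
  have Hm: "bimeasurable H"
    unfolding bimeasurable_def H_def
    by (rule measurable_compose[OF measurable_merge_paths[OF measurable_fst measurable_snd]])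
      (rule borel_measurable_indicator[OF G(1)])
  have H1: "H f g \<le> 1" for f g by (simp add: H_def indicator_def)
  have FA: "finite (F \<inter> A i)" "finite (F \<inter> B j)" for i j using F(1) by auto
  have pb: "pair_bound (F \<inter> A i) (F \<inter> B j) \<le> pair_bound (A i) (B j)" if "i \<in> I" "j \<in> J" for i j
    unfolding pair_bound_def
    using A(1)[OF that(1)] B(1)[OF that(2)] FA
    by (intro mult_mono add_mono inv_sup_expectation_mono ennreal_leI dependence_mono)
      (auto intro: finite_imp_compact)
  have "(\<Sum>i\<in>I0. \<Sum>j\<in>J0. pair_bound (F \<inter> A i) (F \<inter> B j)) \<le> (\<Sum>i\<in>I0. \<Sum>j\<in>J0. pair_bound (A i) (B j))"
    using I0 J0 by (intro sum_mono pb) auto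
  also have "\<dots> \<le> (\<Sum>i\<in>I0. \<Sum>\<^sub>\<infinity>j\<in>J. pair_bound (A i) (B j))"
    using J0 by (intro sum_mono finite_sum_le_infsum_ennreal)
  also have "\<dots> \<le> (\<Sum>\<^sub>\<infinity>i\<in>I. \<Sum>\<^sub>\<infinity>j\<in>J. pair_bound (A i) (B j))"
    using I0 by (intro finite_sum_le_infsum_ennreal)
  finally have K: "2 * (\<Sum>i\<in>I0. \<Sum>j\<in>J0. pair_bound (F \<inter> A i) (F \<inter> B j)) \<le> K"
    unfolding K_def by (intro mult_left_mono) auto
  \<comment> \<open>Equality holds almost surely at each single \<open>t\<close>, hence
    simultaneously on the finite \<open>F\<close>.\<close>
  have ae: "AE \<omega> in M. \<forall>t\<in>F. pos_path \<omega> t = sample_path \<omega> t"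
    using F(1) pos_path_AE unfolding sample_path_def by (subst AE_finite_all) auto
  have Heq: "H (pos_path \<omega>) (pos_path \<omega>') = H (sample_path \<omega>) (sample_path \<omega>')"
    if "\<forall>t\<in>F. pos_path \<omega> t = sample_path \<omega> t" "\<forall>t\<in>F. pos_path \<omega>' t = sample_path \<omega>' t" for \<omega> \<omega>'
    using that by (intro depends_onD[OF Hdep]) auto
  have "(\<integral>\<^sup>+\<omega>. H (pos_path \<omega>) (pos_path \<omega>) \<partial>M) = (\<integral>\<^sup>+\<omega>. H (sample_path \<omega>) (sample_path \<omega>) \<partial>M)"
    by (rule nn_integral_cong_AE, use ae in eventually_elim) (rule Heq)
  also have "\<dots> = (\<integral>\<^sup>+f. indicator G f \<partial>joint_law S1 S2)"
    unfolding joint_law_def H_def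
    by (subst nn_integral_distr[OF joint_law_measurable]) (use G(1) in auto)
  also have "\<dots> = emeasure (joint_law S1 S2) G"
    using G(1) by (intro nn_integral_indicator) (simp add: joint_law_def)
  finally have joint: "(\<integral>\<^sup>+\<omega>. H (pos_path \<omega>) (pos_path \<omega>) \<partial>M) = emeasure (joint_law S1 S2) G" .
  have "(\<integral>\<^sup>+\<omega>. \<integral>\<^sup>+\<omega>'. H (pos_path \<omega>) (pos_path \<omega>') \<partial>M \<partial>M) = (\<integral>\<^sup>+\<omega>. \<integral>\<^sup>+\<omega>'. H (sample_path \<omega>) (sample_path \<omega>') \<partial>M \<partial>M)"
  proof (rule nn_integral_cong_AE, use ae in eventually_elim)
    fix \<omega> assume \<omega>: "\<forall>t\<in>F. pos_path \<omega> t = sample_path \<omega> t"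
    show "(\<integral>\<^sup>+\<omega>'. H (pos_path \<omega>) (pos_path \<omega>') \<partial>M) = (\<integral>\<^sup>+\<omega>'. H (sample_path \<omega>) (sample_path \<omega>') \<partial>M)"
      by (rule nn_integral_cong_AE, use ae in eventually_elim) (rule Heq[OF \<omega>])
  qed
  also have "\<dots> = (\<integral>\<^sup>+x. H (sample_path (fst x)) (sample_path (snd x)) \<partial>(M \<Otimes>\<^sub>M M))"
  proof -
    have "(\<lambda>x. H (sample_path (fst x)) (sample_path (snd x))) \<in> borel_measurable (M \<Otimes>\<^sub>M M)"
      by (intro bimeasurableD[OF Hm] measurable_compose[OF _ measurable_sample_path] measurable_fst measurable_snd)
    from nn_integral_fst[OF this] show ?thesis by simp
  qed
  also have "\<dots> = (\<integral>\<^sup>+f. indicator G f \<partial>indep_law S1 S2)"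
    unfolding indep_law_def H_def
    by (subst nn_integral_distr[OF indep_law_measurable]) (use G(1) in auto)
  also have "\<dots> = emeasure (indep_law S1 S2) G"
    using G(1) by (intro nn_integral_indicator) (simp add: indep_law_def)
  finally have indep: "(\<integral>\<^sup>+\<omega>. \<integral>\<^sup>+\<omega>'. H (pos_path \<omega>) (pos_path \<omega>') \<partial>M \<partial>M) = emeasure (indep_law S1 S2) G" .
  show "emeasure (joint_law S1 S2) G \<le> emeasure (indep_law S1 S2) G + K"
    using order_trans[OF lindeberg_bound(1)[OF Hm H1 Hdep I0(1) FA(1) J0(1) FA(2)] add_left_mono[OF K]]
    unfolding joint indep .
  show "emeasure (indep_law S1 S2) G \<le> emeasure (joint_law S1 S2) G + K"
    using order_trans[OF lindeberg_bound(2)[OF Hm H1 Hdep I0(1) FA(1) J0(1) FA(2)] add_left_mono[OF K]]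
    unfolding joint indep .
qed

text \<open>The bound for cylinder sets is uniform in the number of coordinates, so approximation of
  \<open>E\<close> under both laws at once costs only an arbitrary \<open>e\<close>.\<close>

lemma law_difference_bound:
  assumes E: "E \<in> sets (PiM (S1 \<union> S2) (\<lambda>_. borel))"
    and A: "\<And>i. i \<in> I \<Longrightarrow> compact (A i)" "S1 = (\<Union>i\<in>I. A i)"
    and B: "\<And>j. j \<in> J \<Longrightarrow> compact (B j)" "S2 = (\<Union>j\<in>J. B j)"
    and disj: "S1 \<inter> S2 = {}"
    and k: "k \<ge> 0" "2 * (\<Sum>\<^sub>\<infinity>i\<in>I. \<Sum>\<^sub>\<infinity>j\<in>J. pair_bound (A i) (B j)) = ennreal k"
  shows "\<bar>measure (joint_law S1 S2) E - measure (indep_law S1 S2) E\<bar> \<le> k"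
proof (rule field_le_epsilon)
  fix e :: real assume e: "e > 0"
  interpret P: prob_space "joint_law S1 S2" by (rule prob_space_joint_law)
  interpret Q: prob_space "indep_law S1 S2" by (rule prob_space_indep_law)
  have sP: "sets (joint_law S1 S2) = sets (PiM (S1 \<union> S2) (\<lambda>_. borel))" by (simp add: joint_law_def)
  have sQ: "sets (indep_law S1 S2) = sets (PiM (S1 \<union> S2) (\<lambda>_. borel))" by (simp add: indep_law_def)
  have "e / 2 > 0" using e by simp
  from PiM_approx_finitely_determined[OF P.finite_measure_axioms sP Q.finite_measure_axioms sQ E this]
  obtain G where G: "G \<in> sets (PiM (S1 \<union> S2) (\<lambda>_. borel))" "finitely_determined (S1 \<union> S2) G"
    "measure (joint_law S1 S2) (sym_diff E G) < e / 2" "measure (indep_law S1 S2) (sym_diff E G) < e / 2" by blast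
  have "ennreal (measure (joint_law S1 S2) G) \<le> ennreal (measure (indep_law S1 S2) G + k)"
    and "ennreal (measure (indep_law S1 S2) G) \<le> ennreal (measure (joint_law S1 S2) G + k)"
    using finitely_determined_bound[OF G(1,2) A B disj] k
    by (simp_all add: P.emeasure_eq_measure Q.emeasure_eq_measure)
  then have d: "\<bar>measure (joint_law S1 S2) G - measure (indep_law S1 S2) G\<bar> \<le> k"
    using k(1) by (subst (asm) (1 2) ennreal_le_iff) auto
  have close: "\<bar>measure N E - measure N G\<bar> \<le> measure N (sym_diff E G)"
    if N: "prob_space N" "sets N = sets (PiM (S1 \<union> S2) (\<lambda>_. borel))" for N
  proof -
    interpret N: prob_space N by fact
    have EG: "E \<in> sets N" "G \<in> sets N" using E G N(2) by auto
    have "measure N E \<le> measure N G + measure N (sym_diff E G)"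
      using EG by (intro order_trans[OF N.finite_measure_mono measure_Un_le]) auto
    moreover have "measure N G \<le> measure N E + measure N (sym_diff E G)"
      using EG by (intro order_trans[OF N.finite_measure_mono measure_Un_le]) auto
    ultimately show ?thesis by linarith
  qed
  show "\<bar>measure (joint_law S1 S2) E - measure (indep_law S1 S2) E\<bar> \<le> k + e"
    using close[OF P.prob_space_axioms sP] close[OF Q.prob_space_axioms sQ] d G(3,4) by linarith
qed

lemma restrict_path_measurable:
  assumes lc: "locally_compact_space (euclidean :: 't topology)" and S: "closed S" "sigma_compact S"
  shows "(\<lambda>\<omega>. restrict (sample_path \<omega>) S) \<in> measurable M (borel_cts S)"
proof (rule measurable_borel_ctsI[OF lc S])
  show "(\<lambda>\<omega>. restrict (sample_path \<omega>) S) \<in> measurable M (PiM S (\<lambda>_. borel))"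
    by (rule measurable_PiM_single') (auto simp: sample_path_def)
  show "restrict (sample_path \<omega>) S \<in> cts_on S" if "\<omega> \<in> space M" for \<omega>
    using continuous_on_subset[OF eta_continuous[OF that], of S]
    by (auto simp: cts_on_def sample_path_def cong: continuous_on_cong)
qed

lemma mixing_coeff_bound:
  assumes lc: "locally_compact_space (euclidean :: 't topology)"
    and I: "countable I" and J: "countable J"
    and A: "\<And>i. i \<in> I \<Longrightarrow> compact (A i)" "S1 = (\<Union>i\<in>I. A i)" "closed S1"
    and B: "\<And>j. j \<in> J \<Longrightarrow> compact (B j)" "S2 = (\<Union>j\<in>J. B j)" "closed S2"
    and disj: "S1 \<inter> S2 = {}"
  shows "ennreal (mixing_coeff M \<eta> S1 S2) \<le> 2 * (\<Sum>\<^sub>\<infinity>i\<in>I. \<Sum>\<^sub>\<infinity>j\<in>J. pair_bound (A i) (B j))"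
proof (cases "2 * (\<Sum>\<^sub>\<infinity>i\<in>I. \<Sum>\<^sub>\<infinity>j\<in>J. pair_bound (A i) (B j))")
  case (real k)
  have sc: "sigma_compact S1" "sigma_compact S2"
    using sigma_compact_UN I J A B by blast+
  have cU: "closed (S1 \<union> S2)" "sigma_compact (S1 \<union> S2)" using A(3) B(3) sc sigma_compact_Un by auto
  note r1 = restrict_path_measurable[OF lc A(3) sc(1)] and r2 = restrict_path_measurable[OF lc B(3) sc(2)]
    and r12 = restrict_path_measurable[OF lc cU]
  note mm = measurable_merge_borel_cts[OF lc A(3) sc(1) B(3) sc(2) disj]
  have rl: "restr_law M \<eta> S = distr M (borel_cts S) (\<lambda>\<omega>. restrict (sample_path \<omega>) S)" for S
    by (simp add: restr_law_def sample_path_def)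
  interpret MM: pair_prob_space M M ..
  have "prob_space (restr_law M \<eta> S2)" unfolding rl by (rule prob_space_distr[OF r2])
  then have "sigma_finite_measure (distr M (borel_cts S2) (\<lambda>\<omega>. restrict (sample_path \<omega>) S2))"
    unfolding rl by (rule prob_space_imp_sigma_finite)
  \<comment> \<open>The product of the two restricted laws is realised by two independent paths on
    \<open>M \<Otimes>\<^sub>M M\<close>.\<close>
  then have pm: "restr_law M \<eta> S1 \<Otimes>\<^sub>M restr_law M \<eta> S2 = distr (M \<Otimes>\<^sub>M M) (borel_cts S1 \<Otimes>\<^sub>M borel_cts S2)
      (\<lambda>(\<omega>, \<omega>'). (restrict (sample_path \<omega>) S1, restrict (sample_path \<omega>') S2))"
    unfolding rl by (rule pair_measure_distr[OF r1 r2])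
  have rm: "(\<lambda>(\<omega>, \<omega>'). (restrict (sample_path \<omega>) S1, restrict (sample_path \<omega>') S2))
      \<in> measurable (M \<Otimes>\<^sub>M M) (borel_cts S1 \<Otimes>\<^sub>M borel_cts S2)"
    unfolding case_prod_unfold
    by (intro measurable_Pair measurable_compose[OF measurable_fst r1] measurable_compose[OF measurable_snd r2])
  have merge_r: "merge S1 S2 (restrict f S1, restrict g S2) = merge S1 S2 (f, g)" for f g :: "'t \<Rightarrow> real"
    by (auto simp: merge_def fun_eq_iff)
  have prod: "distr (restr_law M \<eta> S1 \<Otimes>\<^sub>M restr_law M \<eta> S2) (borel_cts (S1 \<union> S2)) (merge S1 S2)
      = distr (M \<Otimes>\<^sub>M M) (borel_cts (S1 \<union> S2)) (\<lambda>x. merge S1 S2 (sample_path (fst x), sample_path (snd x)))"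
    unfolding pm by (subst distr_distr[OF mm rm]) (simp add: comp_def case_prod_unfold merge_r)
  have pmm: "(\<lambda>x. merge S1 S2 (sample_path (fst x), sample_path (snd x))) \<in> measurable (M \<Otimes>\<^sub>M M) (borel_cts (S1 \<union> S2))"
    using measurable_compose[OF rm mm] by (simp add: case_prod_unfold merge_r)
  have "mixing_coeff M \<eta> S1 S2 \<le> k"
    unfolding mixing_coeff_def
  proof (rule cSUP_least)
    fix C assume C: "C \<in> sets (borel_cts (S1 \<union> S2))"
    then obtain E where E: "E \<in> sets (PiM (S1 \<union> S2) (\<lambda>_. borel))" "C = E \<inter> cts_on (S1 \<union> S2)"
      by (rule borel_cts_trace_sigma_compact[OF lc cU])
    have "measure (restr_law M \<eta> (S1 \<union> S2)) C = measure M ((\<lambda>\<omega>. restrict (sample_path \<omega>) (S1 \<union> S2)) -` C \<inter> space M)"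
      unfolding rl by (rule measure_distr[OF r12 C])
    \<comment> \<open>Restricted paths are continuous on the union, so \<open>C\<close> and
      \<open>E\<close> are the same event for them.\<close>
    also have "(\<lambda>\<omega>. restrict (sample_path \<omega>) (S1 \<union> S2)) -` C \<inter> space M = (\<lambda>\<omega>. merge S1 S2 (sample_path \<omega>, sample_path \<omega>)) -` E \<inter> space M"
      using measurable_space[OF r12] unfolding E(2) merge_path_self by auto
    also have "measure M \<dots> = measure (joint_law S1 S2) E"
      unfolding joint_law_def by (rule measure_distr[OF joint_law_measurable E(1), symmetric])
    finally have 1: "measure (restr_law M \<eta> (S1 \<union> S2)) C = measure (joint_law S1 S2) E" .
    have "measure (distr (restr_law M \<eta> S1 \<Otimes>\<^sub>M restr_law M \<eta> S2) (borel_cts (S1 \<union> S2)) (merge S1 S2)) C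
        = measure (M \<Otimes>\<^sub>M M) ((\<lambda>x. merge S1 S2 (sample_path (fst x), sample_path (snd x))) -` C \<inter> space (M \<Otimes>\<^sub>M M))"
      unfolding prod by (rule measure_distr[OF pmm C])
    also have "(\<lambda>x. merge S1 S2 (sample_path (fst x), sample_path (snd x))) -` C \<inter> space (M \<Otimes>\<^sub>M M)
        = (\<lambda>x. merge S1 S2 (sample_path (fst x), sample_path (snd x))) -` E \<inter> space (M \<Otimes>\<^sub>M M)"
      using measurable_space[OF pmm] unfolding E(2) by auto
    also have "measure (M \<Otimes>\<^sub>M M) \<dots> = measure (indep_law S1 S2) E"
      unfolding indep_law_def by (rule measure_distr[OF indep_law_measurable E(1), symmetric])
    finally have 2: "measure (distr (restr_law M \<eta> S1 \<Otimes>\<^sub>M restr_law M \<eta> S2) (borel_cts (S1 \<union> S2)) (merge S1 S2)) C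
        = measure (indep_law S1 S2) E" .
    show "\<bar>measure (restr_law M \<eta> (S1 \<union> S2)) C - measure (distr (restr_law M \<eta> S1 \<Otimes>\<^sub>M restr_law M \<eta> S2)
        (borel_cts (S1 \<union> S2)) (merge S1 S2)) C\<bar> \<le> k"
      unfolding 1 2 by (rule law_difference_bound[OF E(1) A(1,2) B(1,2) disj real])
  qed (use sets.empty_sets in blast)
  then show ?thesis unfolding real(2) by (rule ennreal_leI)
qed simp

end

theorem theorem2p2:
  fixes M :: "'w measure" and \<eta> :: "'t::metric_space \<Rightarrow> 'w \<Rightarrow> real"
  assumes "locally_compact_space (euclidean :: 't topology)"
    and "simple_max_stable M \<eta>"
  defines "C \<equiv> inv_sup_expectation M \<eta>"
    and "\<theta> \<equiv> extremal_coeff M \<eta>"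
    and "\<beta> \<equiv> mixing_coeff M \<eta>"
  shows "(\<forall>S. compact S \<longrightarrow> C S < \<infinity>) \<and>
    (\<forall>S1 S2. compact S1 \<and> compact S2 \<and> S1 \<inter> S2 = {} \<longrightarrow>
       \<beta> S1 S2 \<le> 2 * (enn2real (C S1) + enn2real (C S2)) * (\<theta> S1 + \<theta> S2 - \<theta> (S1 \<union> S2))) \<and>
    (\<forall>(I :: 'i set) (J :: 'j set) A B.
       countable I \<and> countable J \<and>
       (\<forall>i\<in>I. compact (A i)) \<and> (\<forall>j\<in>J. compact (B j)) \<and>
       closed (\<Union>i\<in>I. A i) \<and> closed (\<Union>j\<in>J. B j) \<and>
       (\<Union>i\<in>I. A i) \<inter> (\<Union>j\<in>J. B j) = {} \<longrightarrow>
       ennreal (\<beta> (\<Union>i\<in>I. A i) (\<Union>j\<in>J. B j))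
         \<le> 2 * (\<Sum>\<^sub>\<infinity>i\<in>I. \<Sum>\<^sub>\<infinity>j\<in>J.
               (C (A i) + C (B j)) * ennreal (\<theta> (A i) + \<theta> (B j) - \<theta> (A i \<union> B j))))"
proof -
  interpret max_stable_field M \<eta> by (rule max_stable_field.intro[OF assms(2)])
  have compact_case: "\<beta> S1 S2 \<le> 2 * (enn2real (C S1) + enn2real (C S2)) * (\<theta> S1 + \<theta> S2 - \<theta> (S1 \<union> S2))"
    if S: "compact S1" "compact S2" "S1 \<inter> S2 = {}" for S1 S2
  proof -
    have dn: "0 \<le> dependence S1 S2" by (rule dependence_nonneg[OF S(1,2)])
    \<comment> \<open>By finiteness nothing is lost under \<open>enn2real\<close>, which would send
      infinity to 0.\<close>
    have c: "C S = ennreal (enn2real (C S))" if "compact S" for S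
      using inv_sup_expectation_finite[OF that] by (simp add: C_def ennreal_enn2real)
    \<comment> \<open>The countable bound with a single piece on either side.\<close>
    have "ennreal (\<beta> S1 S2) \<le> 2 * (\<Sum>\<^sub>\<infinity>i\<in>{()}. \<Sum>\<^sub>\<infinity>j\<in>{()}. pair_bound S1 S2)"
      unfolding \<beta>_def
      by (rule mixing_coeff_bound[OF assms(1), where A = "\<lambda>_. S1" and B = "\<lambda>_. S2"])
        (use S compact_imp_closed in auto)
    also have "\<dots> = 2 * ((C S1 + C S2) * ennreal (dependence S1 S2))" by (simp add: pair_bound_def C_def)
    also have "\<dots> = ennreal (2 * (enn2real (C S1) + enn2real (C S2)) * dependence S1 S2)"
    proof -
      have "2 * ((ennreal a + ennreal b) * ennreal d) = ennreal (2 * (a + b) * d)"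
        if "a \<ge> 0" "b \<ge> 0" "d \<ge> 0" for a b d
      proof -
        have "ennreal (2 * ((a + b) * d)) = ennreal 2 * (ennreal (a + b) * ennreal d)"
          using that by (simp only: ennreal_mult zero_le_numeral add_nonneg_nonneg mult_nonneg_nonneg)
        then show ?thesis using that by (simp only: mult.assoc ennreal_plus ennreal_numeral)
      qed
      from this[OF _ _ dn] show ?thesis
        by (subst c[OF S(1)], subst c[OF S(2)]) simp
    qed
    finally show ?thesis using dn by (simp add: ennreal_le_iff dependence_def \<theta>_def)
  qed
  have countable_case: "ennreal (\<beta> (\<Union>i\<in>I. A i) (\<Union>j\<in>J. B j)) \<le> 2 * (\<Sum>\<^sub>\<infinity>i\<in>I. \<Sum>\<^sub>\<infinity>j\<in>J.
      (C (A i) + C (B j)) * ennreal (\<theta> (A i) + \<theta> (B j) - \<theta> (A i \<union> B j)))"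
    if "countable I" "countable J" "\<forall>i\<in>I. compact (A i)" "\<forall>j\<in>J. compact (B j)"
      "closed (\<Union>i\<in>I. A i)" "closed (\<Union>j\<in>J. B j)" "(\<Union>i\<in>I. A i) \<inter> (\<Union>j\<in>J. B j) = {}"
    for I :: "'i set" and J :: "'j set" and A B
    using mixing_coeff_bound[OF assms(1) that(1,2) _ refl that(5) _ refl that(6,7)] that(3,4)
    unfolding \<beta>_def C_def \<theta>_def pair_bound_def dependence_def by blast
  show ?thesis
  proof (intro conjI allI impI)
    show "C S < \<infinity>" if "compact S" for S
      unfolding C_def using that by (rule inv_sup_expectation_finite)
  qed (elim conjE, rule compact_case countable_case; assumption)+
qed

end
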